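(* Let $(E,\langle\cdot,\cdot\rangle,[\cdot,\cdot],\rho)$ be a Courant algebroid over a manifold $M$ (bracket version, as defined in the context), with associated operator $\mathcal D:C^\infty(M)\to\Gamma(E)$ and function $T$. Let $X=X_0\oplus X_1\oplus X_2$ be the graded vector space with $X_0=\Gamma(E)$, $X_1=C^\infty(M)$, $X_2=\ker\mathcal D$ (and $X_k=0$ otherwise), with differential $d$ given by $d_1=\mathcal D:X_1\to X_0$ and $d_2=\iota:X_2=\ker \mathcal D\hookrightarrow X_1$ (the inclusion), so that $X$ is a resolution of $H=\operatorname{coker}\mathcal D$. Denote elements of $X_0$ by $e,e_i$, and elements of $X_1$ by $f$. Then the following maps define a strongly homotopy Lie algebra ($L_\infty$-algebra) structure on $X$: $l_1=d$ and $$\begin{array}{lll} l_2(e_1\wedge e_2)=[e_1,e_2] & & \text{in degree }0,\\ l_2(e\wedge f)=\tfrac12\langle e,\mathcal D f\rangle & & \text{in degree }1,\\ l_2=0 & & \text{in degree }>1,\\ l_3(e_1\wedge e_2\wedge e_3)=-T(e_1,e_2,e_3) & & \text{in degree }0,\\ l_3=0 & & \text{in degree }>0,\\ l_n=0 & & \text{for } n>3, \end{array}$$ where "degree" refers to the total degree of the argument in $\bigwedge X$.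
   Context: Manifolds are smooth and real. A Courant algebroid (bracket version) is a vector bundle $E\to M$ with a nondegenerate symmetric bilinear form $\langle\cdot,\cdot\rangle$ on the bundle, a skew-symmetric $\mathbb R$-bilinear bracket $[\cdot,\cdot]$ on $\Gamma(E)$ and a bundle map $\rho:E\to TM$. Define $\mathcal D:C^\infty(M)\to\Gamma(E)$ by $\langle\mathcal Df,e\rangle=\rho(e)f$, the Jacobiator $J(e_1,e_2,e_3)=[[e_1,e_2],e_3]+[[e_2,e_3],e_1]+[[e_3,e_1],e_2]$, and $T(e_1,e_2,e_3)=\frac16\big(\langle[e_1,e_2],e_3\rangle+\langle[e_2,e_3],e_1\rangle+\langle[e_3,e_1],e_2\rangle\big)\in C^\infty(M)$. The axioms are, for all sections and all $f,g\in C^\infty(M)$: 1. $J(e_1,e_2,e_3)=\mathcal D T(e_1,e_2,e_3)$; 2. $\rho[e_1,e_2]=[\rho e_1,\rho e_2]$; 3. $[e_1,fe_2]=f[e_1,e_2]+(\rho(e_1)f)e_2-\frac12\langle e_1,e_2\rangle\mathcal Df$; 4. $\rho\circ\mathcal D=0$, i.e. $\langle\mathcal Df,\mathcal Dg\rangle=0$; 5. $\rho(e)\langle h_1,h_2\rangle=\langle[e,h_1]+\frac12\mathcal D\langle e,h_1\rangle,h_2\rangle+\langle h_1,[e,h_2]+\frac12\mathcal D\langle e,h_2\rangle\rangle$. For a graded vector space $V$, $\bigwedge V=T(V)/\langle v\otimes w+(-1)^{\tilde v\tilde w}w\otimes v\rangle$, where $\tilde v$ is the degree of $v$. A strongly homotopy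 Lie algebra ($L_\infty$-algebra) is a graded vector space $V$ with linear maps $l_k:\bigwedge^kV\to V$ of degree $k-2$, $k\ge1$, such that for each $n\ge1$ and all homogeneous $x_1,\dots,x_n$: $$\sum_{i+j=n+1}(-1)^{i(j-1)}\sum_\sigma(-1)^\sigma\epsilon(\sigma)\,l_j(l_i(x_{\sigma(1)},\dots,x_{\sigma(i)}),x_{\sigma(i+1)},\dots,x_{\sigma(n)})=0,$$ where $\sigma$ runs over $(i,n-i)$-unshuffles ($\sigma(1)<\dots<\sigma(i)$, $\sigma(i+1)<\dots<\sigma(n)$), $i\ge1$, $(-1)^\sigma$ is the sign of $\sigma$, and $\epsilon(\sigma)$ is the Koszul sign (a minus sign is introduced whenever two consecutive odd elements are permuted). *)

theory Defs
  imports
    "HOL-Analysis.Analysis"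
    "HOL-Library.Function_Algebras"
    "HOL-Combinatorics.Permutations"
begin

text \<open>Pointwise operations make functions into a real vector space (addition is provided by
  \<open>Function_Algebras\<close>).\<close>

instantiation "fun" :: (type, real_vector) real_vector
begin

definition scaleR_fun :: "real \<Rightarrow> ('a \<Rightarrow> 'b) \<Rightarrow> 'a \<Rightarrow> 'b"
  where "scaleR_fun a f = (\<lambda>x. a *\<^sub>R f x)"

instance
  by standard (simp_all add: scaleR_fun_def fun_eq_iff algebra_simps)

end


section \<open>Smooth functions on open subsets of Euclidean space\<close>

text \<open>Euclidean n-space is \<open>Euclidean_space n\<close>, whose points are the \<open>x :: nat \<Rightarrow> real\<close> with
  \<open>x i = 0\<close> for \<open>i \<ge> n\<close>; unlike a type of class \<open>euclidean_space\<close> it includes \<open>n = 0\<close>, hence the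
  Courant algebroids over a point.  The sets \<open>V\<close> below are meant to be open in it.\<close>

definition partial_deriv :: "nat \<Rightarrow> ((nat \<Rightarrow> real) \<Rightarrow> real) \<Rightarrow> (nat \<Rightarrow> real) \<Rightarrow> real"
  where "partial_deriv i f x = deriv (\<lambda>t. f (x(i := t))) (x i)"

fun Ck_on :: "nat \<Rightarrow> nat \<Rightarrow> (nat \<Rightarrow> real) set \<Rightarrow> ((nat \<Rightarrow> real) \<Rightarrow> real) \<Rightarrow> bool" where
  "Ck_on n 0 V f \<longleftrightarrow> continuous_on V f"
| "Ck_on n (Suc k) V f \<longleftrightarrow> continuous_on V f \<and>
     (\<forall>i<n. (\<forall>x\<in>V. (\<lambda>t. f (x(i := t))) differentiable (at (x i))) \<and>
            Ck_on n k V (partial_deriv i f))"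

definition Cinf_on :: "nat \<Rightarrow> (nat \<Rightarrow> real) set \<Rightarrow> ((nat \<Rightarrow> real) \<Rightarrow> real) \<Rightarrow> bool"
  where "Cinf_on n V f \<longleftrightarrow> (\<forall>k. Ck_on n k V f)"


section \<open>Smooth manifolds\<close>

text \<open>The underlying set of the manifold is the whole type \<open>'m\<close>.  A chart is a pair \<open>(U, \<phi>)\<close> of its
  domain and its coordinate map; the values of \<open>\<phi>\<close> outside \<open>U\<close> are irrelevant.\<close>

record 'm manifold =
  mdim :: nat
  atlas :: "('m set \<times> ('m \<Rightarrow> nat \<Rightarrow> real)) set"

definition smooth_manifold :: "('m::{t2_space, second_countable_topology}) manifold \<Rightarrow> bool" where
  "smooth_manifold M \<longleftrightarrow>
     (\<forall>(U, \<phi>) \<in> atlas M. open U \<and> openin (Euclidean_space (mdim M)) (\<phi> ` U) \<and>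
        homeomorphism U (\<phi> ` U) \<phi> (inv_into U \<phi>)) \<and>
     (\<Union>(U, \<phi>) \<in> atlas M. U) = UNIV \<and>
     (\<forall>(U, \<phi>) \<in> atlas M. \<forall>(V, \<psi>) \<in> atlas M. \<forall>i<mdim M.
        Cinf_on (mdim M) (\<phi> ` (U \<inter> V)) (\<lambda>y. \<psi> (inv_into U \<phi> y) i))"

definition smooth_on :: "'m manifold \<Rightarrow> 'm set \<Rightarrow> ('m \<Rightarrow> real) \<Rightarrow> bool" where
  "smooth_on M W f \<longleftrightarrow>
     (\<forall>(U, \<phi>) \<in> atlas M. Cinf_on (mdim M) (\<phi> ` (U \<inter> W)) (\<lambda>y. f (inv_into U \<phi> y)))"

definition smooth_functions :: "'m manifold \<Rightarrow> ('m \<Rightarrow> real) set"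
  where "smooth_functions M = {f. smooth_on M UNIV f}"

text \<open>Tangent vectors at \<open>p\<close> are the point derivations of the algebra of smooth functions at \<open>p\<close>,
  normalised to vanish on non-smooth functions so that equality of tangent vectors is equality.\<close>

definition tangent_space :: "'m manifold \<Rightarrow> 'm \<Rightarrow> (('m \<Rightarrow> real) \<Rightarrow> real) set" where
  "tangent_space M p = {v.
     (\<forall>f\<in>smooth_functions M. \<forall>g\<in>smooth_functions M. \<forall>a b.
        v (\<lambda>x. a * f x + b * g x) = a * v f + b * v g) \<and>
     (\<forall>f\<in>smooth_functions M. \<forall>g\<in>smooth_functions M.
        v (\<lambda>x. f x * g x) = v f * g p + f p * v g) \<and>
     (\<forall>f. f \<notin> smooth_functions M \<longrightarrow> v f = 0)}"

text \<open>A section of the tangent bundle is smooth iff it takes smooth functions to smooth functions,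
  which avoids an explicit atlas on the tangent bundle.\<close>

definition smooth_vector_field_on ::
    "'m manifold \<Rightarrow> 'm set \<Rightarrow> ('m \<Rightarrow> ('m \<Rightarrow> real) \<Rightarrow> real) \<Rightarrow> bool" where
  "smooth_vector_field_on M W X \<longleftrightarrow>
     (\<forall>p\<in>W. X p \<in> tangent_space M p) \<and>
     (\<forall>f\<in>smooth_functions M. smooth_on M W (\<lambda>p. X p f))"

definition lie_bracket ::
    "'m manifold \<Rightarrow> ('m \<Rightarrow> ('m \<Rightarrow> real) \<Rightarrow> real) \<Rightarrow> ('m \<Rightarrow> ('m \<Rightarrow> real) \<Rightarrow> real)
       \<Rightarrow> 'm \<Rightarrow> ('m \<Rightarrow> real) \<Rightarrow> real" where
  "lie_bracket M X Y = (\<lambda>p f.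
     if f \<in> smooth_functions M then X p (\<lambda>q. Y q f) - Y p (\<lambda>q. X q f) else 0)"


section \<open>Vector bundles\<close>

text \<open>The fibre over \<open>x\<close> is a subspace of an auxiliary vector space \<open>'v\<close> (of arbitrary dimension;
  the direct sum of all fibres serves for any given bundle).  A local trivialisation is a pair
  \<open>(W, t)\<close> where \<open>t x\<close>, for \<open>x \<in> W\<close>, is a linear isomorphism from the fibre over \<open>x\<close> to
  \<open>Euclidean_space r\<close>, with \<open>r\<close> the rank.\<close>

record ('m, 'v) vbundle =
  rank :: nat
  fibre :: "'m \<Rightarrow> 'v set"
  trivs :: "('m set \<times> ('m \<Rightarrow> 'v \<Rightarrow> nat \<Rightarrow> real)) set"

definition frame ::
    "('m, 'v, 'z) vbundle_scheme \<Rightarrow> ('m \<Rightarrow> 'v \<Rightarrow> nat \<Rightarrow> real) \<Rightarrow> nat \<Rightarrow> 'm \<Rightarrow> 'v" where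
  "frame E t j x = inv_into (fibre E x) (t x) (\<lambda>i. if i = j then 1 else 0)"

definition vector_bundle ::
    "('m::topological_space) manifold \<Rightarrow> ('m, 'v::real_vector, 'z) vbundle_scheme \<Rightarrow> bool" where
  "vector_bundle M E \<longleftrightarrow>
     (\<forall>x. subspace (fibre E x)) \<and>
     (\<forall>(W, t) \<in> trivs E. open W \<and>
        (\<forall>x\<in>W. bij_betw (t x) (fibre E x) (topspace (Euclidean_space (rank E))) \<and>
           (\<forall>v\<in>fibre E x. \<forall>w\<in>fibre E x. \<forall>a b.
              t x (a *\<^sub>R v + b *\<^sub>R w) = a *\<^sub>R t x v + b *\<^sub>R t x w))) \<and>
     (\<Union>(W, t) \<in> trivs E. W) = UNIV \<and>
     (\<forall>(W, t) \<in> trivs E. \<forall>(W', t') \<in> trivs E. \<forall>i<rank E. \<forall>j<rank E.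
        smooth_on M (W \<inter> W') (\<lambda>x. t' x (frame E t j x) i))"

definition sections ::
    "'m manifold \<Rightarrow> ('m, 'v, 'z) vbundle_scheme \<Rightarrow> ('m \<Rightarrow> 'v) set" where
  "sections M E = {e. (\<forall>x. e x \<in> fibre E x) \<and>
     (\<forall>(W, t) \<in> trivs E. \<forall>i<rank E. smooth_on M W (\<lambda>x. t x (e x) i))}"


section \<open>Courant algebroids\<close>

record ('m, 'v) courant = "('m, 'v) vbundle" +
  pairing :: "'m \<Rightarrow> 'v \<Rightarrow> 'v \<Rightarrow> real"
  bracket :: "('m \<Rightarrow> 'v) \<Rightarrow> ('m \<Rightarrow> 'v) \<Rightarrow> 'm \<Rightarrow> 'v"
  anchor :: "'m \<Rightarrow> 'v \<Rightarrow> ('m \<Rightarrow> real) \<Rightarrow> real"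

definition bundle_metric ::
    "('m::topological_space) manifold \<Rightarrow> ('m, 'v::real_vector) courant \<Rightarrow> bool" where
  "bundle_metric M E \<longleftrightarrow>
     (\<forall>x. \<forall>u\<in>fibre E x. \<forall>v\<in>fibre E x. \<forall>w\<in>fibre E x. \<forall>a b.
        pairing E x (a *\<^sub>R u + b *\<^sub>R v) w = a * pairing E x u w + b * pairing E x v w) \<and>
     (\<forall>x. \<forall>v\<in>fibre E x. \<forall>w\<in>fibre E x. pairing E x v w = pairing E x w v) \<and>
     (\<forall>x. \<forall>v\<in>fibre E x. (\<forall>w\<in>fibre E x. pairing E x v w = 0) \<longrightarrow> v = 0) \<and>
     (\<forall>(W, t) \<in> trivs E. \<forall>i<rank E. \<forall>j<rank E.
        smooth_on M W (\<lambda>x. pairing E x (frame E t i x) (frame E t j x)))"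

text \<open>A smooth bundle map from \<open>E\<close> to the tangent bundle over the identity: it is fibrewise linear,
  and smoothness is expressed on the local frames of \<open>E\<close>.\<close>

definition bundle_map_to_tangent ::
    "('m::topological_space) manifold \<Rightarrow> ('m, 'v::real_vector) courant \<Rightarrow> bool" where
  "bundle_map_to_tangent M E \<longleftrightarrow>
     (\<forall>x. \<forall>v\<in>fibre E x. anchor E x v \<in> tangent_space M x) \<and>
     (\<forall>x. \<forall>v\<in>fibre E x. \<forall>w\<in>fibre E x. \<forall>a b.
        anchor E x (a *\<^sub>R v + b *\<^sub>R w) = a *\<^sub>R anchor E x v + b *\<^sub>R anchor E x w) \<and>
     (\<forall>(W, t) \<in> trivs E. \<forall>j<rank E. smooth_vector_field_on M W (\<lambda>x. anchor E x (frame E t j x)))"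

definition pair :: "('m, 'v) courant \<Rightarrow> ('m \<Rightarrow> 'v) \<Rightarrow> ('m \<Rightarrow> 'v) \<Rightarrow> 'm \<Rightarrow> real"
  where "pair E e h = (\<lambda>x. pairing E x (e x) (h x))"

definition anch :: "('m, 'v) courant \<Rightarrow> ('m \<Rightarrow> 'v) \<Rightarrow> 'm \<Rightarrow> ('m \<Rightarrow> real) \<Rightarrow> real"
  where "anch E e = (\<lambda>x. anchor E x (e x))"

definition along :: "('m, 'v) courant \<Rightarrow> ('m \<Rightarrow> 'v) \<Rightarrow> ('m \<Rightarrow> real) \<Rightarrow> 'm \<Rightarrow> real"
  where "along E e f = (\<lambda>x. anch E e x f)"

definition fmul :: "('m \<Rightarrow> real) \<Rightarrow> ('m \<Rightarrow> 'v::real_vector) \<Rightarrow> 'm \<Rightarrow> 'v"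
  where "fmul f e = (\<lambda>x. f x *\<^sub>R e x)"

text \<open>For smooth \<open>f\<close> existence and uniqueness follow from nondegeneracy of the pairing; on other
  functions the value is irrelevant.\<close>

definition courant_D :: "'m manifold \<Rightarrow> ('m, 'v) courant \<Rightarrow> ('m \<Rightarrow> real) \<Rightarrow> 'm \<Rightarrow> 'v" where
  "courant_D M E f = (THE u. u \<in> sections M E \<and> (\<forall>e\<in>sections M E. pair E u e = along E e f))"

definition jacobiator ::
    "('m, 'v::real_vector) courant \<Rightarrow> ('m \<Rightarrow> 'v) \<Rightarrow> ('m \<Rightarrow> 'v) \<Rightarrow> ('m \<Rightarrow> 'v) \<Rightarrow> 'm \<Rightarrow> 'v" where
  "jacobiator E e1 e2 e3 =
     bracket E (bracket E e1 e2) e3 + bracket E (bracket E e2 e3) e1 + bracket E (bracket E e3 e1) e2"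

definition courant_T ::
    "('m, 'v) courant \<Rightarrow> ('m \<Rightarrow> 'v) \<Rightarrow> ('m \<Rightarrow> 'v) \<Rightarrow> ('m \<Rightarrow> 'v) \<Rightarrow> 'm \<Rightarrow> real" where
  "courant_T E e1 e2 e3 = (1/6) *\<^sub>R
     (pair E (bracket E e1 e2) e3 + pair E (bracket E e2 e3) e1 + pair E (bracket E e3 e1) e2)"

definition courant_algebroid ::
    "('m::{t2_space, second_countable_topology}) manifold \<Rightarrow> ('m, 'v::real_vector) courant \<Rightarrow> bool"
  where
  "courant_algebroid M E \<longleftrightarrow>
     smooth_manifold M \<and> vector_bundle M E \<and> bundle_metric M E \<and> bundle_map_to_tangent M E \<and>
     (\<forall>e\<in>sections M E. \<forall>h\<in>sections M E. bracket E e h \<in> sections M E) \<and>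
     (\<forall>e\<in>sections M E. \<forall>h\<in>sections M E. bracket E e h = - bracket E h e) \<and>
     (\<forall>e1\<in>sections M E. \<forall>e2\<in>sections M E. \<forall>h\<in>sections M E. \<forall>a b.
        bracket E (a *\<^sub>R e1 + b *\<^sub>R e2) h = a *\<^sub>R bracket E e1 h + b *\<^sub>R bracket E e2 h) \<and>
     (\<forall>e1\<in>sections M E. \<forall>e2\<in>sections M E. \<forall>e3\<in>sections M E.
        jacobiator E e1 e2 e3 = courant_D M E (courant_T E e1 e2 e3)) \<and>
     (\<forall>e1\<in>sections M E. \<forall>e2\<in>sections M E.
        anch E (bracket E e1 e2) = lie_bracket M (anch E e1) (anch E e2)) \<and>
     (\<forall>e1\<in>sections M E. \<forall>e2\<in>sections M E. \<forall>f\<in>smooth_functions M.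
        bracket E e1 (fmul f e2) =
          fmul f (bracket E e1 e2) + fmul (along E e1 f) e2
            - (1/2) *\<^sub>R fmul (pair E e1 e2) (courant_D M E f)) \<and>
     (\<forall>f\<in>smooth_functions M. anch E (courant_D M E f) = 0) \<and>
     (\<forall>e\<in>sections M E. \<forall>h1\<in>sections M E. \<forall>h2\<in>sections M E.
        along E e (pair E h1 h2) =
          pair E (bracket E e h1 + (1/2) *\<^sub>R courant_D M E (pair E e h1)) h2 +
          pair E h1 (bracket E e h2 + (1/2) *\<^sub>R courant_D M E (pair E e h2)))"


section \<open>Strongly homotopy Lie algebras\<close>

text \<open>A graded vector space is given by its homogeneous components, which are independent subspaces
  of an ambient vector space; the total space is their span.\<close>

definition graded_vector_space :: "(int \<Rightarrow> 'a::real_vector set) \<Rightarrow> bool" where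
  "graded_vector_space V \<longleftrightarrow>
     (\<forall>k. subspace (V k)) \<and>
     (\<forall>S x. finite S \<and> (\<forall>k\<in>S. x k \<in> V k) \<and> (\<Sum>k\<in>S. x k) = 0 \<longrightarrow> (\<forall>k\<in>S. x k = 0))"

definition total_space :: "(int \<Rightarrow> 'a::real_vector set) \<Rightarrow> 'a set"
  where "total_space V = span (\<Union>k. V k)"

definition homogeneous :: "(int \<Rightarrow> 'a set) \<Rightarrow> int list \<Rightarrow> 'a list \<Rightarrow> bool"
  where "homogeneous V ds xs \<longleftrightarrow> list_all2 (\<lambda>d x. x \<in> V d) ds xs"

text \<open>A linear map of degree \<open>m\<close> from the k-th graded exterior power of \<open>V\<close> to \<open>V\<close>, given by its
  values on decomposable elements: by definition of the exterior power as a quotient of the tensor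
  power, these are the multilinear maps on lists of length \<open>k\<close> that respect the relations
  v @ w + (-1)^(deg v * deg w) w @ v = 0 (@ being the tensor product) in adjacent positions.\<close>

definition wedge_map :: "(int \<Rightarrow> 'a::real_vector set) \<Rightarrow> nat \<Rightarrow> int \<Rightarrow> ('a list \<Rightarrow> 'a) \<Rightarrow> bool" where
  "wedge_map V k m l \<longleftrightarrow>
     (\<forall>xs i x y a b. length xs = k \<and> set xs \<subseteq> total_space V \<and> i < k \<and>
        x \<in> total_space V \<and> y \<in> total_space V \<longrightarrow>
        l (xs[i := a *\<^sub>R x + b *\<^sub>R y]) = a *\<^sub>R l (xs[i := x]) + b *\<^sub>R l (xs[i := y])) \<and>
     (\<forall>ds xs i. homogeneous V ds xs \<and> length xs = k \<and> Suc i < k \<longrightarrow>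
        l (xs[i := xs ! Suc i, Suc i := xs ! i]) =
          - (((-1) powi (ds ! i * ds ! Suc i)) *\<^sub>R l xs)) \<and>
     (\<forall>ds xs. homogeneous V ds xs \<and> length xs = k \<longrightarrow> l xs \<in> V (sum_list ds + m))"

text \<open>Positions are counted from 0, so that \<open>\<sigma>\<close> permutes \<open>{..<n}\<close>.\<close>

definition unshuffles :: "nat \<Rightarrow> nat \<Rightarrow> (nat \<Rightarrow> nat) set" where
  "unshuffles i n = {\<sigma>. \<sigma> permutes {..<n} \<and> strict_mono_on {..<i} \<sigma> \<and> strict_mono_on {i..<n} \<sigma>}"

text \<open>Reordering \<open>x\<^sub>0, \<dots>, x\<^sub>n\<^sub>-\<^sub>1\<close> into \<open>x\<^bsub>\<sigma> 0\<^esub>, \<dots>, x\<^bsub>\<sigma> (n-1)\<^esub>\<close> by exchanging neighbours exchanges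
  exactly the inverted pairs, each of which contributes a sign if both its members are odd.\<close>

definition koszul_sign :: "int list \<Rightarrow> (nat \<Rightarrow> nat) \<Rightarrow> real" where
  "koszul_sign ds \<sigma> =
     (\<Prod>(a, b) \<in> {(a, b). a < b \<and> b < length ds \<and> \<sigma> b < \<sigma> a}. (-1) powi (ds ! \<sigma> a * ds ! \<sigma> b))"

definition L_infty_algebra :: "(int \<Rightarrow> 'a::real_vector set) \<Rightarrow> (nat \<Rightarrow> 'a list \<Rightarrow> 'a) \<Rightarrow> bool" where
  "L_infty_algebra V l \<longleftrightarrow>
     graded_vector_space V \<and>
     (\<forall>k\<ge>1. wedge_map V k (int k - 2) (l k)) \<and>
     (\<forall>n\<ge>1. \<forall>ds xs. homogeneous V ds xs \<and> length xs = n \<longrightarrow>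
        (\<Sum>(i, j) \<in> {(i, j). 1 \<le> i \<and> 1 \<le> j \<and> i + j = n + 1}.
           (-1) ^ (i * (j - 1)) *\<^sub>R
           (\<Sum>\<sigma>\<in>unshuffles i n.
              (of_int (sign \<sigma>) * koszul_sign ds \<sigma>) *\<^sub>R
              l j (l i (map (\<lambda>a. xs ! \<sigma> a) [0..<i]) # map (\<lambda>a. xs ! \<sigma> a) [i..<n]))) = 0)"


section \<open>The graded space and the brackets of a Courant algebroid\<close>

text \<open>A triple stands for the sum of its components in degrees 0, 1 and 2, so that elements of
  degrees 1 and 2 remain distinct although both are functions.\<close>

type_synonym ('m, 'v) courant_elem = "('m \<Rightarrow> 'v) \<times> ('m \<Rightarrow> real) \<times> ('m \<Rightarrow> real)"

definition ker_D :: "'m manifold \<Rightarrow> ('m, 'v::zero) courant \<Rightarrow> ('m \<Rightarrow> real) set"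
  where "ker_D M E = {c \<in> smooth_functions M. courant_D M E c = 0}"

definition courant_space ::
    "'m manifold \<Rightarrow> ('m, 'v::real_vector) courant \<Rightarrow> int \<Rightarrow> ('m, 'v) courant_elem set" where
  "courant_space M E k =
     (if k = 0 then {(e, 0, 0) |e. e \<in> sections M E}
      else if k = 1 then {(0, f, 0) |f. f \<in> smooth_functions M}
      else if k = 2 then {(0, 0, c) |c. c \<in> ker_D M E}
      else {0})"

text \<open>Here \<open>c\<close> moves from the third to the second slot: this is the inclusion of the kernel.\<close>

fun courant_d ::
    "'m manifold \<Rightarrow> ('m, 'v::real_vector) courant \<Rightarrow> ('m, 'v) courant_elem \<Rightarrow> ('m, 'v) courant_elem"
  where "courant_d M E (e, f, c) = (courant_D M E f, c, 0)"

text \<open>The second term in degree 1 is the value on \<open>f\<^sub>1 \<and> e\<^sub>2 = - e\<^sub>2 \<and> f\<^sub>1\<close>.\<close>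

fun courant_l2 ::
    "'m manifold \<Rightarrow> ('m, 'v::real_vector) courant \<Rightarrow> ('m, 'v) courant_elem \<Rightarrow> ('m, 'v) courant_elem
       \<Rightarrow> ('m, 'v) courant_elem" where
  "courant_l2 M E (e1, f1, c1) (e2, f2, c2) =
     (bracket E e1 e2,
      (1/2) *\<^sub>R pair E e1 (courant_D M E f2) - (1/2) *\<^sub>R pair E e2 (courant_D M E f1),
      0)"

fun courant_l3 ::
    "('m, 'v::real_vector) courant \<Rightarrow> ('m, 'v) courant_elem \<Rightarrow> ('m, 'v) courant_elem
       \<Rightarrow> ('m, 'v) courant_elem \<Rightarrow> ('m, 'v) courant_elem" where
  "courant_l3 E (e1, f1, c1) (e2, f2, c2) (e3, f3, c3) = (0, - courant_T E e1 e2 e3, 0)"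

definition courant_l ::
    "'m manifold \<Rightarrow> ('m, 'v::real_vector) courant \<Rightarrow> nat \<Rightarrow> ('m, 'v) courant_elem list
       \<Rightarrow> ('m, 'v) courant_elem" where
  "courant_l M E k xs =
     (if k = 1 then courant_d M E (xs ! 0)
      else if k = 2 then courant_l2 M E (xs ! 0) (xs ! 1)
      else if k = 3 then courant_l3 E (xs ! 0) (xs ! 1) (xs ! 2)
      else 0)"

end

theory Submission
  imports
    Defs
    "HOL-Computational_Algebra.Polynomial"
    "Jordan_Normal_Form.Determinant"
begin

text \<open>The Jacobi identity of the bracket on \<open>\<Gamma>(E)\<close> fails by the exact term \<open>\<D> T\<close>, so on the complex
  \<open>ker \<D> \<rightarrow> C\<^sup>\<infinity>(M) \<rightarrow> \<Gamma>(E)\<close> it holds up to homotopy, with homotopy \<open>l\<^sub>3 = - T\<close>.  Written out, the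
  relations with \<open>n\<close> arguments say the following.

  \<^item> \<open>n = 1\<close>: \<open>d d = 0\<close>.
  \<^item> \<open>n = 2\<close>: \<open>[e, \<D> f] = \<D>\<langle>e, \<D> f\<rangle> / 2\<close> (\<open>bracket_courant_D\<close>), and \<open>\<langle>\<D> f, \<D> g\<rangle> = 0\<close>.
  \<^item> \<open>n = 3\<close>: the axiom \<open>J = \<D> T\<close> on three sections; on two sections and a function the relation
    reduces to \<open>T(e\<^sub>1, e\<^sub>2, \<D> f) = \<rho>[e\<^sub>1, e\<^sub>2] f / 4\<close> (\<open>courant_T_courant_D\<close>) and \<open>\<rho>[e\<^sub>1, e\<^sub>2] = [\<rho> e\<^sub>1, \<rho> e\<^sub>2]\<close>.
  \<^item> \<open>n = 4\<close>: an identity between the six functions \<open>T([e\<^sub>i, e\<^sub>j], e\<^sub>k, e\<^sub>l)\<close> and the four functions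
    \<open>\<rho>(e\<^sub>l) T(e\<^sub>i, e\<^sub>j, e\<^sub>k)\<close> (\<open>courant_T_bracket_identity\<close>).
  \<^item> \<open>n \<ge> 5\<close>: every summand vanishes, since \<open>l\<^sub>k = 0\<close> for \<open>k > 3\<close>, and \<open>l\<^sub>3\<close> takes values in functions
    and vanishes as soon as one argument is a function.

  The values of \<open>T\<close> needed for \<open>n = 3\<close> and \<open>n = 4\<close> rest on one consequence of the invariance of the pairing,
  \<open>\<langle>[e\<^sub>1, e\<^sub>2], e\<^sub>3\<rangle> = 2 T(e\<^sub>1, e\<^sub>2, e\<^sub>3) + \<rho>(e\<^sub>1)\<langle>e\<^sub>2, e\<^sub>3\<rangle> / 2 - \<rho>(e\<^sub>2)\<langle>e\<^sub>1, e\<^sub>3\<rangle> / 2\<close> (\<open>pair_bracket\<close>).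
  The identity for \<open>n = 4\<close> comes from pairing \<open>J = \<D> T\<close> with a fourth section, expanding
  \<open>\<langle>[[e\<^sub>1, e\<^sub>2], e\<^sub>3], e\<^sub>4\<rangle>\<close> by this formula, and antisymmetrising over the four sections: the terms
  \<open>\<rho>[e\<^sub>i, e\<^sub>j]\<langle>e\<^sub>k, e\<^sub>l\<rangle>\<close> cancel by symmetry of the pairing.

  The Koszul signs are dealt with for all degrees at once.  If at most one argument has non-zero degree
  they are all 1, and then each relation holds for arbitrary inhomogeneous elements
  (\<open>jacobi_2\<close>, \<open>jacobi_3\<close>, \<open>jacobi_4\<close>).  If two arguments have non-zero degree, each summand vanishes by itself
  (\<open>jacobi_term_two_zero\<close>).

  Before any of this, \<open>\<D> f\<close> has to be shown to exist and to be unique as a smooth section.  Existence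
  is local: in a frame, \<open>\<D> f\<close> solves a linear system with invertible smooth matrix, and Cramer's rule
  gives a smooth solution (\<open>gradient_exists\<close>).  Uniqueness, where \<open>\<D> f\<close> is tested against global
  sections only, needs a global section through every vector of every fibre (\<open>section_through\<close>), hence
  bump functions (\<open>bump_function\<close>), which are built from \<open>exp (- 1 / s)\<close> in a chart and extended by zero
  because compact subsets of a Hausdorff space are closed.\<close>

section \<open>Differentiable functions on open subsets of Euclidean space\<close>

lemma Ck_on_subset: "Ck_on n k V f \<Longrightarrow> V' \<subseteq> V \<Longrightarrow> Ck_on n k V' f"
  by (induction k arbitrary: f) (auto intro: continuous_on_subset)

lemma Ck_on_Suc_imp: "Ck_on n (Suc k) V f \<Longrightarrow> Ck_on n k V f"
  by (induction k arbitrary: f) auto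

text \<open>Partial derivatives at a point of an open set only depend on the values of the function on
  that set. The bound on the index matters: \<open>V\<close> is open relative to Euclidean n-space only, and
  moving a coordinate beyond the n-th leaves that space.\<close>

lemma openin_Euclidean_space_eventually_update:
  assumes V: "openin (Euclidean_space n) V" and x: "x \<in> V" and i: "i < n"
  shows "\<forall>\<^sub>F t in nhds (x i). x(i := t) \<in> V"
proof -
  obtain T where T: "open T" "V = T \<inter> {x. \<forall>i\<ge>n. x i = 0}"
    using V unfolding Euclidean_space_def euclidean_product_topology openin_subtopology
    by auto
  have cont: "continuous_on UNIV (\<lambda>t. x(i := t))"
  proof (rule continuous_on_coordinatewise_then_product)
    fix j
    show "continuous_on UNIV (\<lambda>t. (x(i := t)) j)"
      by (cases "j = i") (auto intro: continuous_intros)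
  qed
  have "open ((\<lambda>t. x(i := t)) -` T)"
    using cont T(1) by (simp add: continuous_on_open_vimage)
  moreover have "x i \<in> (\<lambda>t. x(i := t)) -` T"
    using x T by auto
  ultimately have "\<forall>\<^sub>F t in nhds (x i). t \<in> (\<lambda>t. x(i := t)) -` T"
    by (rule eventually_nhds_in_open)
  then show ?thesis
    by eventually_elim (use T x i in auto)
qed

lemma Ck_on_cong:
  assumes V: "openin (Euclidean_space n) V"
  shows "(\<And>x. x \<in> V \<Longrightarrow> f x = g x) \<Longrightarrow> Ck_on n k V f \<Longrightarrow> Ck_on n k V g"
proof (induction k arbitrary: f g)
  case 0
  then show ?case by (simp cong: continuous_on_cong)
next
  case (Suc k)
  have ev: "\<forall>\<^sub>F t in nhds (x i). f (x(i := t)) = g (x(i := t))" if "x \<in> V" "i < n" for x i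
    using openin_Euclidean_space_eventually_update[OF V that]
    by eventually_elim (rule Suc.prems)
  have "continuous_on V g"
    using Suc.prems by (simp cong: continuous_on_cong)
  moreover have "(\<lambda>t. g (x(i := t))) differentiable (at (x i))" if "x \<in> V" "i < n" for x i
  proof -
    have "(\<lambda>t. f (x(i := t))) differentiable (at (x i))"
      using Suc.prems that by auto
    then show ?thesis
      unfolding real_differentiable_def using DERIV_cong_ev[OF refl ev[OF that] refl] by blast
  qed
  moreover have "Ck_on n k V (partial_deriv i g)" if "i < n" for i
  proof (rule Suc.IH)
    show "Ck_on n k V (partial_deriv i f)"
      using Suc.prems that by auto
    show "partial_deriv i f x = partial_deriv i g x" if "x \<in> V" for x
      unfolding partial_deriv_def by (rule deriv_cong_ev[OF ev[OF that \<open>i < n\<close>] refl])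
  qed
  ultimately show ?case by auto
qed

text \<open>The derivatives may be named by any functions \<open>g i\<close> that agree with \<open>partial_deriv i f\<close> on
  \<open>V\<close>; this is how the closure properties under arithmetic and composition are proved, by
  induction on the order of differentiability.\<close>

lemma Ck_on_SucI:
  assumes V: "openin (Euclidean_space n) V" and "continuous_on V f"
    and D: "\<And>i x. i < n \<Longrightarrow> x \<in> V \<Longrightarrow> ((\<lambda>t. f (x(i := t))) has_real_derivative g i x) (at (x i))"
    and g: "\<And>i. i < n \<Longrightarrow> Ck_on n k V (g i)"
  shows "Ck_on n (Suc k) V f"
proof -
  have "Ck_on n k V (partial_deriv i f)" if "i < n" for i
    by (rule Ck_on_cong[OF V _ g[OF that]])
      (simp add: partial_deriv_def DERIV_imp_deriv[OF D[OF that]])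
  moreover have "(\<lambda>t. f (x(i := t))) differentiable (at (x i))" if "i < n" "x \<in> V" for i x
    using D[OF that] real_differentiable_def by blast
  ultimately show ?thesis using assms(2) by auto
qed

lemma Ck_on_imp_continuous: "Ck_on n k V f \<Longrightarrow> continuous_on V f"
  by (cases k) auto

lemma Ck_on_SucD:
  assumes "Ck_on n (Suc k) V f" "i < n" "x \<in> V"
  shows "((\<lambda>t. f (x(i := t))) has_real_derivative partial_deriv i f x) (at (x i))"
  using assms by (auto simp: partial_deriv_def DERIV_deriv_iff_real_differentiable)

lemma Ck_on_const:
  assumes V: "openin (Euclidean_space n) V"
  shows "Ck_on n k V (\<lambda>x. c)"
proof (induction k arbitrary: c)
  case (Suc k)
  show ?case
    by (rule Ck_on_SucI[OF V _ _ Suc[of 0]]) auto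
qed simp

lemma Ck_on_add:
  assumes V: "openin (Euclidean_space n) V"
  shows "Ck_on n k V f \<Longrightarrow> Ck_on n k V g \<Longrightarrow> Ck_on n k V (\<lambda>x. f x + g x)"
proof (induction k arbitrary: f g)
  case (Suc k)
  show ?case
  proof (rule Ck_on_SucI[OF V])
    show "continuous_on V (\<lambda>x. f x + g x)"
      using Suc.prems by (auto intro: continuous_intros)
    show "((\<lambda>t. f (x(i := t)) + g (x(i := t))) has_real_derivative
        partial_deriv i f x + partial_deriv i g x) (at (x i))" if "i < n" "x \<in> V" for i x
      by (rule DERIV_add[OF Ck_on_SucD[OF Suc.prems(1) that] Ck_on_SucD[OF Suc.prems(2) that]])
    show "Ck_on n k V (\<lambda>x. partial_deriv i f x + partial_deriv i g x)" if "i < n" for i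
      by (rule Suc.IH) (use Suc.prems that in auto)
  qed
qed (simp add: continuous_on_add)

lemma Ck_on_mult:
  assumes V: "openin (Euclidean_space n) V"
  shows "Ck_on n k V f \<Longrightarrow> Ck_on n k V g \<Longrightarrow> Ck_on n k V (\<lambda>x. f x * g x)"
proof (induction k arbitrary: f g)
  case (Suc k)
  show ?case
  proof (rule Ck_on_SucI[OF V])
    show "continuous_on V (\<lambda>x. f x * g x)"
      using Suc.prems by (auto intro: continuous_intros)
    show "((\<lambda>t. f (x(i := t)) * g (x(i := t))) has_real_derivative
        partial_deriv i f x * g x + partial_deriv i g x * f x) (at (x i))"
      if "i < n" "x \<in> V" for i x
      using DERIV_mult[OF Ck_on_SucD[OF Suc.prems(1) that] Ck_on_SucD[OF Suc.prems(2) that]]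
      by (simp only: fun_upd_triv)
    show "Ck_on n k V (\<lambda>x. partial_deriv i f x * g x + partial_deriv i g x * f x)" if "i < n" for i
      by (intro Ck_on_add[OF V] Suc.IH Suc.prems[THEN Ck_on_Suc_imp]) (use Suc.prems that in auto)
  qed
qed (simp add: continuous_on_mult)

text \<open>The outer function is taken from a set \<open>H\<close> that is closed under differentiation at the
  points of \<open>S\<close>. Every derivative of \<open>h \<circ> u\<close> is then a sum of products of some \<open>h' \<circ> u\<close> with \<open>h'
  \<in> H\<close> and derivatives of \<open>u\<close>, and no explicit sequence of higher derivatives of \<open>h\<close> is needed.\<close>

lemma Ck_on_compose:
  assumes V: "openin (Euclidean_space n) V"
    and H: "\<And>h. h \<in> H \<Longrightarrow> \<exists>h'\<in>H. \<forall>s\<in>S. (h has_real_derivative h' s) (at s)"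
    and u: "u ` V \<subseteq> S"
  shows "Ck_on n k V u \<Longrightarrow> h \<in> H \<Longrightarrow> Ck_on n k V (\<lambda>x. h (u x))"
proof (induction k arbitrary: h)
  case 0
  obtain h' where h': "\<And>s. s \<in> S \<Longrightarrow> (h has_real_derivative h' s) (at s)"
    using H 0 by blast
  have "continuous_on S h"
    by (rule DERIV_continuous_on[OF has_field_derivative_at_within[OF h']])
  then show ?case
    using 0 u continuous_on_compose2 by fastforce
next
  case (Suc k)
  obtain h' where h': "h' \<in> H" "\<And>s. s \<in> S \<Longrightarrow> (h has_real_derivative h' s) (at s)"
    using H Suc.prems by blast
  have "continuous_on S h"
    by (rule DERIV_continuous_on[OF has_field_derivative_at_within[OF h'(2)]])
  then have cont: "continuous_on V (\<lambda>x. h (u x))"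
    using Ck_on_imp_continuous[OF Suc.prems(1)] u continuous_on_compose2 by fastforce
  show ?case
  proof (rule Ck_on_SucI[OF V cont])
    show "((\<lambda>t. h (u (x(i := t)))) has_real_derivative h' (u x) * partial_deriv i u x) (at (x i))"
      if "i < n" "x \<in> V" for i x
    proof (rule DERIV_chain2[where g = "\<lambda>t. u (x(i := t))" and x = "x i"])
      show "(h has_real_derivative h' (u x)) (at (u (x(i := x i))))"
        using h'(2)[of "u x"] u that by auto
    qed (rule Ck_on_SucD[OF Suc.prems(1) that])
    show "Ck_on n k V (\<lambda>x. h' (u x) * partial_deriv i u x)" if "i < n" for i
      using Ck_on_mult[OF V Suc.IH[OF Ck_on_Suc_imp[OF Suc.prems(1)] h'(1)]] Suc.prems that by auto
  qed
qed

text \<open>Only continuity needs an argument, the partial derivatives being defined pointwise: near a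
  point of an open member of \<open>\<V>\<close>, the filter of neighbourhoods within the union is that
  within the member.\<close>

lemma Ck_on_Union:
  assumes "\<And>V. V \<in> \<V> \<Longrightarrow> openin (Euclidean_space n) V"
  shows "(\<And>V. V \<in> \<V> \<Longrightarrow> Ck_on n k V f) \<Longrightarrow> Ck_on n k (\<Union>\<V>) f"
proof -
  have cont: "continuous_on (\<Union>\<V>) g" if g: "\<And>V. V \<in> \<V> \<Longrightarrow> continuous_on V g"
    for g :: "(nat \<Rightarrow> real) \<Rightarrow> real"
  proof (rule continuous_on_eq_continuous_within[THEN iffD2, rule_format])
    fix x assume "x \<in> \<Union>\<V>"
    then obtain V where V: "V \<in> \<V>" "x \<in> V" by blast
    obtain T where T: "open T" "V = T \<inter> {x. \<forall>i\<ge>n. x i = 0}"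
      using assms[OF V(1)] unfolding Euclidean_space_def euclidean_product_topology openin_subtopology
      by auto
    have "\<Union>\<V> \<subseteq> {x. \<forall>i\<ge>n. x i = 0}"
      using assms openin_subset topspace_Euclidean_space by blast
    then have eq: "\<Union>\<V> \<inter> T - {x} = V \<inter> T - {x}"
      using T V by blast
    have "continuous (at x within V) g"
      using g[OF V(1)] V(2) by (simp add: continuous_on_eq_continuous_within)
    moreover have "at x within \<Union>\<V> = at x within V"
      by (rule at_within_nhd[of x T]) (use T V eq in auto)
    ultimately show "continuous (at x within \<Union>\<V>) g" by (simp add: continuous_within)
  qed
  show "(\<And>V. V \<in> \<V> \<Longrightarrow> Ck_on n k V f) \<Longrightarrow> Ck_on n k (\<Union>\<V>) f"
  proof (induction k arbitrary: f)
    case 0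
    then show ?case using cont by simp
  next
    case (Suc k)
    then show ?case using cont[of f] by fastforce
  qed
qed

section \<open>A flat function\<close>

text \<open>\<open>flat 1\<close> is the standard function \<open>exp (- 1 / s)\<close> that is flat at 0.  The polynomial in \<open>1
  / s\<close> makes the family closed under differentiation, which is the form in which smoothness is
  used.\<close>

definition flat :: "real poly \<Rightarrow> real \<Rightarrow> real" where
  "flat p s = (if 0 < s then poly p (1 / s) * exp (- (1 / s)) else 0)"

lemma tendsto_poly_mult_exp_minus: "((\<lambda>y. poly p y * exp (- y)) \<longlongrightarrow> (0 :: real)) at_top"
proof -
  have "((\<lambda>y. \<Sum>i\<le>degree p. coeff p i * (y ^ i / exp y)) \<longlongrightarrow> (\<Sum>i\<le>degree p. coeff p i * 0)) at_top"
    by (intro tendsto_sum tendsto_mult tendsto_const tendsto_power_div_exp_0)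
  moreover have "(\<lambda>y. \<Sum>i\<le>degree p. coeff p i * (y ^ i / exp y)) = (\<lambda>y. poly p y * exp (- y))"
    by (simp add: poly_altdef sum_distrib_right exp_minus divide_inverse mult.assoc)
  ultimately show ?thesis by simp
qed

lemma tendsto_flat_0: "(flat p \<longlongrightarrow> 0) (at 0)"
proof -
  have "((\<lambda>s. poly p (inverse s) * exp (- inverse s)) \<longlongrightarrow> (0 :: real)) (at_right 0)"
    by (rule filterlim_compose[OF tendsto_poly_mult_exp_minus filterlim_inverse_at_top_right])
  then have "(flat p \<longlongrightarrow> 0) (at_right 0)"
    by (rule filterlim_mono_eventually)
      (auto simp: flat_def eventually_at_filter inverse_eq_divide)
  moreover have "(flat p \<longlongrightarrow> 0) (at_left 0)"
    by (rule tendsto_eventually) (auto simp: flat_def eventually_at_filter)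
  ultimately show ?thesis using filterlim_at_split by blast
qed

text \<open>For \<open>s > 0\<close> the derivative of \<open>p(1/s) exp(-1/s)\<close> is \<open>(1/s)\<^sup>2 (p - p')(1/s) exp(-1/s)\<close>.  At
  0 the difference quotient of \<open>flat p\<close> is again a flat function, \<open>flat (pCons 0 p)\<close>, and so
  tends to 0.\<close>

lemma has_real_derivative_flat:
  "(flat p has_real_derivative flat ([:0, 0, 1:] * (p - pderiv p)) s) (at s)"
proof (cases s "0 :: real" rule: linorder_cases)
  case less
  have "(flat p has_real_derivative 0) (at s)"
  proof (rule DERIV_cong_ev[THEN iffD2, OF refl _ refl])
    show "\<forall>\<^sub>F t in nhds s. flat p t = 0"
      using eventually_nhds_in_open[of "{..<0}" s] less
      by (auto simp: flat_def elim!: eventually_mono)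
  qed auto
  then show ?thesis using less by (simp add: flat_def)
next
  case equal
  have "((\<lambda>h. flat p h / h) \<longlongrightarrow> 0) (at 0)"
  proof (rule filterlim_mono_eventually[OF tendsto_flat_0[of "pCons 0 p"]])
    show "\<forall>\<^sub>F h in at 0. flat (pCons 0 p) h = flat p h / h"
      by (auto simp: flat_def eventually_at_filter)
  qed auto
  then show ?thesis
    using equal by (simp add: DERIV_def flat_def)
next
  case greater
  have "((\<lambda>t. poly p (1 / t) * exp (- (1 / t))) has_real_derivative
      flat ([:0, 0, 1:] * (p - pderiv p)) s) (at s)"
    using greater
    by (auto intro!: derivative_eq_intros DERIV_chain2[OF poly_DERIV]
        simp: flat_def field_simps power2_eq_square)
  then show ?thesis
  proof (rule DERIV_cong_ev[THEN iffD2, OF refl _ refl, rotated])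
    show "\<forall>\<^sub>F t in nhds s. flat p t = poly p (1 / t) * exp (- (1 / t))"
      using eventually_nhds_in_open[of "{0<..}" s] greater
      by (auto simp: flat_def elim!: eventually_mono)
  qed
qed

section \<open>Smooth functions on a manifold\<close>

locale smooth_manifold_locale =
  fixes M :: "('m::{t2_space, second_countable_topology}) manifold"
  assumes smooth_manifold: "smooth_manifold M"
begin

lemma chart:
  assumes "(U, \<phi>) \<in> atlas M"
  shows "open U" "openin (Euclidean_space (mdim M)) (\<phi> ` U)"
    "homeomorphism U (\<phi> ` U) \<phi> (inv_into U \<phi>)"
  using smooth_manifold assms unfolding smooth_manifold_def by auto

lemma chart_inv: "(U, \<phi>) \<in> atlas M \<Longrightarrow> x \<in> U \<Longrightarrow> inv_into U \<phi> (\<phi> x) = x"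
  using chart(3) homeomorphism_apply1 by blast

lemma chart_exists:
  obtains U \<phi> where "(U, \<phi>) \<in> atlas M" "x \<in> U"
proof -
  have "x \<in> (\<Union>(U, \<phi>) \<in> atlas M. U)"
    using smooth_manifold unfolding smooth_manifold_def by auto
  then show ?thesis using that by auto
qed

lemma openin_chart_image:
  assumes c: "(U, \<phi>) \<in> atlas M" and W: "open W"
  shows "openin (Euclidean_space (mdim M)) (\<phi> ` (U \<inter> W))"
proof (rule openin_trans_full[OF _ chart(2)[OF c]])
  have "\<phi> ` U \<subseteq> {x. \<forall>i\<ge>mdim M. x i = 0}"
    using chart(2)[OF c] openin_subset topspace_Euclidean_space by blast
  then have "subtopology (Euclidean_space (mdim M)) (\<phi> ` U) = top_of_set (\<phi> ` U)"
    unfolding Euclidean_space_def euclidean_product_topology subtopology_subtopology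
    by (simp add: Int_absorb1)
  moreover have "openin (top_of_set (\<phi> ` U)) (\<phi> ` (U \<inter> W))"
    by (rule homeomorphism_imp_open_map[OF chart(3)[OF c]]) (use W in auto)
  ultimately show "openin (subtopology (Euclidean_space (mdim M)) (\<phi> ` U)) (\<phi> ` (U \<inter> W))"
    by simp
qed

lemma smooth_onI:
  assumes "\<And>U \<phi> k. (U, \<phi>) \<in> atlas M \<Longrightarrow>
    Ck_on (mdim M) k (\<phi> ` (U \<inter> W)) (\<lambda>y. f (inv_into U \<phi> y))"
  shows "smooth_on M W f"
  using assms unfolding smooth_on_def Cinf_on_def by auto

lemma smooth_onD:
  assumes "smooth_on M W f" "(U, \<phi>) \<in> atlas M"
  shows "Ck_on (mdim M) k (\<phi> ` (U \<inter> W)) (\<lambda>y. f (inv_into U \<phi> y))"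
  using assms unfolding smooth_on_def Cinf_on_def by auto

lemma smooth_on_subset: "smooth_on M W f \<Longrightarrow> W' \<subseteq> W \<Longrightarrow> smooth_on M W' f"
  by (rule smooth_onI, rule Ck_on_subset[OF smooth_onD]) auto

lemma smooth_on_cong:
  assumes "open W" "smooth_on M W f" "\<And>x. x \<in> W \<Longrightarrow> f x = g x"
  shows "smooth_on M W g"
proof (rule smooth_onI)
  fix U \<phi> k assume c: "(U, \<phi>) \<in> atlas M"
  show "Ck_on (mdim M) k (\<phi> ` (U \<inter> W)) (\<lambda>y. g (inv_into U \<phi> y))"
    by (rule Ck_on_cong[OF openin_chart_image[OF c assms(1)] _ smooth_onD[OF assms(2) c]])
      (auto simp: chart_inv[OF c] assms(3))
qed

lemma smooth_on_Union:
  assumes "\<And>W. W \<in> \<W> \<Longrightarrow> open W" "\<And>W. W \<in> \<W> \<Longrightarrow> smooth_on M W f"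
  shows "smooth_on M (\<Union>\<W>) f"
proof (rule smooth_onI)
  fix U \<phi> k assume c: "(U, \<phi>) \<in> atlas M"
  have "\<phi> ` (U \<inter> \<Union>\<W>) = \<Union>((\<lambda>W. \<phi> ` (U \<inter> W)) ` \<W>)" by auto
  moreover have "Ck_on (mdim M) k (\<Union>((\<lambda>W. \<phi> ` (U \<inter> W)) ` \<W>)) (\<lambda>y. f (inv_into U \<phi> y))"
    by (rule Ck_on_Union) (use openin_chart_image[OF c assms(1)] smooth_onD[OF assms(2) c] in auto)
  ultimately show "Ck_on (mdim M) k (\<phi> ` (U \<inter> \<Union>\<W>)) (\<lambda>y. f (inv_into U \<phi> y))"
    by simp
qed

lemma smooth_on_const: "open W \<Longrightarrow> smooth_on M W (\<lambda>x. c)"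
  by (rule smooth_onI, rule Ck_on_const[OF openin_chart_image])

lemma smooth_on_add:
  "open W \<Longrightarrow> smooth_on M W f \<Longrightarrow> smooth_on M W g \<Longrightarrow> smooth_on M W (\<lambda>x. f x + g x)"
  by (rule smooth_onI, rule Ck_on_add[OF openin_chart_image smooth_onD smooth_onD])

lemma smooth_on_mult:
  "open W \<Longrightarrow> smooth_on M W f \<Longrightarrow> smooth_on M W g \<Longrightarrow> smooth_on M W (\<lambda>x. f x * g x)"
  by (rule smooth_onI, rule Ck_on_mult[OF openin_chart_image smooth_onD smooth_onD])

lemma smooth_on_diff:
  "open W \<Longrightarrow> smooth_on M W f \<Longrightarrow> smooth_on M W g \<Longrightarrow> smooth_on M W (\<lambda>x. f x - g x)"
  using smooth_on_add[of W f "\<lambda>x. (- 1) * g x"] smooth_on_mult[of W "\<lambda>x. - 1" g]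
    smooth_on_const[of W "- 1"] by simp

lemma smooth_on_sum:
  assumes "open W" "\<And>i. i \<in> I \<Longrightarrow> smooth_on M W (f i)"
  shows "smooth_on M W (\<lambda>x. \<Sum>i\<in>I. f i x)"
  using assms(2)
  by (induction I rule: infinite_finite_induct)
    (auto intro: smooth_on_const smooth_on_add assms(1))

lemma smooth_on_prod:
  assumes "open W" "\<And>i. i \<in> I \<Longrightarrow> smooth_on M W (f i)"
  shows "smooth_on M W (\<lambda>x. \<Prod>i\<in>I. f i x)"
  using assms(2)
  by (induction I rule: infinite_finite_induct)
    (auto intro: smooth_on_const smooth_on_mult assms(1))

lemma smooth_on_compose:
  assumes W: "open W" and u: "smooth_on M W u" and S: "u ` W \<subseteq> S"
    and H: "\<And>h. h \<in> H \<Longrightarrow> \<exists>h'\<in>H. \<forall>s\<in>S. (h has_real_derivative h' s) (at s)" and h: "h \<in> H"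
  shows "smooth_on M W (\<lambda>x. h (u x))"
proof (rule smooth_onI)
  fix U \<phi> k assume c: "(U, \<phi>) \<in> atlas M"
  show "Ck_on (mdim M) k (\<phi> ` (U \<inter> W)) (\<lambda>y. h (u (inv_into U \<phi> y)))"
  proof (rule Ck_on_compose[OF openin_chart_image[OF c W] H _ smooth_onD[OF u c] h])
    show "(\<lambda>y. u (inv_into U \<phi> y)) ` \<phi> ` (U \<inter> W) \<subseteq> S"
      using S by (auto simp: chart_inv[OF c])
  qed
qed

text \<open>The functions \<open>c / s ^ m\<close> are closed under differentiation away from 0.\<close>

lemma smooth_on_inverse:
  assumes "open W" "smooth_on M W u" "\<And>x. x \<in> W \<Longrightarrow> u x \<noteq> 0"
  shows "smooth_on M W (\<lambda>x. inverse (u x))"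
proof -
  let ?h = "\<lambda>c m s. (c :: real) * inverse s ^ m"
  have D: "(?h c m has_real_derivative ?h (- (c * m)) (Suc m) s) (at s)" if "s \<noteq> 0" for c m and s :: real
  proof (cases m)
    case (Suc k)
    then show ?thesis
      using DERIV_cmult[OF DERIV_power_Suc[OF DERIV_inverse[OF that]], of c k UNIV]
      by (simp add: algebra_simps)
  qed auto
  have "smooth_on M W (\<lambda>x. ?h 1 1 (u x))"
  proof (rule smooth_on_compose[OF assms(1,2), where S = "- {0}" and H = "{?h c m |c m. True}"])
    show "u ` W \<subseteq> - {0}" using assms(3) by auto
    show "\<exists>h'\<in>{?h c m |c m. True}. \<forall>s\<in>- {0}. (h has_real_derivative h' s) (at s)"
      if "h \<in> {?h c m |c m. True}" for h
    proof -
      obtain c m where "h = ?h c m" using \<open>h \<in> _\<close> by blast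
      then have "\<forall>s\<in>- {0}. (h has_real_derivative ?h (- (c * m)) (Suc m) s) (at s)"
        using D by blast
      moreover have "?h (- (c * m)) (Suc m) \<in> {?h c m |c m. True}" by blast
      ultimately show ?thesis by (rule bexI)
    qed
    show "?h 1 1 \<in> {?h c m |c m. True}" by blast
  qed
  then show ?thesis by simp
qed

lemma smooth_on_flat:
  assumes "open W" "smooth_on M W u"
  shows "smooth_on M W (\<lambda>x. flat p (u x))"
  by (rule smooth_on_compose[OF assms, of UNIV "range flat"]) (auto intro: has_real_derivative_flat)

lemma smooth_on_coordinate:
  assumes "(U, \<phi>) \<in> atlas M" "i < mdim M"
  shows "smooth_on M U (\<lambda>x. \<phi> x i)"
proof (rule smooth_onI)
  fix V \<psi> k assume "(V, \<psi>) \<in> atlas M"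
  then have "Cinf_on (mdim M) (\<psi> ` (V \<inter> U)) (\<lambda>y. \<phi> (inv_into V \<psi> y) i)"
    using smooth_manifold assms unfolding smooth_manifold_def by blast
  then show "Ck_on (mdim M) k (\<psi> ` (V \<inter> U)) (\<lambda>y. \<phi> (inv_into V \<psi> y) i)"
    by (simp add: Cinf_on_def)
qed

lemma openin_Euclidean_space_contains_box:
  assumes V: "openin (Euclidean_space n) V" and q: "q \<in> V"
  obtains d where "d > 0" "{y. (\<forall>i<n. \<bar>y i - q i\<bar> \<le> d) \<and> (\<forall>i\<ge>n. y i = 0)} \<subseteq> V"
proof -
  obtain T where T: "openin (powertop_real UNIV) T" "V = T \<inter> {x. \<forall>i\<ge>n. x i = 0}"
    using V unfolding Euclidean_space_def openin_subtopology by auto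
  obtain X where X: "q \<in> (\<Pi>\<^sub>E i\<in>UNIV. X i)" "\<And>i. open (X i)" "(\<Pi>\<^sub>E i\<in>UNIV. X i) \<subseteq> T"
    using product_topology_open_contains_basis[OF T(1), of q] q T(2)
    by (auto simp only: open_openin)
  have "\<exists>d>0. cball (q i) d \<subseteq> X i" for i
    using X(1) open_contains_cball[THEN iffD1, OF X(2)] by (auto simp: PiE_iff)
  then obtain d where d: "\<And>i. d i > 0" "\<And>i. cball (q i) (d i) \<subseteq> X i" by metis
  \<comment> \<open>The 1 keeps the minimum defined for \<open>n = 0\<close>.\<close>
  define e where "e = Min (insert 1 (d ` {..<n}))"
  have "e > 0" unfolding e_def using d(1) by (subst Min_gr_iff) auto
  moreover have e: "e \<le> d i" if "i < n" for i
    unfolding e_def using that by (intro Min_le) auto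
  have "y \<in> V" if y: "\<forall>i<n. \<bar>y i - q i\<bar> \<le> e" "\<forall>i\<ge>n. y i = 0" for y
  proof -
    have "y i \<in> X i" for i
    proof (cases "i < n")
      case True
      then have "y i \<in> cball (q i) (d i)"
        using y(1) e[OF True] by (auto simp: dist_real_def abs_minus_commute intro: order_trans)
      then show ?thesis using d(2) by blast
    next
      case False
      then have "y i = q i" using y(2) q T(2) by auto
      then show ?thesis using X(1) by (auto simp: PiE_iff)
    qed
    then show ?thesis using X(3) T(2) y(2) by (auto simp: PiE_iff)
  qed
  ultimately show ?thesis using that[of e] by blast
qed

lemma compact_Euclidean_box:
  "compact {y :: nat \<Rightarrow> real. (\<forall>i<n. \<bar>y i - q i\<bar> \<le> d) \<and> (\<forall>i\<ge>n. y i = 0)}"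
proof -
  have "{y. (\<forall>i<n. \<bar>y i - q i\<bar> \<le> d) \<and> (\<forall>i\<ge>n. y i = 0)} =
      (\<Pi>\<^sub>E i\<in>UNIV. if i < n then cball (q i) d else {0})"
    by (auto simp: PiE_iff dist_real_def abs_minus_commute split: if_splits)
  moreover have "compactin (powertop_real UNIV) (\<Pi>\<^sub>E i\<in>UNIV. if i < n then cball (q i) d else {0})"
    unfolding compactin_PiE by simp
  ultimately show ?thesis by (simp add: euclidean_product_topology)
qed

text \<open>In a chart around \<open>p\<close>, the image of \<open>W\<close> contains a closed coordinate box with centre \<open>q\<close>,
  the image of \<open>p\<close>.  The product of the flat functions of \<open>d\<^sup>2 - (y\<^sub>i - q\<^sub>i)\<^sup>2\<close> is positive at
  \<open>q\<close> and vanishes outside this box.  The preimage \<open>K\<close> of the box is compact, hence closed, so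
  that the complement of \<open>K\<close> and the chart domain form an open cover; on each of the two sets
  the extension by zero is smooth.\<close>

lemma bump_function:
  assumes W: "open W" and p: "p \<in> W"
  obtains b K where "smooth_on M UNIV b" "b p = 1" "closed K" "K \<subseteq> W" "\<And>x. x \<notin> K \<Longrightarrow> b x = 0"
proof -
  obtain U \<phi> where c: "(U, \<phi>) \<in> atlas M" "p \<in> U" by (rule chart_exists)
  let ?n = "mdim M"
  have V: "openin (Euclidean_space ?n) (\<phi> ` (U \<inter> W))"
    by (rule openin_chart_image[OF c(1) W])
  then obtain d where d: "d > 0"
    "{y. (\<forall>i<?n. \<bar>y i - \<phi> p i\<bar> \<le> d) \<and> (\<forall>i\<ge>?n. y i = 0)} \<subseteq> \<phi> ` (U \<inter> W)" (is "?C \<subseteq> _")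
    using openin_Euclidean_space_contains_box[OF V, of "\<phi> p"] c(2) p by blast
  define K where "K = inv_into U \<phi> ` ?C"
  have "?C \<subseteq> \<phi> ` U" using d(2) by auto
  then have "continuous_on ?C (inv_into U \<phi>)"
    by (rule continuous_on_subset[OF homeomorphism_cont2[OF chart(3)[OF c(1)]]])
  then have "compact K"
    unfolding K_def by (rule compact_continuous_image) (rule compact_Euclidean_box)
  then have closed: "closed K" by (rule compact_imp_closed)
  have KUW: "K \<subseteq> U \<inter> W"
  proof
    fix x assume "x \<in> K"
    then obtain y where y: "y \<in> ?C" "x = inv_into U \<phi> y" unfolding K_def by blast
    then have "y \<in> \<phi> ` (U \<inter> W)" using d(2) by blast
    then obtain z where "z \<in> U \<inter> W" "y = \<phi> z" by blast
    then show "x \<in> U \<inter> W" using y(2) chart_inv[OF c(1), of z] by simp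
  qed
  have inK: "x \<in> K" if "x \<in> U" "\<forall>i<?n. \<bar>\<phi> x i - \<phi> p i\<bar> \<le> d" for x
  proof -
    have "\<phi> x \<in> topspace (Euclidean_space ?n)"
      using chart(2)[OF c(1)] openin_subset that(1) by blast
    then have "\<phi> x \<in> ?C" using that(2) by (auto simp: topspace_Euclidean_space)
    then have "inv_into U \<phi> (\<phi> x) \<in> K" unfolding K_def by (rule imageI)
    then show ?thesis by (simp only: chart_inv[OF c(1) that(1)])
  qed
  define b0 where "b0 x = (\<Prod>i<?n. flat 1 (d^2 - (\<phi> x i - \<phi> p i)^2))" for x
  define b where "b x = (if x \<in> U then b0 x / b0 p else 0)" for x
  have b0p: "b0 p \<noteq> 0"
    using d(1) by (simp add: b0_def flat_def)
  have b0: "smooth_on M U b0"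
    unfolding b0_def power2_eq_square
    by (intro smooth_on_prod smooth_on_flat smooth_on_diff smooth_on_mult smooth_on_const
        smooth_on_coordinate[OF c(1)] chart(1)[OF c(1)]) auto
  have supp: "b x = 0" if "x \<notin> K" for x
  proof (cases "x \<in> U")
    case True
    then have "\<not> (\<forall>i<?n. \<bar>\<phi> x i - \<phi> p i\<bar> \<le> d)" using inK that by blast
    then obtain i where i: "i < ?n" "\<bar>\<phi> x i - \<phi> p i\<bar> > d" by (auto simp: not_le)
    then have "d^2 \<le> (\<phi> x i - \<phi> p i)^2"
      using d(1) abs_le_square_iff[of d "\<phi> x i - \<phi> p i"] by simp
    then have "flat 1 (d^2 - (\<phi> x i - \<phi> p i)^2) = 0" by (simp add: flat_def)
    then have "b0 x = 0" unfolding b0_def using i(1) by (intro prod_zero) auto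
    then show ?thesis by (simp add: b_def)
  qed (simp add: b_def)
  have "smooth_on M U b"
    by (rule smooth_on_cong[OF chart(1)[OF c(1)]
          smooth_on_mult[OF chart(1)[OF c(1)] b0 smooth_on_const[OF chart(1)[OF c(1)], of "1 / b0 p"]]])
      (simp add: b_def)
  moreover have "smooth_on M (- K) b"
    by (rule smooth_on_cong[OF _ smooth_on_const[of _ 0]]) (use closed supp in auto)
  ultimately have "smooth_on M (\<Union>{U, - K}) b"
    using closed chart(1)[OF c(1)] by (intro smooth_on_Union) auto
  moreover have "\<Union>{U, - K} = UNIV" using KUW by auto
  ultimately have "smooth_on M UNIV b" by simp
  moreover have "b p = 1" using b0p c(2) by (simp add: b_def)
  moreover have "K \<subseteq> W" using KUW by blast
  ultimately show ?thesis using that closed supp by blast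
qed

subsection \<open>Linear systems with smooth coefficients\<close>

lemma smooth_on_det:
  assumes W: "open W" and G: "\<And>i j. i < n \<Longrightarrow> j < n \<Longrightarrow> smooth_on M W (\<lambda>x. G x i j)"
  shows "smooth_on M W (\<lambda>x. det (mat n n (\<lambda>(i, j). G x i j)))"
proof -
  have "smooth_on M W (\<lambda>x. \<Sum>p\<in>{p. p permutes {0..<n}}. signof p * (\<Prod>i = 0..<n. G x i (p i)))"
  proof (intro smooth_on_sum smooth_on_mult smooth_on_prod smooth_on_const W)
    fix p i assume "p \<in> {p. p permutes {0..<n}}" "i \<in> {0..<n}"
    then have "i < n" "p i < n" using permutes_in_image[of p "{0..<n}" i] by auto
    then show "smooth_on M W (\<lambda>x. G x i (p i))" by (rule G)
  qed
  moreover have "det (mat n n (\<lambda>(i, j). G x i j)) =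
      (\<Sum>p\<in>{p. p permutes {0..<n}}. signof p * (\<Prod>i = 0..<n. G x i (p i)))" for x
  proof -
    have "(\<Prod>i = 0..<n. mat n n (\<lambda>(i, j). G x i j) $$ (i, p i)) = (\<Prod>i = 0..<n. G x i (p i))"
      if "p permutes {0..<n}" for p
    proof (rule prod.cong[OF refl])
      fix i assume "i \<in> {0..<n}"
      then have "i < n" "p i < n" using permutes_in_image[OF that, of i] by auto
      then show "mat n n (\<lambda>(i, j). G x i j) $$ (i, p i) = G x i (p i)" by simp
    qed
    then show ?thesis
      by (subst det_def'[of _ n]) (auto intro!: sum.cong)
  qed
  ultimately show ?thesis by simp
qed

text \<open>Cramer's rule: the entries of the adjugate matrix and the determinant are polynomials in
  the coefficients, hence smooth, and injectivity at every point makes the determinant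
  invertible.\<close>

lemma smooth_linear_system:
  fixes n :: nat
  assumes W: "open W" and G: "\<And>i j. i < n \<Longrightarrow> j < n \<Longrightarrow> smooth_on M W (\<lambda>x. G x i j)"
    and \<beta>: "\<And>j. j < n \<Longrightarrow> smooth_on M W (\<beta> j)"
    and inj: "\<And>x a. x \<in> W \<Longrightarrow> (\<forall>j<n. (\<Sum>i<n. G x j i * a i) = 0) \<Longrightarrow> (\<forall>i<n. a i = 0)"
  obtains a where "\<And>i. i < n \<Longrightarrow> smooth_on M W (a i)"
    "\<And>x j. x \<in> W \<Longrightarrow> j < n \<Longrightarrow> (\<Sum>i<n. G x j i * a i x) = \<beta> j x"
proof -
  define A where "A x = mat n n (\<lambda>(i, j). G x i j)" for x
  have A: "A x \<in> carrier_mat n n" for x by (simp add: A_def)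
  have det: "det (A x) \<noteq> 0" if "x \<in> W" for x
  proof
    assume "det (A x) = 0"
    then obtain v where v: "v \<in> carrier_vec n" "v \<noteq> 0\<^sub>v n" "A x *\<^sub>v v = 0\<^sub>v n"
      using det_0_iff_vec_prod_zero[OF A] by blast
    have "(\<Sum>i<n. G x j i * v $ i) = 0" if "j < n" for j
    proof -
      have "(A x *\<^sub>v v) $ j = (\<Sum>i<n. G x j i * v $ i)"
        using that v(1) by (auto simp: A_def scalar_prod_def atLeast0LessThan intro!: sum.cong)
      then show ?thesis using v(3) that by simp
    qed
    then have "\<forall>i<n. v $ i = 0" using inj[OF that, of "\<lambda>i. v $ i"] by blast
    then have "v = 0\<^sub>v n" using v(1) by (intro eq_vecI) auto
    then show False using v(2) by simp
  qed
  have adj: "smooth_on M W (\<lambda>x. adj_mat (A x) $$ (i, j))" if ij: "i < n" "j < n" for i j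
  proof -
    \<comment> \<open>Deleting row \<open>j\<close> and column \<open>i\<close> shifts the later indices by one.\<close>
    let ?s = "\<lambda>k l. if l < k then l else Suc l"
    have "smooth_on M W (\<lambda>x. det (mat (n - 1) (n - 1) (\<lambda>(k, l). G x (?s j k) (?s i l))))"
      by (rule smooth_on_det[OF W]) (rule G; use ij in auto)
    moreover have "mat_delete (A x) j i = mat (n - 1) (n - 1) (\<lambda>(k, l). G x (?s j k) (?s i l))" for x
      using ij by (auto simp: mat_delete_def A_def intro!: eq_matI)
    moreover have "adj_mat (A x) $$ (i, j) = (- 1) ^ (j + i) * det (mat_delete (A x) j i)" for x
      using ij A[of x] by (simp add: adj_mat_def cofactor_def)
    ultimately show ?thesis
      using smooth_on_mult[OF W smooth_on_const[OF W]] by simp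
  qed
  define a where "a i x = inverse (det (A x)) * (\<Sum>j<n. adj_mat (A x) $$ (i, j) * \<beta> j x)" for i x
  have "smooth_on M W (a i)" if "i < n" for i
    unfolding a_def
  proof (intro smooth_on_mult smooth_on_sum smooth_on_inverse W)
    show "smooth_on M W (\<lambda>x. det (A x))" unfolding A_def by (rule smooth_on_det[OF W G])
  qed (use adj \<beta> det that in auto)
  moreover have "(\<Sum>i<n. G x j i * a i x) = \<beta> j x" if x: "x \<in> W" and j: "j < n" for x j
  proof -
    have prod: "(\<Sum>i<n. G x j i * adj_mat (A x) $$ (i, k)) = (if j = k then det (A x) else 0)"
      if "k < n" for k
    proof -
      have "(A x * adj_mat (A x)) $$ (j, k) = (\<Sum>i<n. G x j i * adj_mat (A x) $$ (i, k))"
        using j that adj_mat(1)[OF A[of x]]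
        by (auto simp: A_def scalar_prod_def atLeast0LessThan intro!: sum.cong)
      then show ?thesis using adj_mat(2)[OF A[of x]] j that by (auto split: if_splits)
    qed
    have "(\<Sum>i<n. G x j i * a i x) =
        (\<Sum>i<n. \<Sum>k<n. inverse (det (A x)) * (\<beta> k x * (G x j i * adj_mat (A x) $$ (i, k))))"
      by (simp add: a_def sum_distrib_left mult_ac)
    also have "\<dots> = (\<Sum>k<n. inverse (det (A x)) * (\<beta> k x * (\<Sum>i<n. G x j i * adj_mat (A x) $$ (i, k))))"
      by (subst sum.swap) (simp add: sum_distrib_left)
    also have "\<dots> = (\<Sum>k<n. if j = k then inverse (det (A x)) * (\<beta> k x * det (A x)) else 0)"
      by (intro sum.cong refl) (simp add: prod)
    also have "\<dots> = \<beta> j x"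
      using j det[OF x] by simp
    finally show ?thesis .
  qed
  ultimately show ?thesis using that by blast
qed

end

section \<open>Sections of a Courant algebroid\<close>

locale courant_algebroid_locale =
  fixes M :: "('m::{t2_space, second_countable_topology}) manifold"
    and E :: "('m, 'v::real_vector) courant"
  assumes courant_algebroid: "courant_algebroid M E"

sublocale courant_algebroid_locale \<subseteq> smooth_manifold_locale M
  using courant_algebroid by unfold_locales (simp add: courant_algebroid_def)

context courant_algebroid_locale
begin

abbreviation r where "r \<equiv> rank E"
abbreviation \<Gamma> where "\<Gamma> \<equiv> sections M E"
abbreviation C where "C \<equiv> smooth_functions M"

lemma vector_bundle: "vector_bundle M E"
  and bundle_metric: "bundle_metric M E"
  and bundle_map: "bundle_map_to_tangent M E"
  using courant_algebroid unfolding courant_algebroid_def by auto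

lemma subspace_fibre: "subspace (fibre E x)"
  using vector_bundle unfolding vector_bundle_def by blast

lemma triv:
  assumes "(W, t) \<in> trivs E"
  shows "open W"
    and "x \<in> W \<Longrightarrow> bij_betw (t x) (fibre E x) {v. \<forall>i\<ge>r. v i = 0}"
    and "x \<in> W \<Longrightarrow> v \<in> fibre E x \<Longrightarrow> w \<in> fibre E x \<Longrightarrow>
      t x (a *\<^sub>R v + b *\<^sub>R w) = a *\<^sub>R t x v + b *\<^sub>R t x w"
proof -
  have "\<forall>(W, t) \<in> trivs E. open W \<and>
      (\<forall>x\<in>W. bij_betw (t x) (fibre E x) {v. \<forall>i\<ge>r. v i = 0} \<and>
        (\<forall>v\<in>fibre E x. \<forall>w\<in>fibre E x. \<forall>a b. t x (a *\<^sub>R v + b *\<^sub>R w) = a *\<^sub>R t x v + b *\<^sub>R t x w))"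
    using vector_bundle unfolding vector_bundle_def topspace_Euclidean_space by (elim conjE)
  from bspec[OF this assms]
  show "open W"
    and "x \<in> W \<Longrightarrow> bij_betw (t x) (fibre E x) {v. \<forall>i\<ge>r. v i = 0}"
    and "x \<in> W \<Longrightarrow> v \<in> fibre E x \<Longrightarrow> w \<in> fibre E x \<Longrightarrow>
      t x (a *\<^sub>R v + b *\<^sub>R w) = a *\<^sub>R t x v + b *\<^sub>R t x w"
    by simp_all
qed

lemma smooth_frame_transition:
  assumes "(W, t) \<in> trivs E" "(W', t') \<in> trivs E" "i < r" "j < r"
  shows "smooth_on M (W \<inter> W') (\<lambda>x. t' x (frame E t j x) i)"
proof -
  have "\<forall>(W, t) \<in> trivs E. \<forall>(W', t') \<in> trivs E. \<forall>i<r. \<forall>j<r.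
      smooth_on M (W \<inter> W') (\<lambda>x. t' x (frame E t j x) i)"
    using vector_bundle unfolding vector_bundle_def by (elim conjE)
  from bspec[OF this assms(1)] show ?thesis using assms(2-4) by blast
qed

lemma smooth_frame_pairing:
  assumes "(W, t) \<in> trivs E" "i < r" "j < r"
  shows "smooth_on M W (\<lambda>x. pairing E x (frame E t i x) (frame E t j x))"
proof -
  have "\<forall>(W, t) \<in> trivs E. \<forall>i<r. \<forall>j<r.
      smooth_on M W (\<lambda>x. pairing E x (frame E t i x) (frame E t j x))"
    using bundle_metric unfolding bundle_metric_def by (elim conjE)
  from bspec[OF this assms(1)] show ?thesis using assms(2,3) by blast
qed

lemma triv_exists:
  obtains W t where "(W, t) \<in> trivs E" "x \<in> W"
proof -
  have "x \<in> (\<Union>(W, t) \<in> trivs E. W)"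
    using vector_bundle unfolding vector_bundle_def by auto
  then show ?thesis using that by auto
qed

lemma smooth_on_trivs:
  assumes "\<And>W t. (W, t) \<in> trivs E \<Longrightarrow> smooth_on M W f"
  shows "smooth_on M UNIV f"
proof -
  have "smooth_on M (\<Union>(fst ` trivs E)) f"
  proof (rule smooth_on_Union)
    fix W assume "W \<in> fst ` trivs E"
    then obtain t where W: "(W, t) \<in> trivs E" by auto
    show "open W" "smooth_on M W f" using triv(1)[OF W] assms[OF W] by auto
  qed
  moreover have "\<Union>(fst ` trivs E) = UNIV"
  proof -
    have "x \<in> \<Union>(fst ` trivs E)" for x
      by (rule triv_exists[of x]) (rule UnionI, rule image_eqI, auto)
    then show ?thesis by blast
  qed
  ultimately show ?thesis by simp
qed

lemma frame:
  assumes "(W, t) \<in> trivs E" "x \<in> W" "j < r"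
  shows "frame E t j x \<in> fibre E x" "t x (frame E t j x) = (\<lambda>i. if i = j then 1 else 0)"
proof -
  have "(\<lambda>i. if i = j then 1 else 0) \<in> t x ` fibre E x"
    using triv(2)[OF assms(1,2)] assms(3) unfolding bij_betw_def by auto
  then show "frame E t j x \<in> fibre E x" "t x (frame E t j x) = (\<lambda>i. if i = j then 1 else 0)"
    unfolding frame_def by (auto intro: inv_into_into f_inv_into_f)
qed

lemma fibre_comb: "v \<in> fibre E x \<Longrightarrow> w \<in> fibre E x \<Longrightarrow> a *\<^sub>R v + b *\<^sub>R w \<in> fibre E x"
  using subspace_fibre by (intro subspace_add subspace_mul)

lemma fibre_sum: "(\<And>i. i \<in> I \<Longrightarrow> v i \<in> fibre E x) \<Longrightarrow> (\<Sum>i\<in>I. c i *\<^sub>R v i) \<in> fibre E x"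
  using subspace_fibre by (intro subspace_sum subspace_mul)

text \<open>Shared by the trivialisations, the pairing and the anchor, whose linearity is assumed for
  two summands in a fibre only.\<close>

lemma fibrewise_linear_sum:
  fixes L :: "'v \<Rightarrow> 'b::real_vector"
  assumes L: "\<And>v w a b. v \<in> fibre E x \<Longrightarrow> w \<in> fibre E x \<Longrightarrow> L (a *\<^sub>R v + b *\<^sub>R w) = a *\<^sub>R L v + b *\<^sub>R L w"
    and v: "\<And>i. i \<in> I \<Longrightarrow> v i \<in> fibre E x"
  shows "L (\<Sum>i\<in>I. c i *\<^sub>R v i) = (\<Sum>i\<in>I. c i *\<^sub>R L (v i))"
proof -
  have 0: "L 0 = 0"
    using L[of 0 0 0 0] subspace_0[OF subspace_fibre] by simp
  show ?thesis
    using v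
  proof (induction I rule: infinite_finite_induct)
    case (insert i I)
    then have "L (c i *\<^sub>R v i + 1 *\<^sub>R (\<Sum>i\<in>I. c i *\<^sub>R v i)) = c i *\<^sub>R L (v i) + 1 *\<^sub>R L (\<Sum>i\<in>I. c i *\<^sub>R v i)"
      by (intro L fibre_sum) auto
    then show ?case using insert by simp
  qed (simp_all add: 0)
qed

lemma triv_sum:
  assumes "(W, t) \<in> trivs E" "x \<in> W" "\<And>i. i \<in> I \<Longrightarrow> v i \<in> fibre E x"
  shows "t x (\<Sum>i\<in>I. c i *\<^sub>R v i) k = (\<Sum>i\<in>I. c i * t x (v i) k)"
proof -
  have "t x (\<Sum>i\<in>I. c i *\<^sub>R v i) k = (\<Sum>i\<in>I. c i *\<^sub>R t x (v i) k)"
    by (rule fibrewise_linear_sum[where L = "\<lambda>v. t x v k" and x = x])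
      (use triv(3)[OF assms(1,2)] assms(3) in \<open>simp_all add: scaleR_fun_def\<close>)
  then show ?thesis by simp
qed

lemma triv_frame_sum:
  assumes "(W, t) \<in> trivs E" "x \<in> W" "i < r"
  shows "t x (\<Sum>j<r. c j *\<^sub>R frame E t j x) i = c i"
proof -
  have "t x (\<Sum>j<r. c j *\<^sub>R frame E t j x) i = (\<Sum>j<r. c j * (if i = j then 1 else 0))"
    by (subst triv_sum[OF assms(1,2)]) (auto simp: frame[OF assms(1,2)])
  then show ?thesis using assms(3) by (simp add: if_distrib[of "(*) _"] cong: if_cong)
qed

lemma frame_sum_in_fibre:
  assumes "(W, t) \<in> trivs E" "x \<in> W"
  shows "(\<Sum>j<r. c j *\<^sub>R frame E t j x) \<in> fibre E x"
  by (rule fibre_sum) (use frame[OF assms] in auto)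

lemma frame_expansion:
  assumes "(W, t) \<in> trivs E" "x \<in> W" "v \<in> fibre E x"
  shows "(\<Sum>j<r. t x v j *\<^sub>R frame E t j x) = v"
proof -
  note bij = triv(2)[OF assms(1,2)]
  let ?s = "\<Sum>j<r. t x v j *\<^sub>R frame E t j x"
  have s: "?s \<in> fibre E x" by (rule frame_sum_in_fibre[OF assms(1,2)])
  have "t x ?s i = t x v i" for i
  proof (cases "i < r")
    case True
    then show ?thesis by (rule triv_frame_sum[OF assms(1,2)])
  next
    case False
    then show ?thesis
      using bij_betwE[OF bij] s assms(3) by simp
  qed
  then have "t x ?s = t x v" by blast
  then show ?thesis
    by (rule inj_onD[OF bij_betw_imp_inj_on[OF bij] _ s assms(3)])
qed

lemma pairing_linear_left:
  "u \<in> fibre E x \<Longrightarrow> v \<in> fibre E x \<Longrightarrow> w \<in> fibre E x \<Longrightarrow>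
    pairing E x (a *\<^sub>R u + b *\<^sub>R v) w = a * pairing E x u w + b * pairing E x v w"
  using bundle_metric[unfolded bundle_metric_def, THEN conjunct1] by blast

lemma pairing_sym: "v \<in> fibre E x \<Longrightarrow> w \<in> fibre E x \<Longrightarrow> pairing E x v w = pairing E x w v"
  using bundle_metric[unfolded bundle_metric_def, THEN conjunct2, THEN conjunct1] by blast

lemma pairing_linear_right:
  "u \<in> fibre E x \<Longrightarrow> v \<in> fibre E x \<Longrightarrow> w \<in> fibre E x \<Longrightarrow>
    pairing E x w (a *\<^sub>R u + b *\<^sub>R v) = a * pairing E x w u + b * pairing E x w v"
  using pairing_linear_left[of u x v w a b] pairing_sym[of w x] fibre_comb[of u x v a b] by simp

lemma pairing_nondegenerate:
  "v \<in> fibre E x \<Longrightarrow> (\<And>w. w \<in> fibre E x \<Longrightarrow> pairing E x v w = 0) \<Longrightarrow> v = 0"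
  using bundle_metric[unfolded bundle_metric_def, THEN conjunct2, THEN conjunct2, THEN conjunct1]
  by blast

lemma anchor_linear:
  "v \<in> fibre E x \<Longrightarrow> w \<in> fibre E x \<Longrightarrow>
    anchor E x (a *\<^sub>R v + b *\<^sub>R w) = a *\<^sub>R anchor E x v + b *\<^sub>R anchor E x w"
  using bundle_map[unfolded bundle_map_to_tangent_def, THEN conjunct2, THEN conjunct1] by blast

lemma anchor_tangent: "v \<in> fibre E x \<Longrightarrow> anchor E x v \<in> tangent_space M x"
  using bundle_map[unfolded bundle_map_to_tangent_def, THEN conjunct1] by blast

lemma pairing_frame_sum_left:
  assumes "(W, t) \<in> trivs E" "x \<in> W" "w \<in> fibre E x"
  shows "pairing E x (\<Sum>i<r. c i *\<^sub>R frame E t i x) w = (\<Sum>i<r. c i * pairing E x (frame E t i x) w)"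
  using fibrewise_linear_sum[where L = "\<lambda>v. pairing E x v w" and x = x and I = "{..<r}"
      and v = "\<lambda>i. frame E t i x" and c = c]
  by (simp add: pairing_linear_left assms(3) frame[OF assms(1,2)])

lemma pairing_frame_expansion_right:
  assumes "(W, t) \<in> trivs E" "x \<in> W" "v \<in> fibre E x" "w \<in> fibre E x"
  shows "pairing E x v w = (\<Sum>j<r. t x w j * pairing E x v (frame E t j x))"
proof -
  have "pairing E x v (\<Sum>j<r. t x w j *\<^sub>R frame E t j x) = (\<Sum>j<r. t x w j * pairing E x v (frame E t j x))"
    using fibrewise_linear_sum[where L = "pairing E x v" and x = x and I = "{..<r}"
        and v = "\<lambda>i. frame E t i x" and c = "t x w"]
    by (simp add: pairing_linear_right assms(3) frame[OF assms(1,2)])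
  then show ?thesis by (simp add: frame_expansion[OF assms(1,2,4)])
qed

lemma anchor_frame_expansion:
  assumes "(W, t) \<in> trivs E" "x \<in> W" "v \<in> fibre E x"
  shows "anchor E x v f = (\<Sum>j<r. t x v j * anchor E x (frame E t j x) f)"
proof -
  have "anchor E x (\<Sum>j<r. t x v j *\<^sub>R frame E t j x) f = (\<Sum>j<r. t x v j * anchor E x (frame E t j x) f)"
    using fibrewise_linear_sum[where L = "\<lambda>v. anchor E x v f" and x = x and I = "{..<r}"
        and v = "\<lambda>i. frame E t i x" and c = "t x v"]
    by (simp add: anchor_linear frame[OF assms(1,2)] scaleR_fun_def)
  then show ?thesis by (simp add: frame_expansion[OF assms])
qed

lemma section_in_fibre: "e \<in> \<Gamma> \<Longrightarrow> e x \<in> fibre E x"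
  unfolding sections_def by blast

lemma section_smooth: "e \<in> \<Gamma> \<Longrightarrow> (W, t) \<in> trivs E \<Longrightarrow> i < r \<Longrightarrow> smooth_on M W (\<lambda>x. t x (e x) i)"
  unfolding sections_def by blast

lemma sectionI:
  assumes "\<And>x. e x \<in> fibre E x"
    and "\<And>W t i. (W, t) \<in> trivs E \<Longrightarrow> i < r \<Longrightarrow> smooth_on M W (\<lambda>x. t x (e x) i)"
  shows "e \<in> \<Gamma>"
  using assms unfolding sections_def by blast

lemma section_comb:
  assumes "e \<in> \<Gamma>" "h \<in> \<Gamma>"
  shows "a *\<^sub>R e + b *\<^sub>R h \<in> \<Gamma>"
proof (rule sectionI)
  show "(a *\<^sub>R e + b *\<^sub>R h) x \<in> fibre E x" for x
    using fibre_comb section_in_fibre assms by (simp add: scaleR_fun_def)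
  fix W t i assume W: "(W, t) \<in> trivs E" and i: "i < r"
  show "smooth_on M W (\<lambda>x. t x ((a *\<^sub>R e + b *\<^sub>R h) x) i)"
  proof (rule smooth_on_cong[OF triv(1)[OF W]])
    show "smooth_on M W (\<lambda>x. a * t x (e x) i + b * t x (h x) i)"
      using W i assms by (intro smooth_on_add smooth_on_mult smooth_on_const section_smooth triv(1))
    show "a * t x (e x) i + b * t x (h x) i = t x ((a *\<^sub>R e + b *\<^sub>R h) x) i" if "x \<in> W" for x
      using triv(3)[OF W that] section_in_fibre assms by (simp add: scaleR_fun_def)
  qed
qed

lemma smooth_pair:
  assumes "e \<in> \<Gamma>" "h \<in> \<Gamma>"
  shows "pair E e h \<in> C"
proof -
  have "smooth_on M W (pair E e h)" if W: "(W, t) \<in> trivs E" for W t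
  proof (rule smooth_on_cong[OF triv(1)[OF W]])
    show "smooth_on M W (\<lambda>x. \<Sum>j<r. t x (h x) j *
        (\<Sum>i<r. t x (e x) i * pairing E x (frame E t i x) (frame E t j x)))"
    proof (intro smooth_on_sum smooth_on_mult section_smooth[OF _ W] assms triv(1)[OF W])
      show "smooth_on M W (\<lambda>x. pairing E x (frame E t i x) (frame E t j x))"
        if "i \<in> {..<r}" "j \<in> {..<r}" for i j
        using smooth_frame_pairing[OF W] that by simp
    qed auto
    show "(\<Sum>j<r. t x (h x) j * (\<Sum>i<r. t x (e x) i * pairing E x (frame E t i x) (frame E t j x)))
        = pair E e h x" if "x \<in> W" for x
      unfolding pair_def
      by (subst pairing_frame_expansion_right[OF W that])
        (auto simp: section_in_fibre assms frame[OF W that] frame_expansion[OF W that]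
          pairing_frame_sum_left[OF W that, symmetric])
  qed
  then show ?thesis
    unfolding smooth_functions_def by (simp add: smooth_on_trivs)
qed

lemma smooth_anchor_frame:
  assumes "(W, t) \<in> trivs E" "j < r" "f \<in> C"
  shows "smooth_on M W (\<lambda>x. anchor E x (frame E t j x) f)"
proof -
  have "\<forall>(W, t) \<in> trivs E. \<forall>j<r. smooth_vector_field_on M W (\<lambda>x. anchor E x (frame E t j x))"
    using bundle_map unfolding bundle_map_to_tangent_def by (elim conjE)
  from bspec[OF this assms(1)] show ?thesis
    using assms(2,3) unfolding smooth_vector_field_on_def by simp
qed

lemma smooth_along:
  assumes "e \<in> \<Gamma>" "f \<in> C"
  shows "along E e f \<in> C"
proof -
  have "smooth_on M W (along E e f)" if W: "(W, t) \<in> trivs E" for W t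
  proof (rule smooth_on_cong[OF triv(1)[OF W]])
    show "smooth_on M W (\<lambda>x. \<Sum>j<r. t x (e x) j * anchor E x (frame E t j x) f)"
      by (intro smooth_on_sum smooth_on_mult section_smooth[OF _ W] assms triv(1)[OF W]
          smooth_anchor_frame[OF W]) auto
    show "(\<Sum>j<r. t x (e x) j * anchor E x (frame E t j x) f) = along E e f x" if "x \<in> W" for x
      using anchor_frame_expansion[OF W that section_in_fibre[OF assms(1)]]
      by (simp add: along_def anch_def)
  qed
  then show ?thesis
    unfolding smooth_functions_def by (simp add: smooth_on_trivs)
qed

text \<open>Extend the vector with constant coefficients in a local frame and cut off by a bump
  function.  On any other trivialisation the result is smooth on the overlap, by smoothness of
  the transition functions, and zero away from the support.\<close>

lemma section_through:
  assumes v: "v \<in> fibre E x"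
  obtains e where "e \<in> \<Gamma>" "e x = v"
proof -
  obtain W t where W: "(W, t) \<in> trivs E" "x \<in> W" by (rule triv_exists)
  obtain b K where b: "smooth_on M UNIV b" "b x = 1" "closed K" "K \<subseteq> W" "\<And>y. y \<notin> K \<Longrightarrow> b y = 0"
    using bump_function[OF triv(1)[OF W(1)] W(2)] by metis
  define e where "e y = (if y \<in> W then \<Sum>j<r. (b y * t x v j) *\<^sub>R frame E t j y else 0)" for y
  have "e \<in> \<Gamma>"
  proof (rule sectionI)
    show "e y \<in> fibre E y" for y
      unfolding e_def using frame_sum_in_fibre[OF W(1)] subspace_0[OF subspace_fibre] by auto
    fix W' t' i assume W': "(W', t') \<in> trivs E" and i: "i < r"
    have "smooth_on M (W \<inter> W') (\<lambda>y. t' y (e y) i)"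
    proof (rule smooth_on_cong)
      show op: "open (W \<inter> W')" using triv(1) W W' by blast
      show "smooth_on M (W \<inter> W') (\<lambda>y. \<Sum>j<r. (b y * t x v j) * t' y (frame E t j y) i)"
      proof (intro smooth_on_sum smooth_on_mult smooth_on_const op smooth_on_subset[OF b(1)])
        show "smooth_on M (W \<inter> W') (\<lambda>y. t' y (frame E t j y) i)" if "j \<in> {..<r}" for j
          using smooth_frame_transition[OF W(1) W' i] that by simp
      qed auto
      show "(\<Sum>j<r. (b y * t x v j) * t' y (frame E t j y) i) = t' y (e y) i"
        if "y \<in> W \<inter> W'" for y
        using that triv_sum[OF W', of y "{..<r}"] frame[OF W(1)] by (simp add: e_def)
    qed
    moreover have "smooth_on M (- K \<inter> W') (\<lambda>y. t' y (e y) i)"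
    proof (rule smooth_on_cong[OF _ smooth_on_const])
      show "open (- K \<inter> W')" "open (- K \<inter> W')" using triv(1)[OF W'] b(3) by auto
      show "0 = t' y (e y) i" if "y \<in> - K \<inter> W'" for y
        using that triv_sum[OF W', of y "{}"] b(5) by (simp add: e_def)
    qed
    ultimately have "smooth_on M (\<Union>{W \<inter> W', - K \<inter> W'}) (\<lambda>y. t' y (e y) i)"
      using triv(1) W W' b(3) by (intro smooth_on_Union) auto
    moreover have "\<Union>{W \<inter> W', - K \<inter> W'} = W'" using b(4) by auto
    ultimately show "smooth_on M W' (\<lambda>y. t' y (e y) i)" by simp
  qed
  moreover have "e x = v"
    using W v b(2) by (simp add: e_def frame_expansion)
  ultimately show ?thesis by (rule that)
qed

text \<open>Each fibre vector extends to a global section, so this is nondegeneracy of the pairing on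
  the fibres.\<close>

lemma pair_nondegenerate:
  assumes "u \<in> \<Gamma>" "u' \<in> \<Gamma>" "\<And>e. e \<in> \<Gamma> \<Longrightarrow> pair E u e = pair E u' e"
  shows "u = u'"
proof
  fix x
  have "1 *\<^sub>R u x + (- 1) *\<^sub>R u' x = 0"
  proof (rule pairing_nondegenerate)
    show "1 *\<^sub>R u x + (- 1) *\<^sub>R u' x \<in> fibre E x"
      using assms(1,2) by (intro fibre_comb section_in_fibre)
    fix w assume w: "w \<in> fibre E x"
    obtain e where e: "e \<in> \<Gamma>" "e x = w" using section_through[OF w] by blast
    have "pairing E x (u x) w = pairing E x (u' x) w"
      using fun_cong[OF assms(3)[OF e(1)], of x] e(2) by (simp add: pair_def)
    then show "pairing E x (1 *\<^sub>R u x + (- 1) *\<^sub>R u' x) w = 0"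
      using pairing_linear_left[OF _ _ w, of "u x" "u' x" 1 "- 1"] assms(1,2) section_in_fibre by simp
  qed
  then show "u x = u' x" by simp
qed

text \<open>The value of \<open>\<D> f\<close> at a point is determined by nondegeneracy on the fibre.  In a local
  frame its coefficients solve the linear system whose matrix is the Gram matrix of the frame,
  so the pointwise solutions fit together to a smooth section.\<close>

lemma gradient_exists:
  assumes f: "f \<in> C"
  obtains u where "u \<in> \<Gamma>" "\<And>e. e \<in> \<Gamma> \<Longrightarrow> pair E u e = along E e f"
proof -
  define grad where "grad x v \<longleftrightarrow> v \<in> fibre E x \<and> (\<forall>w\<in>fibre E x. pairing E x v w = anchor E x w f)" for x v
  have unique: "v = v'" if "grad x v" "grad x v'" for x v v'
  proof -
    have "1 *\<^sub>R v + (- 1) *\<^sub>R v' = 0"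
    proof (rule pairing_nondegenerate)
      show "1 *\<^sub>R v + (- 1) *\<^sub>R v' \<in> fibre E x"
        using that unfolding grad_def by (intro fibre_comb) auto
      show "pairing E x (1 *\<^sub>R v + (- 1) *\<^sub>R v') w = 0" if "w \<in> fibre E x" for w
        using pairing_linear_left[OF _ _ that, of v v' 1 "- 1"] \<open>grad x v\<close> \<open>grad x v'\<close> that
        unfolding grad_def by simp
    qed
    then show ?thesis by simp
  qed
  have local: "\<exists>a. (\<forall>i<r. smooth_on M W (a i)) \<and> (\<forall>x\<in>W. grad x (\<Sum>i<r. a i x *\<^sub>R frame E t i x))"
    if W: "(W, t) \<in> trivs E" for W t
  proof -
    let ?G = "\<lambda>x j i. pairing E x (frame E t i x) (frame E t j x)"
    have G: "smooth_on M W (\<lambda>x. ?G x j i)" if "j < r" "i < r" for i j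
      using smooth_frame_pairing[OF W] that by simp
    have inj: "\<forall>i<r. a i = 0" if x: "x \<in> W" and a: "\<forall>j<r. (\<Sum>i<r. ?G x j i * a i) = 0" for x a
    proof -
      let ?v = "\<Sum>i<r. a i *\<^sub>R frame E t i x"
      have v: "?v \<in> fibre E x" by (rule frame_sum_in_fibre[OF W x])
      have "?v = 0"
      proof (rule pairing_nondegenerate[OF v])
        fix w assume w: "w \<in> fibre E x"
        have "pairing E x ?v (frame E t j x) = 0" if "j < r" for j
          using a that pairing_frame_sum_left[OF W x frame(1)[OF W x that]] by (simp add: mult.commute)
        then show "pairing E x ?v w = 0"
          using pairing_frame_expansion_right[OF W x v w] by simp
      qed
      then show ?thesis
        using triv_frame_sum[OF W x, of _ a] triv_sum[OF W x, of "{}"] by simp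
    qed
    obtain a where a: "\<And>i. i < r \<Longrightarrow> smooth_on M W (a i)"
      "\<And>x j. x \<in> W \<Longrightarrow> j < r \<Longrightarrow> (\<Sum>i<r. ?G x j i * a i x) = anchor E x (frame E t j x) f"
    proof (rule smooth_linear_system[where W = W and n = r and G = ?G
          and \<beta> = "\<lambda>j x. anchor E x (frame E t j x) f"])
      show "open W" by (rule triv(1)[OF W])
      show "smooth_on M W (\<lambda>x. anchor E x (frame E t j x) f)" if "j < r" for j
        by (rule smooth_anchor_frame[OF W that f])
    qed (use G inj in blast)+
    have "grad x (\<Sum>i<r. a i x *\<^sub>R frame E t i x)" if x: "x \<in> W" for x
      unfolding grad_def
    proof (intro conjI ballI)
      let ?v = "\<Sum>i<r. a i x *\<^sub>R frame E t i x"
      show v: "?v \<in> fibre E x" by (rule frame_sum_in_fibre[OF W x])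
      fix w assume w: "w \<in> fibre E x"
      have "pairing E x ?v (frame E t j x) = anchor E x (frame E t j x) f" if "j < r" for j
        using a(2)[OF x that] pairing_frame_sum_left[OF W x frame(1)[OF W x that]]
        by (simp add: mult.commute)
      then show "pairing E x ?v w = anchor E x w f"
        using pairing_frame_expansion_right[OF W x v w] anchor_frame_expansion[OF W x w, of f] by simp
    qed
    then show ?thesis using a(1) by blast
  qed
  define u where "u x = (THE v. grad x v)" for x
  have u: "grad x (u x)" for x
  proof -
    obtain W t where W: "(W, t) \<in> trivs E" "x \<in> W" by (rule triv_exists)
    then obtain v where v: "grad x v" using local by blast
    show ?thesis unfolding u_def by (rule theI[where P = "grad x", OF v unique[OF _ v]])
  qed
  have "u \<in> \<Gamma>"
  proof (rule sectionI)
    show "u x \<in> fibre E x" for x using u unfolding grad_def by blast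
    fix W t i assume W: "(W, t) \<in> trivs E" and i: "i < r"
    obtain a where a: "\<And>i. i < r \<Longrightarrow> smooth_on M W (a i)"
      "\<And>x. x \<in> W \<Longrightarrow> grad x (\<Sum>i<r. a i x *\<^sub>R frame E t i x)"
      using local[OF W] by blast
    show "smooth_on M W (\<lambda>x. t x (u x) i)"
    proof (rule smooth_on_cong[OF triv(1)[OF W] a(1)[OF i]])
      fix x assume x: "x \<in> W"
      have "u x = (\<Sum>i<r. a i x *\<^sub>R frame E t i x)" by (rule unique[OF u a(2)[OF x]])
      then show "a i x = t x (u x) i" by (simp only: triv_frame_sum[OF W x i])
    qed
  qed
  moreover have "pair E u e = along E e f" if "e \<in> \<Gamma>" for e
    using u section_in_fibre[OF that] by (simp add: grad_def pair_def along_def anch_def)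
  ultimately show ?thesis by (rule that)
qed

lemma courant_D:
  assumes "f \<in> C"
  shows "courant_D M E f \<in> \<Gamma>" "e \<in> \<Gamma> \<Longrightarrow> pair E (courant_D M E f) e = along E e f"
proof -
  obtain u where u: "u \<in> \<Gamma>" "\<And>e. e \<in> \<Gamma> \<Longrightarrow> pair E u e = along E e f"
    by (rule gradient_exists[OF assms]) blast
  have "courant_D M E f = u"
    unfolding courant_D_def
    by (rule the_equality) (use u in \<open>auto intro: pair_nondegenerate\<close>)
  then show "courant_D M E f \<in> \<Gamma>" "e \<in> \<Gamma> \<Longrightarrow> pair E (courant_D M E f) e = along E e f"
    using u by auto
qed

section \<open>Identities in a Courant algebroid\<close>

lemma scaleR_fun_apply: "(a *\<^sub>R f) x = a *\<^sub>R f x"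
  by (simp add: scaleR_fun_def)

lemma smooth_comb: "f \<in> C \<Longrightarrow> g \<in> C \<Longrightarrow> a *\<^sub>R f + b *\<^sub>R g \<in> C"
proof -
  assume "f \<in> C" "g \<in> C"
  then have "smooth_on M UNIV (\<lambda>x. a * f x + b * g x)"
    unfolding smooth_functions_def mem_Collect_eq
    by (intro smooth_on_add smooth_on_mult smooth_on_const open_UNIV)
  moreover have "(\<lambda>x. a * f x + b * g x) = a *\<^sub>R f + b *\<^sub>R g"
    by (simp add: fun_eq_iff scaleR_fun_def)
  ultimately show ?thesis by (simp add: smooth_functions_def)
qed

lemma smooth_zero: "0 \<in> C"
  using smooth_on_const[of UNIV 0] by (simp add: smooth_functions_def zero_fun_def)

lemma smooth_scale: "f \<in> C \<Longrightarrow> a *\<^sub>R f \<in> C"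
  using smooth_comb[of f f a 0] by simp

lemma smooth_add: "f \<in> C \<Longrightarrow> g \<in> C \<Longrightarrow> f + g \<in> C"
  using smooth_comb[of f g 1 1] by simp

lemma section_zero: "0 \<in> \<Gamma>"
proof (rule sectionI)
  show "0 x \<in> fibre E x" for x
    using subspace_0[OF subspace_fibre] by simp
  fix W t i assume W: "(W, t) \<in> trivs E"
  show "smooth_on M W (\<lambda>x. t x (0 x) i)"
    by (rule smooth_on_cong[OF triv(1)[OF W] smooth_on_const[OF triv(1)[OF W], of 0]])
      (use triv_sum[OF W, of _ "{}"] in simp)
qed

lemma section_scale: "e \<in> \<Gamma> \<Longrightarrow> a *\<^sub>R e \<in> \<Gamma>"
  using section_comb[of e e a 0] by simp

lemma section_add: "e \<in> \<Gamma> \<Longrightarrow> h \<in> \<Gamma> \<Longrightarrow> e + h \<in> \<Gamma>"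
  using section_comb[of e h 1 1] by simp

lemma pair_sym: "e \<in> \<Gamma> \<Longrightarrow> h \<in> \<Gamma> \<Longrightarrow> pair E e h = pair E h e"
  unfolding pair_def by (simp add: pairing_sym section_in_fibre)

lemma pair_linear_left:
  assumes "e \<in> \<Gamma>" "e' \<in> \<Gamma>" "h \<in> \<Gamma>"
  shows "pair E (a *\<^sub>R e + b *\<^sub>R e') h = a *\<^sub>R pair E e h + b *\<^sub>R pair E e' h"
  using assms by (simp add: pair_def fun_eq_iff scaleR_fun_def pairing_linear_left section_in_fibre)

lemma pair_linear_right:
  assumes "e \<in> \<Gamma>" "e' \<in> \<Gamma>" "h \<in> \<Gamma>"
  shows "pair E h (a *\<^sub>R e + b *\<^sub>R e') = a *\<^sub>R pair E h e + b *\<^sub>R pair E h e'"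
  using assms by (simp add: pair_def fun_eq_iff scaleR_fun_def pairing_linear_right section_in_fibre)

lemma pair_zero: "h \<in> \<Gamma> \<Longrightarrow> pair E 0 h = 0" "h \<in> \<Gamma> \<Longrightarrow> pair E h 0 = 0"
  using pair_linear_left[of h h h 0 0] pair_linear_right[of h h h 0 0] by simp_all

lemma pair_simps:
  assumes "e \<in> \<Gamma>" "h \<in> \<Gamma>"
  shows "pair E (- e) h = - pair E e h" "pair E h (- e) = - pair E h e"
    "pair E (a *\<^sub>R e) h = a *\<^sub>R pair E e h" "pair E h (a *\<^sub>R e) = a *\<^sub>R pair E h e"
    "e' \<in> \<Gamma> \<Longrightarrow> pair E (e + e') h = pair E e h + pair E e' h"
  using pair_linear_left[OF assms(1) assms(1) assms(2), of "- 1" 0]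
    pair_linear_left[OF assms(1) assms(1) assms(2), of a 0]
    pair_linear_left[OF assms(1) _ assms(2), of e' 1 1]
    pair_linear_right[OF assms(1) assms(1) assms(2), of "- 1" 0]
    pair_linear_right[OF assms(1) assms(1) assms(2), of a 0] by simp_all

lemma along_linear:
  assumes "e \<in> \<Gamma>" "h \<in> \<Gamma>"
  shows "along E (a *\<^sub>R e + b *\<^sub>R h) f = a *\<^sub>R along E e f + b *\<^sub>R along E h f"
  using assms
  by (simp add: along_def anch_def fun_eq_iff scaleR_fun_def anchor_linear section_in_fibre)

lemma along_uminus: "e \<in> \<Gamma> \<Longrightarrow> along E (- e) f = - along E e f"
  using along_linear[of e e "- 1" 0 f] by simp

lemma along_comb:
  assumes "e \<in> \<Gamma>" "f \<in> C" "g \<in> C"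
  shows "along E e (a *\<^sub>R f + b *\<^sub>R g) = a *\<^sub>R along E e f + b *\<^sub>R along E e g"
proof
  fix x
  have "anchor E x (e x) \<in> tangent_space M x"
    by (rule anchor_tangent[OF section_in_fibre[OF assms(1)]])
  then have "anchor E x (e x) (\<lambda>x. a * f x + b * g x) =
      a * anchor E x (e x) f + b * anchor E x (e x) g"
    using assms(2,3) unfolding tangent_space_def by blast
  then show "along E e (a *\<^sub>R f + b *\<^sub>R g) x = (a *\<^sub>R along E e f + b *\<^sub>R along E e g) x"
    by (simp add: along_def anch_def scaleR_fun_def plus_fun_def)
qed

lemma along_simps:
  assumes "e \<in> \<Gamma>" "f \<in> C"
  shows "along E e 0 = 0" "along E e (a *\<^sub>R f) = a *\<^sub>R along E e f" "along E e (- f) = - along E e f"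
    "g \<in> C \<Longrightarrow> along E e (f + g) = along E e f + along E e g"
  using along_comb[OF assms(1) assms(2) assms(2), of 0 0] along_comb[OF assms assms(2), of a 0]
    along_comb[OF assms assms(2), of "- 1" 0] along_comb[OF assms, of g 1 1] by simp_all

lemma bracket_closed: "e \<in> \<Gamma> \<Longrightarrow> h \<in> \<Gamma> \<Longrightarrow> bracket E e h \<in> \<Gamma>"
  using courant_algebroid unfolding courant_algebroid_def by (elim conjE) blast

lemma bracket_skew: "e \<in> \<Gamma> \<Longrightarrow> h \<in> \<Gamma> \<Longrightarrow> bracket E e h = - bracket E h e"
  using courant_algebroid unfolding courant_algebroid_def by (elim conjE) blast

lemma bracket_linear_left: "e \<in> \<Gamma> \<Longrightarrow> e' \<in> \<Gamma> \<Longrightarrow> h \<in> \<Gamma> \<Longrightarrow>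
    bracket E (a *\<^sub>R e + b *\<^sub>R e') h = a *\<^sub>R bracket E e h + b *\<^sub>R bracket E e' h"
  using courant_algebroid unfolding courant_algebroid_def by (elim conjE) blast

lemma jacobiator: "e \<in> \<Gamma> \<Longrightarrow> e' \<in> \<Gamma> \<Longrightarrow> h \<in> \<Gamma> \<Longrightarrow>
    jacobiator E e e' h = courant_D M E (courant_T E e e' h)"
  using courant_algebroid unfolding courant_algebroid_def by (elim conjE) blast

lemma anch_bracket: "e \<in> \<Gamma> \<Longrightarrow> h \<in> \<Gamma> \<Longrightarrow>
    anch E (bracket E e h) = lie_bracket M (anch E e) (anch E h)"
  using courant_algebroid unfolding courant_algebroid_def by (elim conjE) blast

lemma anch_courant_D: "f \<in> C \<Longrightarrow> anch E (courant_D M E f) = 0"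
  using courant_algebroid unfolding courant_algebroid_def by (elim conjE) blast

lemma along_pair_axiom:
  assumes "e \<in> \<Gamma>" "e' \<in> \<Gamma>" "h \<in> \<Gamma>"
  shows "along E e (pair E e' h) =
    pair E (bracket E e e' + (1/2) *\<^sub>R courant_D M E (pair E e e')) h +
    pair E e' (bracket E e h + (1/2) *\<^sub>R courant_D M E (pair E e h))"
proof -
  have "\<forall>e\<in>\<Gamma>. \<forall>h1\<in>\<Gamma>. \<forall>h2\<in>\<Gamma>. along E e (pair E h1 h2) =
      pair E (bracket E e h1 + (1/2) *\<^sub>R courant_D M E (pair E e h1)) h2 +
      pair E h1 (bracket E e h2 + (1/2) *\<^sub>R courant_D M E (pair E e h2))"
    using courant_algebroid unfolding courant_algebroid_def by (elim conjE)
  from bspec[OF bspec[OF bspec[OF this assms(1)] assms(2)] assms(3)] show ?thesis .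
qed

lemma bracket_linear_right:
  assumes "e \<in> \<Gamma>" "e' \<in> \<Gamma>" "h \<in> \<Gamma>"
  shows "bracket E h (a *\<^sub>R e + b *\<^sub>R e') = a *\<^sub>R bracket E h e + b *\<^sub>R bracket E h e'"
  using bracket_skew[of h "a *\<^sub>R e + b *\<^sub>R e'"] bracket_skew[of h e] bracket_skew[of h e']
    bracket_linear_left[of e e' h a b] section_comb assms by simp

lemma bracket_zero: "h \<in> \<Gamma> \<Longrightarrow> bracket E 0 h = 0" "h \<in> \<Gamma> \<Longrightarrow> bracket E h 0 = 0"
  using bracket_linear_left[of 0 0 h 0 0] bracket_linear_right[of 0 0 h 0 0] section_zero by simp_all

lemma along_bracket:
  assumes "e \<in> \<Gamma>" "h \<in> \<Gamma>" "f \<in> C"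
  shows "along E (bracket E e h) f = along E e (along E h f) - along E h (along E e f)"
  using assms by (simp add: along_def[of E "bracket E e h"] anch_bracket lie_bracket_def fun_eq_iff)
    (simp add: along_def)

lemma along_courant_D: "f \<in> C \<Longrightarrow> along E (courant_D M E f) g = 0"
  by (simp add: along_def anch_courant_D fun_eq_iff)

text \<open>The invariance axiom with the gradients evaluated by \<open>\<langle>\<D> g, h\<rangle> = \<rho>(h) g\<close>.\<close>

lemma along_pair:
  assumes "e \<in> \<Gamma>" "h \<in> \<Gamma>" "k \<in> \<Gamma>"
  shows "along E e (pair E h k) x = pair E (bracket E e h) k x + pair E (bracket E e k) h x
    + along E k (pair E e h) x / 2 + along E h (pair E e k) x / 2"
proof -
  have D: "courant_D M E (pair E e h) \<in> \<Gamma>" "courant_D M E (pair E e k) \<in> \<Gamma>"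
    using assms by (auto intro: courant_D smooth_pair)
  have "pair E (bracket E e h + (1/2) *\<^sub>R courant_D M E (pair E e h)) k =
      pair E (bracket E e h) k + (1/2) *\<^sub>R along E k (pair E e h)"
    using assms D by (simp add: pair_simps bracket_closed section_scale courant_D smooth_pair)
  moreover have "pair E h (bracket E e k + (1/2) *\<^sub>R courant_D M E (pair E e k)) =
      pair E (bracket E e k) h + (1/2) *\<^sub>R along E h (pair E e k)"
    using assms D
    by (subst pair_sym) (auto simp: pair_simps bracket_closed section_scale section_add courant_D smooth_pair)
  ultimately show ?thesis
    unfolding along_pair_axiom[OF assms] by (simp add: scaleR_fun_def)
qed

lemma courant_D_comb:
  assumes "f \<in> C" "g \<in> C"
  shows "courant_D M E (a *\<^sub>R f + b *\<^sub>R g) = a *\<^sub>R courant_D M E f + b *\<^sub>R courant_D M E g"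
proof (rule pair_nondegenerate)
  show "courant_D M E (a *\<^sub>R f + b *\<^sub>R g) \<in> \<Gamma>" "a *\<^sub>R courant_D M E f + b *\<^sub>R courant_D M E g \<in> \<Gamma>"
    using assms by (auto intro: courant_D section_comb smooth_comb)
  show "pair E (courant_D M E (a *\<^sub>R f + b *\<^sub>R g)) e =
      pair E (a *\<^sub>R courant_D M E f + b *\<^sub>R courant_D M E g) e" if "e \<in> \<Gamma>" for e
    using assms that by (simp add: pair_linear_left courant_D smooth_comb along_comb)
qed

lemma courant_D_simps:
  assumes "f \<in> C"
  shows "courant_D M E 0 = 0" "courant_D M E (a *\<^sub>R f) = a *\<^sub>R courant_D M E f"
    "courant_D M E (- f) = - courant_D M E f"
  using courant_D_comb[OF assms assms, of 0 0] courant_D_comb[OF assms assms, of a 0]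
    courant_D_comb[OF assms assms, of "- 1" 0] by simp_all

lemma pair_courant_D: "f \<in> C \<Longrightarrow> e \<in> \<Gamma> \<Longrightarrow> pair E e (courant_D M E f) = along E e f"
  using courant_D pair_sym by metis

lemma courant_T_cyclic: "courant_T E e1 e2 e3 = courant_T E e2 e3 e1"
  by (simp add: courant_T_def add_ac)

lemma courant_T_swap:
  assumes "e1 \<in> \<Gamma>" "e2 \<in> \<Gamma>" "e3 \<in> \<Gamma>"
  shows "courant_T E e2 e1 e3 = - courant_T E e1 e2 e3"
proof -
  have "pair E (bracket E e2 e1) e3 = - pair E (bracket E e1 e2) e3"
    "pair E (bracket E e1 e3) e2 = - pair E (bracket E e3 e1) e2"
    "pair E (bracket E e3 e2) e1 = - pair E (bracket E e2 e3) e1"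
    using bracket_skew[of e2 e1] bracket_skew[of e1 e3] bracket_skew[of e3 e2] assms
    by (simp_all add: pair_simps bracket_closed)
  then show ?thesis by (simp add: courant_T_def algebra_simps)
qed

lemma smooth_courant_T: "e1 \<in> \<Gamma> \<Longrightarrow> e2 \<in> \<Gamma> \<Longrightarrow> e3 \<in> \<Gamma> \<Longrightarrow> courant_T E e1 e2 e3 \<in> C"
  unfolding courant_T_def by (intro smooth_scale smooth_add smooth_pair bracket_closed)

lemma courant_T_linear:
  assumes "e \<in> \<Gamma>" "e' \<in> \<Gamma>" "e2 \<in> \<Gamma>" "e3 \<in> \<Gamma>"
  shows "courant_T E (a *\<^sub>R e + b *\<^sub>R e') e2 e3 = a *\<^sub>R courant_T E e e2 e3 + b *\<^sub>R courant_T E e' e2 e3"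
  using assms
  by (simp add: courant_T_def bracket_linear_left bracket_linear_right pair_linear_left
      pair_linear_right bracket_closed algebra_simps)

lemma courant_T_zero:
  assumes "e2 \<in> \<Gamma>" "e3 \<in> \<Gamma>"
  shows "courant_T E 0 e2 e3 = 0" "courant_T E e2 0 e3 = 0" "courant_T E e2 e3 0 = 0"
proof -
  have *: "courant_T E 0 h k = 0" if "h \<in> \<Gamma>" "k \<in> \<Gamma>" for h k
    using courant_T_linear[of 0 0 h k 0 0] section_zero that by simp
  show "courant_T E 0 e2 e3 = 0"
    by (rule *[OF assms])
  show "courant_T E e2 0 e3 = 0"
    by (rule trans[OF courant_T_cyclic *[OF assms(2,1)]])
  show "courant_T E e2 e3 0 = 0"
    by (rule trans[OF courant_T_cyclic[symmetric] *[OF assms]])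
qed

text \<open>Invariance applied to \<open>\<rho>(e)\<langle>\<D> f, h\<rangle>\<close> expresses \<open>\<langle>[e, \<D> f], h\<rangle>\<close> by \<open>\<rho>(e) \<rho>(h) f\<close>,
  \<open>\<rho>(h) \<rho>(e) f / 2\<close> and \<open>\<rho>[e, h] f\<close>; the remaining term contains \<open>\<rho>(\<D> f)\<close>, which is 0.  As
  \<open>\<rho>\<close> preserves brackets, what is left is \<open>\<rho>(h) \<rho>(e) f / 2\<close>.\<close>

lemma bracket_courant_D:
  assumes "e \<in> \<Gamma>" "f \<in> C"
  shows "bracket E e (courant_D M E f) = (1/2) *\<^sub>R courant_D M E (along E e f)"
proof (rule pair_nondegenerate)
  note D = courant_D(1)[OF assms(2)]
  show "bracket E e (courant_D M E f) \<in> \<Gamma>" "(1/2) *\<^sub>R courant_D M E (along E e f) \<in> \<Gamma>"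
    using assms by (auto intro!: bracket_closed section_scale courant_D smooth_along)
  fix h assume h: "h \<in> \<Gamma>"
  show "pair E (bracket E e (courant_D M E f)) h = pair E ((1/2) *\<^sub>R courant_D M E (along E e f)) h"
  proof
    fix x
    have "pair E (bracket E e h) (courant_D M E f) = along E (bracket E e h) f"
      using assms h by (intro pair_courant_D bracket_closed)
    then show "pair E (bracket E e (courant_D M E f)) h x
        = pair E ((1/2) *\<^sub>R courant_D M E (along E e f)) h x"
      using along_pair[OF assms(1) D h, of x] assms h
      by (simp add: courant_D(2) pair_courant_D along_bracket along_courant_D pair_simps
          courant_D(1) smooth_along scaleR_fun_apply)
  qed
qed

text \<open>Invariance compares \<open>\<langle>[e\<^sub>1, e\<^sub>2], e\<^sub>3\<rangle>\<close> with its two cyclic permutations, up to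
  derivatives of pairings; the average of the three is \<open>2 T\<close>.\<close>

lemma pair_bracket:
  assumes "e1 \<in> \<Gamma>" "e2 \<in> \<Gamma>" "e3 \<in> \<Gamma>"
  shows "pair E (bracket E e1 e2) e3 x =
    2 * courant_T E e1 e2 e3 x + along E e1 (pair E e2 e3) x / 2 - along E e2 (pair E e1 e3) x / 2"
proof -
  have skew: "pair E (bracket E e h) k x = - pair E (bracket E h e) k x"
    if "e \<in> \<Gamma>" "h \<in> \<Gamma>" "k \<in> \<Gamma>" for e h k
    using bracket_skew[OF that(1,2)] that by (simp add: pair_simps bracket_closed)
  have "6 * courant_T E e1 e2 e3 x = pair E (bracket E e1 e2) e3 x
      + pair E (bracket E e2 e3) e1 x + pair E (bracket E e3 e1) e2 x"
    by (simp add: courant_T_def scaleR_fun_apply)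
  moreover note sym = pair_sym[OF assms(2,1)] pair_sym[OF assms(3,1)] pair_sym[OF assms(3,2)]
  ultimately show ?thesis
    using along_pair[OF assms(1,2,3), of x, unfolded sym] along_pair[OF assms(2,3,1), of x, unfolded sym]
      skew[OF assms(1,3,2)] skew[OF assms(2,1,3)] by linarith
qed

lemma courant_T_courant_D:
  assumes "e1 \<in> \<Gamma>" "e2 \<in> \<Gamma>" "f \<in> C"
  shows "courant_T E e1 e2 (courant_D M E f) = (1/4) *\<^sub>R along E (bracket E e1 e2) f"
proof
  fix x
  note D = courant_D(1)[OF assms(3)]
  have "pair E (bracket E e1 e2) (courant_D M E f) x = along E (bracket E e1 e2) f x"
    using assms by (simp add: pair_courant_D bracket_closed)
  then show "courant_T E e1 e2 (courant_D M E f) x = ((1/4) *\<^sub>R along E (bracket E e1 e2) f) x"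
    using pair_bracket[OF assms(1,2) D, of x] assms
    by (simp add: pair_courant_D along_bracket scaleR_fun_apply field_simps)
qed

text \<open>The axiom \<open>J = \<D> T\<close> paired with a fourth section, with the iterated brackets expanded
  by \<open>pair_bracket\<close>.\<close>

lemma along_courant_T_expansion:
  assumes "e1 \<in> \<Gamma>" "e2 \<in> \<Gamma>" "e3 \<in> \<Gamma>" "e4 \<in> \<Gamma>"
  shows "along E e4 (courant_T E e1 e2 e3) x =
    2 * (courant_T E (bracket E e1 e2) e3 e4 x + courant_T E (bracket E e2 e3) e1 e4 x
       + courant_T E (bracket E e3 e1) e2 e4 x)
    + (along E (bracket E e1 e2) (pair E e3 e4) x + along E (bracket E e2 e3) (pair E e1 e4) x
       + along E (bracket E e3 e1) (pair E e2 e4) x) / 2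
    - (along E e3 (pair E (bracket E e1 e2) e4) x + along E e1 (pair E (bracket E e2 e3) e4) x
       + along E e2 (pair E (bracket E e3 e1) e4) x) / 2"
proof -
  have "along E e4 (courant_T E e1 e2 e3) = pair E (jacobiator E e1 e2 e3) e4"
    using assms by (simp add: jacobiator courant_D smooth_courant_T)
  also have "\<dots> = pair E (bracket E (bracket E e1 e2) e3) e4
      + pair E (bracket E (bracket E e2 e3) e1) e4 + pair E (bracket E (bracket E e3 e1) e2) e4"
    using assms by (simp add: jacobiator_def pair_simps bracket_closed section_add)
  finally show ?thesis
    using assms by (simp add: pair_bracket bracket_closed field_simps)
qed

lemma along_courant_T:
  assumes "e1 \<in> \<Gamma>" "e2 \<in> \<Gamma>" "e3 \<in> \<Gamma>" "e \<in> \<Gamma>"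
  shows "6 * along E e (courant_T E e1 e2 e3) x = along E e (pair E (bracket E e1 e2) e3) x
    + along E e (pair E (bracket E e2 e3) e1) x + along E e (pair E (bracket E e3 e1) e2) x"
  using assms
  by (simp add: courant_T_def along_simps smooth_pair smooth_add bracket_closed scaleR_fun_apply)

text \<open>Take the alternating sum \<open>S = \<rho>(e\<^sub>4) T(e\<^sub>1, e\<^sub>2, e\<^sub>3) - \<dots>\<close> of \<open>along_courant_T_expansion\<close>
  over the choice of the fourth section, and let \<open>L\<close> be the left-hand side of the claim.  Each
  \<open>T([e\<^sub>i, e\<^sub>j], e\<^sub>k, e\<^sub>l)\<close> occurs for two choices and contributes to \<open>4 L\<close>; the terms \<open>\<rho>[e\<^sub>i,
  e\<^sub>j]\<langle>e\<^sub>k, e\<^sub>l\<rangle>\<close> cancel; the terms \<open>\<rho>(e\<^sub>l)\<langle>[e\<^sub>i, e\<^sub>j], e\<^sub>k\<rangle>\<close> collect cyclically to \<open>6 \<rho>(e\<^sub>l)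
  T(e\<^sub>i, e\<^sub>j, e\<^sub>k)\<close>, in total \<open>3 S\<close>.  So \<open>S = 4 L + 3 S\<close>, that is \<open>L = - S / 2\<close>.\<close>

lemma courant_T_bracket_identity:
  assumes e: "e1 \<in> \<Gamma>" "e2 \<in> \<Gamma>" "e3 \<in> \<Gamma>" "e4 \<in> \<Gamma>"
  shows "courant_T E (bracket E e1 e2) e3 e4 x - courant_T E (bracket E e1 e3) e2 e4 x
      + courant_T E (bracket E e1 e4) e2 e3 x + courant_T E (bracket E e2 e3) e1 e4 x
      - courant_T E (bracket E e2 e4) e1 e3 x + courant_T E (bracket E e3 e4) e1 e2 x =
    (along E e1 (courant_T E e2 e3 e4) x - along E e2 (courant_T E e1 e3 e4) x
      + along E e3 (courant_T E e1 e2 e4) x - along E e4 (courant_T E e1 e2 e3) x) / 2"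
proof -
  have T1: "courant_T E (bracket E h e) k l = - courant_T E (bracket E e h) k l"
    if "e \<in> \<Gamma>" "h \<in> \<Gamma>" "k \<in> \<Gamma>" "l \<in> \<Gamma>" for e h k l
    using courant_T_linear[of "bracket E e h" "bracket E e h" k l "- 1" 0] bracket_skew[of h e] that
    by (simp add: bracket_closed)
  have T2: "courant_T E (bracket E e h) l k = - courant_T E (bracket E e h) k l"
    if "e \<in> \<Gamma>" "h \<in> \<Gamma>" "k \<in> \<Gamma>" "l \<in> \<Gamma>" for e h k l
    using courant_T_swap[of k l "bracket E e h"] courant_T_cyclic[of "bracket E e h" l k]
      courant_T_cyclic[of "bracket E e h" k l] that by (simp add: bracket_closed)
  have A1: "along E (bracket E h e) f = - along E (bracket E e h) f"
    if "e \<in> \<Gamma>" "h \<in> \<Gamma>" for e h f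
    using along_uminus[of "bracket E e h" f] bracket_skew[of h e] that by (simp add: bracket_closed)
  have A2: "along E k (pair E (bracket E h e) l) = - along E k (pair E (bracket E e h) l)"
    if "e \<in> \<Gamma>" "h \<in> \<Gamma>" "k \<in> \<Gamma>" "l \<in> \<Gamma>" for e h k l
    using bracket_skew[of h e] that by (simp add: pair_simps along_simps bracket_closed smooth_pair)
  \<comment> \<open>These rules bring every bracket and every pairing into increasing order of the indices.\<close>
  note swaps = T1[OF e(1,3)] T1[OF e(1,4)] T1[OF e(2,4)] T2[OF _ _ e(3,4)] T2[OF _ _ e(2,4)]
    T2[OF _ _ e(1,4)] T2[OF _ _ e(2,3)] T2[OF _ _ e(1,3)] T2[OF _ _ e(1,2)]
    A1[OF e(1,3)] A1[OF e(1,4)] A1[OF e(2,4)] A2[OF e(1,3)] A2[OF e(1,4)] A2[OF e(2,4)]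
    pair_sym[OF e(2,1)] pair_sym[OF e(3,1)] pair_sym[OF e(4,1)] pair_sym[OF e(3,2)]
    pair_sym[OF e(4,2)] pair_sym[OF e(4,3)]
  note J = along_courant_T_expansion[OF e(1,2,3,4), of x] along_courant_T_expansion[OF e(1,2,4,3), of x]
    along_courant_T_expansion[OF e(1,3,4,2), of x] along_courant_T_expansion[OF e(2,3,4,1), of x]
  note S = along_courant_T[OF e(1,2,3,4), of x] along_courant_T[OF e(1,2,4,3), of x]
    along_courant_T[OF e(1,3,4,2), of x] along_courant_T[OF e(2,3,4,1), of x]
  show ?thesis
    using J S by (simp (no_asm_use) only: swaps e uminus_apply) (simp add: field_simps)
qed

end

section \<open>Unshuffles of at most four arguments\<close>

text \<open>Unshuffles are enumerated through their lists of values, because equality of lists is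
  decided by rewriting while equality of functions is not.\<close>

definition list_perm :: "nat list \<Rightarrow> nat \<Rightarrow> nat"
  where "list_perm xs k = (if k < length xs then xs ! k else k)"

definition unshuffle_lists :: "nat \<Rightarrow> nat \<Rightarrow> nat list set"
  where "unshuffle_lists i n = {xs. length xs = n \<and> distinct xs \<and> set xs \<subseteq> {..<n} \<and>
    sorted_wrt (<) (take i xs) \<and> sorted_wrt (<) (drop i xs)}"

lemma list_perm_permutes:
  assumes "distinct xs" "set xs \<subseteq> {..<length xs}"
  shows "list_perm xs permutes {..<length xs}"
proof (rule bij_imp_permutes)
  have inj: "inj_on (list_perm xs) {..<length xs}"
    using assms(1) by (auto simp: inj_on_def list_perm_def nth_eq_iff_index_eq)
  have "list_perm xs ` {..<length xs} \<subseteq> {..<length xs}"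
    using assms(2) nth_mem by (fastforce simp: list_perm_def)
  then have "list_perm xs ` {..<length xs} = {..<length xs}"
    using inj by (intro endo_inj_surj) auto
  then show "bij_betw (list_perm xs) {..<length xs} {..<length xs}"
    using inj by (simp add: bij_betw_def)
qed (simp add: list_perm_def)

lemma unshuffles_eq_list_perm:
  assumes "i \<le> n"
  shows "unshuffles i n = list_perm ` unshuffle_lists i n"
proof (intro equalityI subsetI)
  fix \<sigma> assume "\<sigma> \<in> unshuffles i n"
  then have \<sigma>: "\<sigma> permutes {..<n}" "strict_mono_on {..<i} \<sigma>" "strict_mono_on {i..<n} \<sigma>"
    by (auto simp: unshuffles_def)
  let ?xs = "map \<sigma> [0..<n]"
  have "set ?xs \<subseteq> {..<n}"
    by (simp add: permutes_image[OF \<sigma>(1)] atLeast0LessThan)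
  moreover have "sorted_wrt (<) (take i ?xs)"
    using \<sigma>(2) assms by (auto simp: sorted_wrt_iff_nth_less monotone_on_def)
  moreover have "sorted_wrt (<) (drop i ?xs)"
    using \<sigma>(3) assms by (auto simp: sorted_wrt_iff_nth_less monotone_on_def)
  moreover have "distinct ?xs"
    using permutes_inj_on[OF \<sigma>(1)] by (simp add: distinct_map)
  ultimately have "?xs \<in> unshuffle_lists i n"
    by (simp add: unshuffle_lists_def)
  moreover have "\<sigma> = list_perm ?xs"
    using permutes_not_in[OF \<sigma>(1)] by (auto simp: list_perm_def fun_eq_iff)
  ultimately show "\<sigma> \<in> list_perm ` unshuffle_lists i n" by (rule rev_image_eqI)
next
  fix \<sigma> assume "\<sigma> \<in> list_perm ` unshuffle_lists i n"
  then obtain xs where xs: "\<sigma> = list_perm xs" "length xs = n" "distinct xs" "set xs \<subseteq> {..<n}"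
    "sorted_wrt (<) (take i xs)" "sorted_wrt (<) (drop i xs)"
    by (auto simp: unshuffle_lists_def)
  have "\<sigma> permutes {..<n}"
    using list_perm_permutes xs by auto
  moreover have "strict_mono_on {..<i} \<sigma>"
    using xs assms by (auto simp: sorted_wrt_iff_nth_less list_perm_def monotone_on_def)
  moreover have "strict_mono_on {i..<n} \<sigma>"
  proof (rule monotone_onI)
    fix a b assume "a \<in> {i..<n}" "b \<in> {i..<n}" "a < b"
    then show "\<sigma> a < \<sigma> b"
      using xs(6)[unfolded sorted_wrt_iff_nth_less, rule_format, of "a - i" "b - i"] xs(1,2)
      by (simp add: list_perm_def)
  qed
  ultimately show "\<sigma> \<in> unshuffles i n" by (simp add: unshuffles_def)
qed

lemma sum_unshuffles:
  assumes "i \<le> n"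
  shows "sum f (unshuffles i n) = (\<Sum>xs\<in>unshuffle_lists i n. f (list_perm xs))"
proof -
  have "inj_on list_perm (unshuffle_lists i n)"
  proof (rule inj_onI)
    fix xs ys assume *: "xs \<in> unshuffle_lists i n" "ys \<in> unshuffle_lists i n" "list_perm xs = list_perm ys"
    show "xs = ys"
    proof (rule nth_equalityI)
      show len: "length xs = length ys" using * by (simp add: unshuffle_lists_def)
      show "xs ! k = ys ! k" if "k < length xs" for k
        using fun_cong[OF *(3), of k] that len by (simp add: list_perm_def)
    qed
  qed
  then show ?thesis
    unfolding unshuffles_eq_list_perm[OF assms] by (simp add: sum.reindex)
qed

lemma unshuffle_lists_1_1: "unshuffle_lists 1 1 = {[0]}"
  by (auto simp: unshuffle_lists_def length_Suc_conv)

lemma unshuffle_lists_1_2: "unshuffle_lists 1 2 = {[0, 1], [1, 0]}"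
  by (auto simp: unshuffle_lists_def length_Suc_conv numeral_2_eq_2 less_Suc_eq)

lemma unshuffle_lists_2_2: "unshuffle_lists 2 2 = {[0, 1]}"
  by (auto simp: unshuffle_lists_def length_Suc_conv numeral_2_eq_2 less_Suc_eq)

lemma unshuffle_lists_1_3: "unshuffle_lists 1 3 = {[0, 1, 2], [1, 0, 2], [2, 0, 1]}"
  by (auto simp: unshuffle_lists_def length_Suc_conv eval_nat_numeral less_Suc_eq)

lemma unshuffle_lists_2_3: "unshuffle_lists 2 3 = {[0, 1, 2], [0, 2, 1], [1, 2, 0]}"
  by (auto simp: unshuffle_lists_def length_Suc_conv eval_nat_numeral less_Suc_eq)

lemma unshuffle_lists_3_3: "unshuffle_lists 3 3 = {[0, 1, 2]}"
  by (auto simp: unshuffle_lists_def length_Suc_conv eval_nat_numeral less_Suc_eq)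

lemma unshuffle_lists_2_4: "unshuffle_lists 2 4 =
    {[0, 1, 2, 3], [0, 2, 1, 3], [0, 3, 1, 2], [1, 2, 0, 3], [1, 3, 0, 2], [2, 3, 0, 1]}" (is "_ = ?R")
proof (intro equalityI subsetI)
  fix xs assume "xs \<in> unshuffle_lists 2 4"
  then obtain a b c d where xs: "xs = [a, b, c, d]" "a \<noteq> c" "a \<noteq> d" "b \<noteq> c" "b \<noteq> d"
    and *: "a < b" "b < 4" "c < d" "d < 4"
    by (auto simp: unshuffle_lists_def length_Suc_conv eval_nat_numeral)
  have pairs: "k = 0 \<and> m = 1 \<or> k = 0 \<and> m = 2 \<or> k = 0 \<and> m = 3 \<or> k = 1 \<and> m = 2 \<or> k = 1 \<and> m = 3 \<or>
      k = 2 \<and> m = 3" if "k < m" "m < 4" for k m :: nat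
    using that by linarith
  show "xs \<in> ?R"
    using pairs[OF *(1,2)] pairs[OF *(3,4)] xs by (elim disjE conjE) simp_all
qed (auto simp: unshuffle_lists_def)

lemma unshuffle_lists_3_4: "unshuffle_lists 3 4 =
    {[0, 1, 2, 3], [0, 1, 3, 2], [0, 2, 3, 1], [1, 2, 3, 0]}" (is "_ = ?R")
proof (intro equalityI subsetI)
  fix xs assume "xs \<in> unshuffle_lists 3 4"
  then obtain a b c d where xs: "xs = [a, b, c, d]" "a \<noteq> d" "b \<noteq> d" "c \<noteq> d"
    and *: "a < b" "b < c" "c < 4" "d < 4"
    by (auto simp: unshuffle_lists_def length_Suc_conv eval_nat_numeral)
  have "a = 0 \<and> b = 1 \<and> c = 2 \<or> a = 0 \<and> b = 1 \<and> c = 3 \<or> a = 0 \<and> b = 2 \<and> c = 3 \<or>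
      a = 1 \<and> b = 2 \<and> c = 3"
    using * by linarith
  moreover have "d = 0 \<or> d = 1 \<or> d = 2 \<or> d = 3"
    using * by linarith
  ultimately show "xs \<in> ?R"
    using xs by (elim disjE conjE) simp_all
qed (auto simp: unshuffle_lists_def)

lemma list_perm_as_transpositions:
  "list_perm [0] = id"
  "list_perm [0, 1] = id" "list_perm [1, 0] = Transposition.transpose 0 1"
  "list_perm [0, 1, 2] = id" "list_perm [1, 0, 2] = Transposition.transpose 0 1"
  "list_perm [2, 0, 1] = Transposition.transpose 1 2 \<circ> Transposition.transpose 0 1"
  "list_perm [0, 2, 1] = Transposition.transpose 1 2" "list_perm [1, 2, 0] = Transposition.transpose 0 1 \<circ> Transposition.transpose 1 2"
  "list_perm [0, 1, 2, 3] = id" "list_perm [0, 2, 1, 3] = Transposition.transpose 1 2"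
  "list_perm [0, 3, 1, 2] = Transposition.transpose 2 3 \<circ> Transposition.transpose 1 2"
  "list_perm [1, 2, 0, 3] = Transposition.transpose 0 1 \<circ> Transposition.transpose 1 2"
  "list_perm [1, 3, 0, 2] = Transposition.transpose 0 1 \<circ> (Transposition.transpose 2 3 \<circ> Transposition.transpose 1 2)"
  "list_perm [2, 3, 0, 1] = Transposition.transpose 0 2 \<circ> Transposition.transpose 1 3"
  "list_perm [0, 1, 3, 2] = Transposition.transpose 2 3"
  "list_perm [0, 2, 3, 1] = Transposition.transpose 1 2 \<circ> Transposition.transpose 2 3"
  "list_perm [1, 2, 3, 0] = Transposition.transpose 0 1 \<circ> (Transposition.transpose 1 2 \<circ> Transposition.transpose 2 3)"
  by (auto simp: fun_eq_iff list_perm_def Transposition.transpose_def nth_Cons split: nat.splits)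

lemma sign_list_perm:
  "sign (list_perm [0]) = 1"
  "sign (list_perm [0, 1]) = 1" "sign (list_perm [1, 0]) = - 1"
  "sign (list_perm [0, 1, 2]) = 1" "sign (list_perm [1, 0, 2]) = - 1" "sign (list_perm [2, 0, 1]) = 1"
  "sign (list_perm [0, 2, 1]) = - 1" "sign (list_perm [1, 2, 0]) = 1"
  "sign (list_perm [0, 1, 2, 3]) = 1" "sign (list_perm [0, 2, 1, 3]) = - 1"
  "sign (list_perm [0, 3, 1, 2]) = 1" "sign (list_perm [1, 2, 0, 3]) = 1"
  "sign (list_perm [1, 3, 0, 2]) = - 1" "sign (list_perm [2, 3, 0, 1]) = 1"
  "sign (list_perm [0, 1, 3, 2]) = - 1" "sign (list_perm [0, 2, 3, 1]) = 1"
  "sign (list_perm [1, 2, 3, 0]) = - 1"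
  unfolding list_perm_as_transpositions
  by (simp_all add: sign_compose sign_swap_id permutation_swap_id permutation_compose)

lemma set_map_permutes:
  assumes "\<sigma> permutes {..<length xs}"
  shows "set (map (\<lambda>a. xs ! \<sigma> a) [0..<length xs]) = set xs"
proof -
  have "set (map (\<lambda>a. xs ! \<sigma> a) [0..<length xs]) = (!) xs ` (\<sigma> ` {..<length xs})"
    by (simp add: image_image atLeast0LessThan)
  also have "\<dots> = set (map ((!) xs) [0..<length xs])"
    by (simp add: permutes_image[OF assms] atLeast0LessThan)
  finally show ?thesis by (simp only: map_nth)
qed

text \<open>Every factor of the Koszul sign involves two different positions, at least one of them of
  degree 0.\<close>

lemma koszul_sign_eq_1:
  assumes "\<sigma> permutes {..<length ds}"
    and "\<And>a b. a < length ds \<Longrightarrow> b < length ds \<Longrightarrow> a \<noteq> b \<Longrightarrow> ds ! a = 0 \<or> ds ! b = 0"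
  shows "koszul_sign ds \<sigma> = 1"
  unfolding koszul_sign_def
proof (rule prod.neutral, clarify)
  fix a b assume "a < b" "b < length ds" "\<sigma> b < \<sigma> a"
  then have "\<sigma> a < length ds" "\<sigma> b < length ds" "\<sigma> a \<noteq> \<sigma> b"
    using permutes_in_image[OF assms(1), of a] permutes_in_image[OF assms(1), of b] by auto
  then show "(- 1) powi (ds ! \<sigma> a * ds ! \<sigma> b) = (1 :: real)"
    using assms(2)[of "\<sigma> a" "\<sigma> b"] by auto
qed

context courant_algebroid_locale
begin

section \<open>The graded space and its brackets\<close>

abbreviation K where "K \<equiv> ker_D M E"
abbreviation V where "V \<equiv> courant_space M E"
abbreviation l where "l \<equiv> courant_l M E"
abbreviation d where "d \<equiv> courant_d M E"
abbreviation l2 where "l2 \<equiv> courant_l2 M E"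
abbreviation l3 where "l3 \<equiv> courant_l3 E"
abbreviation Tot where "Tot \<equiv> \<Gamma> \<times> C \<times> K"

lemma ker_D: "c \<in> K \<longleftrightarrow> c \<in> C \<and> courant_D M E c = 0"
  by (simp add: ker_D_def)

lemma courant_D_zero: "courant_D M E 0 = 0"
  by (rule courant_D_simps(1)[OF smooth_zero])

lemma ker_D_zero: "0 \<in> K"
  by (simp add: ker_D smooth_zero courant_D_zero)

lemma ker_D_comb: "c \<in> K \<Longrightarrow> c' \<in> K \<Longrightarrow> a *\<^sub>R c + b *\<^sub>R c' \<in> K"
  by (simp add: ker_D smooth_comb courant_D_comb)

text \<open>All components are treated alike: an element of degree \<open>k\<close> is a triple in \<open>Tot\<close> whose
  entries in the other degrees vanish.  Thus the computations below are made for arbitrary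
  triples, and degrees only decide which entries are 0.\<close>

lemma courant_space_iff:
  "(e, f, c) \<in> V k \<longleftrightarrow> e \<in> \<Gamma> \<and> f \<in> C \<and> c \<in> K \<and>
    (k \<noteq> 0 \<longrightarrow> e = 0) \<and> (k \<noteq> 1 \<longrightarrow> f = 0) \<and> (k \<noteq> 2 \<longrightarrow> c = 0)"
  by (auto simp: courant_space_def section_zero smooth_zero ker_D_zero zero_prod_def)

lemma courant_space_fst: "x \<in> V k \<Longrightarrow> k \<noteq> 0 \<Longrightarrow> fst x = 0"
  by (cases x) (simp add: courant_space_iff)

lemma courant_space_subset: "V k \<subseteq> Tot"
  by (auto simp: courant_space_iff)

lemma comb_in_Tot: "x \<in> Tot \<Longrightarrow> y \<in> Tot \<Longrightarrow> a *\<^sub>R x + b *\<^sub>R y \<in> Tot"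
  by (cases x; cases y) (simp add: section_comb smooth_comb ker_D_comb)

lemma subspace_Tot: "subspace Tot"
proof (rule subspaceI)
  show "0 \<in> Tot" by (simp add: zero_prod_def section_zero smooth_zero ker_D_zero)
  show "x + y \<in> Tot" if "x \<in> Tot" "y \<in> Tot" for x y
    using comb_in_Tot[OF that, of 1 1] by simp
  show "a *\<^sub>R x \<in> Tot" if "x \<in> Tot" for a x
    using comb_in_Tot[OF that that, of a 0] by simp
qed

lemma subspace_courant_space: "subspace (V k)"
proof (rule subspaceI)
  have comb: "a *\<^sub>R x + b *\<^sub>R y \<in> V k" if "x \<in> V k" "y \<in> V k" for a b x y
    using that by (cases x; cases y) (auto simp: courant_space_iff section_comb smooth_comb ker_D_comb)
  show "0 \<in> V k" by (simp add: zero_prod_def courant_space_iff section_zero smooth_zero ker_D_zero)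
  show "x + y \<in> V k" if "x \<in> V k" "y \<in> V k" for x y
    using comb[OF that, of 1 1] by simp
  show "a *\<^sub>R x \<in> V k" if "x \<in> V k" for a x
    using comb[OF that that, of a 0] by simp
qed

lemma total_space_subset: "total_space V \<subseteq> Tot"
  unfolding total_space_def by (rule span_minimal[OF _ subspace_Tot]) (use courant_space_subset in blast)

lemma graded_vector_space_courant: "graded_vector_space V"
  unfolding graded_vector_space_def
proof (intro conjI allI impI ballI)
  fix S x k
  assume *: "finite S \<and> (\<forall>k\<in>S. x k \<in> V k) \<and> (\<Sum>k\<in>S. x k) = 0" and k: "k \<in> S"
  \<comment> \<open>Projection to the component of degree \<open>k\<close>.\<close>
  define p :: "('m, 'v) courant_elem \<Rightarrow> ('m, 'v) courant_elem" where
    "p y = (if k = 0 then fst y else 0, if k = 1 then fst (snd y) else 0, if k = 2 then snd (snd y) else 0)" for y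
  have p: "p (x j) = (if j = k then x k else 0)" if "j \<in> S" for j
    using * that by (cases "x j") (auto simp: p_def courant_space_iff zero_prod_def)
  have "0 = p (\<Sum>j\<in>S. x j)" using * by (simp add: p_def zero_prod_def)
  also have "\<dots> = (\<Sum>j\<in>S. p (x j))"
    by (rule sum_comp_morphism[of p, unfolded comp_def, symmetric]) (simp_all add: p_def zero_prod_def)
  also have "\<dots> = (\<Sum>j\<in>S. if j = k then x k else 0)" by (rule sum.cong) (simp_all add: p)
  also have "\<dots> = x k" using * k by simp
  finally show "x k = 0" by simp
qed (rule subspace_courant_space)

lemma d_linear: "x \<in> Tot \<Longrightarrow> y \<in> Tot \<Longrightarrow> d (a *\<^sub>R x + b *\<^sub>R y) = a *\<^sub>R d x + b *\<^sub>R d y"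
  by (cases x; cases y) (simp add: courant_D_comb)

lemma l2_skew: "x \<in> Tot \<Longrightarrow> y \<in> Tot \<Longrightarrow> l2 y x = - l2 x y"
  by (cases x; cases y) (simp add: bracket_skew[symmetric])

lemma l2_linear_left:
  "x \<in> Tot \<Longrightarrow> y \<in> Tot \<Longrightarrow> z \<in> Tot \<Longrightarrow> l2 (a *\<^sub>R x + b *\<^sub>R y) z = a *\<^sub>R l2 x z + b *\<^sub>R l2 y z"
  by (cases x; cases y; cases z)
    (simp add: bracket_linear_left courant_D_comb pair_linear_left pair_linear_right courant_D algebra_simps)

lemma l2_linear_right:
  assumes "x \<in> Tot" "y \<in> Tot" "z \<in> Tot"
  shows "l2 z (a *\<^sub>R x + b *\<^sub>R y) = a *\<^sub>R l2 z x + b *\<^sub>R l2 z y"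
  using l2_linear_left[OF assms, of a b] l2_skew[of "a *\<^sub>R x + b *\<^sub>R y" z]
    l2_skew[of x z] l2_skew[of y z] comb_in_Tot[of x y] assms by simp

lemma l3_cyclic: "l3 x y z = l3 y z x"
  by (cases x; cases y; cases z) (simp, rule courant_T_cyclic)

lemma l3_linear:
  "x \<in> Tot \<Longrightarrow> y \<in> Tot \<Longrightarrow> z \<in> Tot \<Longrightarrow> w \<in> Tot \<Longrightarrow>
    l3 (a *\<^sub>R x + b *\<^sub>R y) z w = a *\<^sub>R l3 x z w + b *\<^sub>R l3 y z w"
  by (cases x; cases y; cases z; cases w) (simp add: courant_T_linear)

lemma l3_swap: "x \<in> Tot \<Longrightarrow> y \<in> Tot \<Longrightarrow> z \<in> Tot \<Longrightarrow> l3 y x z = - l3 x y z"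
  by (cases x; cases y; cases z) (simp add: courant_T_swap[symmetric])

lemma l3_zero: "x \<in> Tot \<Longrightarrow> y \<in> Tot \<Longrightarrow> z \<in> Tot \<Longrightarrow> fst x = 0 \<or> fst y = 0 \<or> fst z = 0 \<Longrightarrow> l3 x y z = 0"
  by (cases x; cases y; cases z) (auto simp: courant_T_zero zero_prod_def)

lemma l2_zero: "x \<in> Tot \<Longrightarrow> y \<in> Tot \<Longrightarrow> fst x = 0 \<Longrightarrow> fst y = 0 \<Longrightarrow> l2 x y = 0"
  by (cases x; cases y) (auto simp: bracket_zero section_zero pair_zero courant_D zero_prod_def)

lemma d_in_Tot: "x \<in> Tot \<Longrightarrow> d x \<in> Tot"
  by (cases x) (auto simp: courant_D ker_D courant_D_zero smooth_zero)

lemma l2_in_Tot: "x \<in> Tot \<Longrightarrow> y \<in> Tot \<Longrightarrow> l2 x y \<in> Tot"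
  using smooth_comb[of _ _ "1/2" "- (1/2)"]
  by (cases x; cases y) (auto simp: bracket_closed smooth_pair courant_D ker_D_zero)

lemma l3_in_Tot: "x \<in> Tot \<Longrightarrow> y \<in> Tot \<Longrightarrow> z \<in> Tot \<Longrightarrow> l3 x y z \<in> Tot"
  using smooth_scale[of _ "- 1"]
  by (cases x; cases y; cases z) (auto simp: section_zero smooth_courant_T ker_D_zero)

section \<open>The generalized Jacobi relations without Koszul signs\<close>

lemma jacobi_1: "x \<in> Tot \<Longrightarrow> d (d x) = (0, 0, 0)"
  by (cases x) (simp add: courant_D_zero ker_D)

text \<open>Both sides only involve \<open>\<D> (\<rho>(e) f)\<close>: the left one by \<open>bracket_courant_D\<close>, the right
  one because \<open>\<langle>e, \<D> f\<rangle> = \<rho>(e) f\<close>.\<close>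

lemma jacobi_2:
  assumes "x0 \<in> Tot" "x1 \<in> Tot"
  shows "l2 (d x0) x1 - l2 (d x1) x0 = d (l2 x0 x1)"
proof -
  obtain e0 f0 c0 e1 f1 c1 where x: "x0 = (e0, f0, c0)" "x1 = (e1, f1, c1)"
    by (cases x0; cases x1) auto
  have m: "e0 \<in> \<Gamma>" "e1 \<in> \<Gamma>" "f0 \<in> C" "f1 \<in> C" "c0 \<in> K" "c1 \<in> K"
    using assms x by auto
  have *: "l2 (d (e, f, c)) (e', f', c') = (- (1/2) *\<^sub>R courant_D M E (along E e' f), 0, 0)"
    if "e \<in> \<Gamma>" "f \<in> C" "c \<in> K" "e' \<in> \<Gamma>" "f' \<in> C" for e f c e' f' c'
    using that bracket_skew[of "courant_D M E f" e'] bracket_courant_D[of e' f]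
    by (simp add: courant_D along_courant_D ker_D pair_zero)
  show ?thesis
    unfolding x *[OF m(1,3,5,2,4)] *[OF m(2,4,6,1,3)]
    using m courant_D_comb[of "along E e0 f1" "along E e1 f0" "1/2" "- (1/2)"]
    by (simp add: pair_courant_D smooth_along zero_prod_def)
qed

lemma l2_l2:
  assumes "e0 \<in> \<Gamma>" "e1 \<in> \<Gamma>" "e2 \<in> \<Gamma>" "f0 \<in> C" "f1 \<in> C" "f2 \<in> C"
  shows "l2 (l2 (e0, f0, c0) (e1, f1, c1)) (e2, f2, c2) =
    (bracket E (bracket E e0 e1) e2,
     (1/2) *\<^sub>R along E (bracket E e0 e1) f2
       - (1/4) *\<^sub>R along E e2 (along E e0 f1) + (1/4) *\<^sub>R along E e2 (along E e1 f0), 0)"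
proof -
  let ?g = "(1/2) *\<^sub>R along E e0 f1 + (- (1/2)) *\<^sub>R along E e1 f0"
  have g: "?g \<in> C" using assms by (intro smooth_comb smooth_along)
  have "along E e2 ?g = (1/2) *\<^sub>R along E e2 (along E e0 f1) + (- (1/2)) *\<^sub>R along E e2 (along E e1 f0)"
    using assms by (intro along_comb smooth_along)
  then have D: "pair E e2 (courant_D M E ((1/2) *\<^sub>R along E e0 f1 - (1/2) *\<^sub>R along E e1 f0)) =
      (1/2) *\<^sub>R along E e2 (along E e0 f1) - (1/2) *\<^sub>R along E e2 (along E e1 f0)"
    using pair_courant_D[OF g assms(3)] by simp
  show ?thesis
    using assms by (simp add: pair_courant_D bracket_closed D scaleR_diff_right)
qed

lemma l3_d:
  assumes "e0 \<in> \<Gamma>" "e1 \<in> \<Gamma>" "e2 \<in> \<Gamma>" "f0 \<in> C"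
  shows "l3 (d (e0, f0, c0)) (e1, f1, c1) (e2, f2, c2) = (0, - (1/4) *\<^sub>R along E (bracket E e1 e2) f0, 0)"
  using assms courant_T_cyclic[of "courant_D M E f0" e1 e2] by (simp add: courant_T_courant_D)

text \<open>The component of degree 0 is the axiom \<open>J = \<D> T\<close>.  In degree 1 the coefficient of each
  \<open>f\<^sub>k\<close> vanishes separately: for \<open>f\<^sub>2\<close> it is \<open>\<rho>[e\<^sub>0, e\<^sub>1] / 2\<close> from \<open>l\<^sub>2(l\<^sub>2(e\<^sub>0, e\<^sub>1), f\<^sub>2)\<close>,
  minus a quarter of the commutator of \<open>\<rho>(e\<^sub>0)\<close> and \<open>\<rho>(e\<^sub>1)\<close> from the other two such terms,
  minus \<open>\<rho>[e\<^sub>0, e\<^sub>1] / 4\<close> from \<open>l\<^sub>3(\<D> f\<^sub>2, e\<^sub>0, e\<^sub>1)\<close>.\<close>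

lemma jacobi_3:
  assumes "x0 \<in> Tot" "x1 \<in> Tot" "x2 \<in> Tot"
  shows "l3 (d x0) x1 x2 - l3 (d x1) x0 x2 + l3 (d x2) x0 x1
    + (l2 (l2 x0 x1) x2 - l2 (l2 x0 x2) x1 + l2 (l2 x1 x2) x0) + d (l3 x0 x1 x2) = 0"
proof -
  obtain e0 f0 c0 e1 f1 c1 e2 f2 c2 where
    x: "x0 = (e0, f0, c0)" "x1 = (e1, f1, c1)" "x2 = (e2, f2, c2)"
    by (cases x0; cases x1; cases x2) auto
  have m: "e0 \<in> \<Gamma>" "e1 \<in> \<Gamma>" "e2 \<in> \<Gamma>" "f0 \<in> C" "f1 \<in> C" "f2 \<in> C"
    using assms x by auto
  have "bracket E (bracket E e0 e2) e1 = - bracket E (bracket E e2 e0) e1"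
    using bracket_skew[OF m(1,3)] bracket_linear_left[of "bracket E e2 e0" "bracket E e2 e0" e1 "- 1" 0] m
    by (simp add: bracket_closed)
  then have J: "bracket E (bracket E e0 e1) e2 - bracket E (bracket E e0 e2) e1
      + bracket E (bracket E e1 e2) e0 = courant_D M E (courant_T E e0 e1 e2)"
    using jacobiator[OF m(1,2,3)] by (simp add: jacobiator_def algebra_simps)
  have "courant_D M E (- courant_T E e0 e1 e2) = - courant_D M E (courant_T E e0 e1 e2)"
    by (rule courant_D_simps(3)[OF smooth_courant_T[OF m(1,2,3)]])
  then have D: "d (0, - courant_T E e0 e1 e2, 0) = (- courant_D M E (courant_T E e0 e1 e2), 0, 0)"
    by simp
  \<comment> \<open>Rewriting halves as sums of quarters lets the terms cancel by linear arithmetic in a vector space.\<close>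
  have q: "(1/2) *\<^sub>R (v :: 'm \<Rightarrow> real) = (1/4) *\<^sub>R v + (1/4) *\<^sub>R v" for v
    by (simp flip: scaleR_add_left)
  show ?thesis
    unfolding x using m J
    by (simp add: l2_l2 l3_d D zero_prod_def along_bracket q algebra_simps del: courant_d.simps courant_l2.simps)
qed

text \<open>By degree only the \<open>X\<^sub>1\<close>-component can be non-zero, where this is
  \<open>courant_T_bracket_identity\<close>.\<close>

lemma jacobi_4:
  assumes "x0 \<in> Tot" "x1 \<in> Tot" "x2 \<in> Tot" "x3 \<in> Tot"
  shows "l3 (l2 x0 x1) x2 x3 - l3 (l2 x0 x2) x1 x3 + l3 (l2 x0 x3) x1 x2
      + l3 (l2 x1 x2) x0 x3 - l3 (l2 x1 x3) x0 x2 + l3 (l2 x2 x3) x0 x1 =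
    l2 (l3 x0 x1 x2) x3 - l2 (l3 x0 x1 x3) x2 + l2 (l3 x0 x2 x3) x1 - l2 (l3 x1 x2 x3) x0"
proof -
  obtain e0 f0 c0 e1 f1 c1 e2 f2 c2 e3 f3 c3 where
    x: "x0 = (e0, f0, c0)" "x1 = (e1, f1, c1)" "x2 = (e2, f2, c2)" "x3 = (e3, f3, c3)"
    by (cases x0; cases x1; cases x2; cases x3) auto
  have m: "e0 \<in> \<Gamma>" "e1 \<in> \<Gamma>" "e2 \<in> \<Gamma>" "e3 \<in> \<Gamma>" "f0 \<in> C" "f1 \<in> C" "f2 \<in> C" "f3 \<in> C"
    using assms x by auto
  have l2_l3: "l2 (l3 (e, f, c) (e', f', c') (e'', f'', c'')) (h, g, k) =
      (0, (1/2) *\<^sub>R along E h (courant_T E e e' e''), 0)"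
    if "e \<in> \<Gamma>" "e' \<in> \<Gamma>" "e'' \<in> \<Gamma>" "h \<in> \<Gamma>" "g \<in> C" for e f c e' f' c' e'' f'' c'' h g k
    using that
    by (simp add: bracket_zero pair_zero pair_simps courant_D courant_D_simps smooth_courant_T pair_courant_D)
  have l3_l2: "l3 (l2 (e, f, c) (e', f', c')) (h, g, k) (h', g', k') = (0, - courant_T E (bracket E e e') h h', 0)"
    for e f c e' f' c' h g k h' g' k'
    by simp
  have "- courant_T E (bracket E e0 e1) e2 e3 - - courant_T E (bracket E e0 e2) e1 e3
      + - courant_T E (bracket E e0 e3) e1 e2 + - courant_T E (bracket E e1 e2) e0 e3
      - - courant_T E (bracket E e1 e3) e0 e2 + - courant_T E (bracket E e2 e3) e0 e1 =
    (1/2) *\<^sub>R along E e3 (courant_T E e0 e1 e2) - (1/2) *\<^sub>R along E e2 (courant_T E e0 e1 e3)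
      + (1/2) *\<^sub>R along E e1 (courant_T E e0 e2 e3) - (1/2) *\<^sub>R along E e0 (courant_T E e1 e2 e3)"
    (is "?L = ?R")
  proof
    show "?L y = ?R y" for y
      using courant_T_bracket_identity[OF m(1-4), of y]
      by (simp only: plus_fun_apply minus_apply uminus_apply scaleR_fun_apply real_scaleR_def) argo
  qed
  then show ?thesis
    unfolding x using m by (simp add: l2_l3 l3_l2 del: courant_l2.simps courant_l3.simps)
qed

section \<open>The brackets as maps on exterior powers\<close>

lemma l_simps:
  "l (Suc 0) [x] = d x" "l 2 [x, y] = l2 x y" "l 3 [x, y, z] = l3 x y z"
  "k > 3 \<Longrightarrow> l k xs = 0"
  "l (Suc (Suc 0)) [x, y] = l2 x y" "l (Suc (Suc (Suc 0))) [x, y, z] = l3 x y z"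
  by (simp_all add: courant_l_def)

lemma l3_zero_degree:
  assumes "u \<in> V p" "v \<in> V q" "w \<in> V s" "p \<noteq> 0 \<or> q \<noteq> 0 \<or> s \<noteq> 0"
  shows "l3 u v w = 0"
proof (rule l3_zero)
  show "u \<in> Tot" "v \<in> Tot" "w \<in> Tot" using assms(1-3) courant_space_subset by blast+
  show "fst u = 0 \<or> fst v = 0 \<or> fst w = 0"
    using assms(4) courant_space_fst[OF assms(1)] courant_space_fst[OF assms(2)]
      courant_space_fst[OF assms(3)] by blast
qed

lemma zero_in_Tot: "0 \<in> Tot"
  by (rule subspace_0[OF subspace_Tot])

lemma d_zero: "d 0 = 0"
  using d_linear[OF zero_in_Tot zero_in_Tot, of 0 0] by simp

text \<open>As functions of triples, \<open>l\<^sub>2\<close> and \<open>l\<^sub>3\<close> are skew-symmetric without Koszul signs.  This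
  agrees with graded skew-symmetry: \<open>l\<^sub>2\<close> vanishes when both degrees are non-zero, and \<open>l\<^sub>3\<close>
  when any degree is, so whenever the value is non-zero the product of the exchanged degrees is
  0.\<close>

lemma wedge_map_courant:
  assumes "1 \<le> k"
  shows "wedge_map V k (int k - 2) (l k)"
  unfolding wedge_map_def
proof (intro conjI allI impI)
  fix xs i x y and a b :: real
  assume "length xs = k \<and> set xs \<subseteq> total_space V \<and> i < k \<and> x \<in> total_space V \<and> y \<in> total_space V"
  then have len: "length xs = k" and xs: "set xs \<subseteq> Tot" and i: "i < k" and xy: "x \<in> Tot" "y \<in> Tot"
    using total_space_subset by blast+
  consider "k = 1" | "k = 2" | "k = 3" | "k > 3" using assms by linarith
  then show "l k (xs[i := a *\<^sub>R x + b *\<^sub>R y]) = a *\<^sub>R l k (xs[i := x]) + b *\<^sub>R l k (xs[i := y])"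
  proof cases
    case 1
    then obtain z where "xs = [z]" using len by (auto simp: length_Suc_conv)
    then show ?thesis using 1 i d_linear[OF xy] by (simp add: l_simps del: courant_d.simps)
  next
    case 2
    then obtain u v where u: "xs = [u, v]" "u \<in> Tot" "v \<in> Tot"
      using len xs by (auto simp: length_Suc_conv numeral_2_eq_2)
    consider "i = 0" | "i = 1" using i 2 by linarith
    then show ?thesis
      using xy u 2 by cases (simp_all only: list_update.simps list_update_code l_simps l2_linear_left l2_linear_right One_nat_def nat.case)
  next
    case 3
    then obtain u v w where u: "xs = [u, v, w]" "u \<in> Tot" "v \<in> Tot" "w \<in> Tot"
      using len xs by (auto simp: length_Suc_conv numeral_3_eq_3)
    have mid: "l3 u (a *\<^sub>R x + b *\<^sub>R y) w = a *\<^sub>R l3 u x w + b *\<^sub>R l3 u y w"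
      using l3_linear[OF xy u(4,2)] l3_cyclic[of u _ w] by metis
    have last: "l3 u v (a *\<^sub>R x + b *\<^sub>R y) = a *\<^sub>R l3 u v x + b *\<^sub>R l3 u v y"
      using l3_linear[OF xy u(2,3)] l3_cyclic[of _ u v] by metis
    consider "i = 0" | "i = 1" | "i = 2" using i 3 by linarith
    then show ?thesis
    proof cases
      case 1
      then show ?thesis using 3 u(1) l3_linear[OF xy u(3,4)] by (simp only: list_update_code l_simps)
    next
      case 2
      then show ?thesis using 3 u(1) mid by (simp only: list_update_code l_simps One_nat_def)
    next
      case i2: 3
      then show ?thesis using 3 u(1) last by (simp only: list_update_code l_simps numeral_2_eq_2)
    qed
  next
    case 4
    then show ?thesis by (simp add: l_simps)
  qed
next
  fix ds xs i
  assume "homogeneous V ds xs \<and> length xs = k \<and> Suc i < k"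
  then have hom: "list_all2 (\<lambda>d x. x \<in> V d) ds xs" and len: "length xs = k" and i: "Suc i < k"
    by (auto simp: homogeneous_def)
  have sign: "s = - (((- 1) powi (p * q)) *\<^sub>R t)"
    if "s = - t" "p \<noteq> 0 \<Longrightarrow> q \<noteq> 0 \<Longrightarrow> t = 0" for s t :: "('m, 'v) courant_elem" and p q :: int
    using that by (cases "p = 0 \<or> q = 0") auto
  consider "k = 2" | "k = 3" | "k > 3" using i by linarith
  then show "l k (xs[i := xs ! Suc i, Suc i := xs ! i]) = - (((- 1) powi (ds ! i * ds ! Suc i)) *\<^sub>R l k xs)"
  proof cases
    case 1
    then obtain u v p q where u: "xs = [u, v]" "ds = [p, q]" "u \<in> V p" "v \<in> V q"
      using len hom by (auto simp: length_Suc_conv numeral_2_eq_2 list_all2_Cons2)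
    note T = subsetD[OF courant_space_subset u(3)] subsetD[OF courant_space_subset u(4)]
    have "i = 0" using i 1 by linarith
    moreover have "l2 v u = - (((- 1) powi (p * q)) *\<^sub>R l2 u v)"
      by (rule sign[OF l2_skew[OF T] l2_zero[OF T]]) (use u courant_space_fst in auto)
    ultimately show ?thesis using 1 u(1,2) by (simp add: l_simps del: courant_l2.simps)
  next
    case 2
    then obtain u v w p q s where u: "xs = [u, v, w]" "ds = [p, q, s]" "u \<in> V p" "v \<in> V q" "w \<in> V s"
      using len hom by (auto simp: length_Suc_conv numeral_3_eq_3 list_all2_Cons2)
    note T = subsetD[OF courant_space_subset u(3)] subsetD[OF courant_space_subset u(4)]
      subsetD[OF courant_space_subset u(5)]
    have z: "l3 u v w = 0" if "p \<noteq> 0 \<or> q \<noteq> 0 \<or> s \<noteq> 0"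
      by (rule l3_zero_degree[OF u(3-5) that])
    have s1: "l3 v u w = - (((- 1) powi (p * q)) *\<^sub>R l3 u v w)"
      by (rule sign[OF l3_swap[OF T]]) (use z in auto)
    have "l3 u w v = - l3 u v w"
      using l3_swap[OF T(2,3,1)] l3_cyclic[of u] by simp
    then have s2: "l3 u w v = - (((- 1) powi (q * s)) *\<^sub>R l3 u v w)"
      by (rule sign) (use z in auto)
    consider "i = 0" | "i = 1" using i 2 by linarith
    then show ?thesis
      using 2 u(1,2) s1 s2 by cases (simp_all add: l_simps del: courant_l3.simps)
  next
    case 3
    then show ?thesis by (simp add: l_simps)
  qed
next
  fix ds xs
  assume "homogeneous V ds xs \<and> length xs = k"
  then have hom: "list_all2 (\<lambda>d x. x \<in> V d) ds xs" and len: "length xs = k"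
    by (auto simp: homogeneous_def)
  consider "k = 1" | "k = 2" | "k = 3" | "k > 3" using assms by linarith
  then show "l k xs \<in> V (sum_list ds + (int k - 2))"
  proof cases
    case 1
    then obtain e f c p where u: "xs = [(e, f, c)]" "ds = [p]" "(e, f, c) \<in> V p"
      using len hom by (auto simp: length_Suc_conv list_all2_Cons2)
    then show ?thesis
      using 1 d_in_Tot[of "(e, f, c)"]
      by (auto simp: l_simps courant_space_iff courant_D_zero ker_D courant_D smooth_zero)
  next
    case 2
    then obtain e f c p e' f' c' q where u: "xs = [(e, f, c), (e', f', c')]" "ds = [p, q]"
      "(e, f, c) \<in> V p" "(e', f', c') \<in> V q"
      using len hom by (auto simp: length_Suc_conv numeral_2_eq_2 list_all2_Cons2)
    then have "l2 (e, f, c) (e', f', c') \<in> Tot" by (intro l2_in_Tot) (auto simp: courant_space_iff)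
    then show ?thesis
      using 2 u by (cases "p = 0"; cases "q = 0"; cases "p = 1"; cases "q = 1")
        (auto simp: l_simps courant_space_iff bracket_zero pair_zero courant_D courant_D_zero section_zero)
  next
    case 3
    then obtain u v w p q s where u: "xs = [u, v, w]" "ds = [p, q, s]" "u \<in> V p" "v \<in> V q" "w \<in> V s"
      using len hom by (auto simp: length_Suc_conv numeral_3_eq_3 list_all2_Cons2)
    note T = subsetD[OF courant_space_subset u(3)] subsetD[OF courant_space_subset u(4)]
      subsetD[OF courant_space_subset u(5)]
    show ?thesis
    proof (cases "p = 0 \<and> q = 0 \<and> s = 0")
      case True
      then show ?thesis
        using 3 u l3_in_Tot[OF T]
        by (cases u; cases v; cases w) (auto simp: l_simps courant_space_iff section_zero)
    next
      case False
      then have "l3 u v w = 0"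
        by (intro l3_zero_degree[OF u(3-5)]) blast
      then show ?thesis
        using 3 u(1) subspace_0[OF subspace_courant_space] by (simp add: l_simps del: courant_l3.simps)
    qed
  next
    case 4
    then show ?thesis using subspace_0[OF subspace_courant_space] by (simp add: l_simps)
  qed
qed

section \<open>The generalized Jacobi relations\<close>

text \<open>The summand \<open>l\<^sub>j (l\<^sub>i (\<dots>), \<dots>)\<close> of a generalized Jacobi relation for an already permuted
  list of arguments, where \<open>i + j\<close> exceeds the number of arguments by 1.\<close>

definition jacobi_term where "jacobi_term i ys = l (length ys + 1 - i) (l i (take i ys) # drop i ys)"

lemma l_zero_first:
  assumes "set ys \<subseteq> Tot" "0 < j" "j = Suc (length ys)"
  shows "l j (0 # ys) = 0"
proof -
  consider "j = 1" | "j = 2" | "j = 3" | "j > 3" using assms by linarith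
  then show ?thesis
  proof cases
    case 1
    then show ?thesis using assms(3) by (simp add: l_simps d_zero)
  next
    case 2
    then obtain u where u: "ys = [u]" "u \<in> Tot"
      using assms(1,3) by (auto simp: length_Suc_conv numeral_2_eq_2)
    have "l2 0 u = 0"
      using l2_linear_left[OF zero_in_Tot zero_in_Tot u(2), of 0 0] by simp
    then show ?thesis using 2 u(1) by (simp add: l_simps del: courant_l2.simps)
  next
    case 3
    then obtain u v where u: "ys = [u, v]" "u \<in> Tot" "v \<in> Tot"
      using assms(1,3) by (auto simp: length_Suc_conv numeral_3_eq_3)
    have "l3 0 u v = 0"
      using u zero_in_Tot by (intro l3_zero) auto
    then show ?thesis using 3 u(1) by (simp add: l_simps del: courant_l3.simps)
  next
    case 4
    then show ?thesis by (simp add: l_simps)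
  qed
qed

text \<open>Brackets of more than three arguments are 0.  If \<open>i\<close> and \<open>j\<close> are at most 3 and there are
  at least five arguments, then \<open>i = j = 3\<close>, and the inner \<open>l\<^sub>3\<close> is a function, on which the
  outer \<open>l\<^sub>3\<close> vanishes.\<close>

lemma jacobi_term_large:
  assumes ys: "set ys \<subseteq> Tot" and i: "1 \<le> i" "i \<le> length ys"
    and large: "i > 3 \<or> length ys + 1 - i > 3 \<or> length ys \<ge> 5"
  shows "jacobi_term i ys = 0"
proof -
  consider "i > 3" | "length ys + 1 - i > 3" | "i = 3" "length ys = 5" using i large by linarith
  then show ?thesis
  proof cases
    case 1
    have D: "set (drop i ys) \<subseteq> Tot" by (rule order_trans[OF set_drop_subset ys])
    have "l (length ys + 1 - i) (0 # drop i ys) = 0"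
      by (rule l_zero_first[OF D]) (use i in simp_all)
    then show ?thesis by (simp only: jacobi_term_def l_simps(4)[OF 1])
  next
    case 2
    then show ?thesis by (simp add: jacobi_term_def l_simps)
  next
    case 3
    then obtain a b c u v where y: "ys = [a, b, c, u, v]"
      by (auto simp: length_Suc_conv eval_nat_numeral)
    have T: "a \<in> Tot" "b \<in> Tot" "c \<in> Tot" "u \<in> Tot" "v \<in> Tot" using ys unfolding y by auto
    have "fst (l3 a b c) = 0" by (cases a; cases b; cases c) simp
    then have "l3 (l3 a b c) u v = 0" by (intro l3_zero l3_in_Tot T) blast
    then show ?thesis using 3 y by (simp add: jacobi_term_def l_simps del: courant_l3.simps)
  qed
qed

lemma along_zero: "along E 0 f = 0" "e \<in> \<Gamma> \<Longrightarrow> along E e 0 = 0"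
  using along_linear[OF section_zero section_zero, of 0 0 f] along_comb[OF _ smooth_zero smooth_zero, of e 0 0]
  by simp_all

lemma l2_l2_zero:
  assumes "x \<in> Tot" "y \<in> Tot" "z \<in> Tot"
    and "fst x = 0 \<and> fst y = 0 \<or> fst x = 0 \<and> fst z = 0 \<or> fst y = 0 \<and> fst z = 0"
  shows "l2 (l2 x y) z = 0"
proof -
  obtain e0 f0 c0 e1 f1 c1 e2 f2 c2 where
    x: "x = (e0, f0, c0)" "y = (e1, f1, c1)" "z = (e2, f2, c2)"
    by (cases x; cases y; cases z) auto
  have m: "e0 \<in> \<Gamma>" "e1 \<in> \<Gamma>" "e2 \<in> \<Gamma>" "f0 \<in> C" "f1 \<in> C" "f2 \<in> C"
    using assms(1-3) x by auto
  show ?thesis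
    unfolding x l2_l2[OF m]
    using assms(4) m unfolding x
    by (elim disjE conjE) (simp_all add: zero_prod_def bracket_zero bracket_closed section_zero along_zero)
qed

lemma l2_d_zero:
  "x \<in> Tot \<Longrightarrow> y \<in> Tot \<Longrightarrow> fst y = 0 \<Longrightarrow> l2 (d x) y = 0"
  by (cases x; cases y)
    (auto simp: zero_prod_def bracket_zero courant_D pair_zero along_courant_D ker_D)

text \<open>Two arguments without a component in \<open>X\<^sub>0\<close> either both enter the inner bracket, or one of
  them enters the outer bracket next to a value that is a function or a gradient; either way the
  term is 0.  The only case that is not immediate is \<open>l\<^sub>2 (d x, y)\<close>, which vanishes because
  \<open>\<langle>\<D> f, \<D> g\<rangle> = 0\<close>.\<close>

lemma jacobi_term_two_zero:
  assumes ys: "set ys \<subseteq> Tot" and i: "1 \<le> i" "i \<le> length ys"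
    and k: "k < length ys" "k' < length ys" "k \<noteq> k'" "fst (ys ! k) = 0" "fst (ys ! k') = 0"
  shows "jacobi_term i ys = 0"
proof -
  consider "i > 3 \<or> length ys + 1 - i > 3 \<or> length ys \<ge> 5" | "length ys = 2" "i = 1 \<or> i = 2"
    | "length ys = 3" "i = 1 \<or> i = 2 \<or> i = 3" | "length ys = 4" "i = 2 \<or> i = 3"
    using i k(1-3) by linarith
  then show ?thesis
  proof cases
    case 1
    then show ?thesis using jacobi_term_large[OF ys i] by blast
  next
    case 2
    then obtain a b where y: "ys = [a, b]" "a \<in> Tot" "b \<in> Tot"
      using ys by (auto simp: length_Suc_conv numeral_2_eq_2)
    then have z: "fst a = 0" "fst b = 0"
      using k by (auto simp: less_Suc_eq numeral_2_eq_2)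
    show ?thesis
      using 2(2) l2_zero[OF y(2,3) z] l2_d_zero[OF y(2,3) z(2)] d_zero
      by (auto simp: jacobi_term_def y(1) l_simps simp del: courant_l2.simps courant_d.simps)
  next
    case 3
    then obtain a b c where y: "ys = [a, b, c]" "a \<in> Tot" "b \<in> Tot" "c \<in> Tot"
      using ys by (auto simp: length_Suc_conv numeral_3_eq_3)
    then have z: "fst a = 0 \<and> fst b = 0 \<or> fst a = 0 \<and> fst c = 0 \<or> fst b = 0 \<and> fst c = 0"
      using k by (auto simp: less_Suc_eq numeral_3_eq_3)
    have "l3 (d a) b c = 0" by (rule l3_zero[OF d_in_Tot[OF y(2)] y(3,4)]) (use z in blast)
    moreover have "l3 a b c = 0" by (rule l3_zero[OF y(2-4)]) (use z in blast)
    ultimately show ?thesis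
      using 3(2) l2_l2_zero[OF y(2-4) z] d_zero
      by (auto simp: jacobi_term_def y(1) l_simps simp del: courant_l2.simps courant_l3.simps courant_d.simps)
  next
    case 4
    then obtain a b c e where y: "ys = [a, b, c, e]" "a \<in> Tot" "b \<in> Tot" "c \<in> Tot" "e \<in> Tot"
      using ys by (auto simp: length_Suc_conv eval_nat_numeral)
    then have z: "fst a = 0 \<and> fst b = 0 \<or> fst c = 0 \<or> fst e = 0" "fst a = 0 \<or> fst b = 0 \<or> fst c = 0"
      using k by (auto simp: less_Suc_eq eval_nat_numeral)
    have "l3 (l2 a b) c e = 0"
    proof (rule l3_zero[OF l2_in_Tot[OF y(2,3)] y(4,5)])
      show "fst (l2 a b) = 0 \<or> fst c = 0 \<or> fst e = 0"
        using z(1) l2_zero[OF y(2,3)] by (auto simp del: courant_l2.simps)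
    qed
    moreover have "l2 (l3 a b c) e = 0"
      using l3_zero[OF y(2-4) z(2)] l_zero_first[of "[e]" 2] y(5) by (simp add: l_simps del: courant_l2.simps)
    ultimately show ?thesis
      using 4(2)
      by (auto simp: jacobi_term_def y(1) l_simps simp del: courant_l2.simps courant_l3.simps courant_d.simps)
  qed
qed

definition jacobi_sum where
  "jacobi_sum ds xs i = (\<Sum>\<sigma>\<in>unshuffles i (length xs). (of_int (sign \<sigma>) * koszul_sign ds \<sigma>) *\<^sub>R
      l (length xs + 1 - i) (l i (map (\<lambda>a. xs ! \<sigma> a) [0..<i]) # map (\<lambda>a. xs ! \<sigma> a) [i..<length xs]))"

lemma jacobi_sum_eq_jacobi_term:
  assumes "i \<le> length xs"
  shows "jacobi_sum ds xs i = (\<Sum>\<sigma>\<in>unshuffles i (length xs). (of_int (sign \<sigma>) * koszul_sign ds \<sigma>) *\<^sub>R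
      jacobi_term i (map (\<lambda>a. xs ! \<sigma> a) [0..<length xs]))"
  unfolding jacobi_sum_def jacobi_term_def using assms by (simp add: take_map drop_map)

lemma map_nth_list_perm: "length ps = length xs \<Longrightarrow> map (\<lambda>a. xs ! list_perm ps a) [0..<length xs] = map ((!) xs) ps"
  by (rule nth_equalityI) (simp_all add: list_perm_def)

text \<open>With at most one argument of non-zero degree all Koszul signs are 1, and the sum over
  unshuffles becomes a sum over explicit lists.\<close>

lemma jacobi_sum_even:
  assumes i: "i \<le> length xs" and len: "length ds = length xs"
    and ds: "\<And>a b. a < length ds \<Longrightarrow> b < length ds \<Longrightarrow> a \<noteq> b \<Longrightarrow> ds ! a = 0 \<or> ds ! b = 0"
  shows "jacobi_sum ds xs i =
    (\<Sum>ps\<in>unshuffle_lists i (length xs). of_int (sign (list_perm ps)) *\<^sub>R jacobi_term i (map ((!) xs) ps))"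
proof -
  have "jacobi_sum ds xs i = (\<Sum>\<sigma>\<in>unshuffles i (length xs). of_int (sign \<sigma>) *\<^sub>R
      jacobi_term i (map (\<lambda>a. xs ! \<sigma> a) [0..<length xs]))"
    unfolding jacobi_sum_eq_jacobi_term[OF i]
  proof (rule sum.cong[OF refl])
    fix \<sigma> assume "\<sigma> \<in> unshuffles i (length xs)"
    then have "koszul_sign ds \<sigma> = 1"
      by (intro koszul_sign_eq_1 ds) (simp_all add: unshuffles_def len)
    then show "(of_int (sign \<sigma>) * koszul_sign ds \<sigma>) *\<^sub>R jacobi_term i (map (\<lambda>a. xs ! \<sigma> a) [0..<length xs]) =
        of_int (sign \<sigma>) *\<^sub>R jacobi_term i (map (\<lambda>a. xs ! \<sigma> a) [0..<length xs])" by simp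
  qed
  also have "\<dots> = (\<Sum>ps\<in>unshuffle_lists i (length xs). of_int (sign (list_perm ps)) *\<^sub>R
      jacobi_term i (map ((!) xs) ps))"
    unfolding sum_unshuffles[OF i]
    by (rule sum.cong[OF refl]) (simp add: map_nth_list_perm unshuffle_lists_def)
  finally show ?thesis .
qed

lemma jacobi_sum_two_zero:
  assumes xs: "set xs \<subseteq> Tot" and i: "1 \<le> i" "i \<le> length xs"
    and k: "k < length xs" "k' < length xs" "k \<noteq> k'" "fst (xs ! k) = 0" "fst (xs ! k') = 0"
  shows "jacobi_sum ds xs i = 0"
  unfolding jacobi_sum_eq_jacobi_term[OF i(2)]
proof (rule sum.neutral, rule ballI)
  fix \<sigma> assume "\<sigma> \<in> unshuffles i (length xs)"
  then have \<sigma>: "\<sigma> permutes {..<length xs}" by (simp add: unshuffles_def)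
  have inv: "\<exists>m<length xs. \<sigma> m = n" if "n < length xs" for n
  proof -
    have "n \<in> \<sigma> ` {..<length xs}" using permutes_image[OF \<sigma>] that by simp
    then show ?thesis by auto
  qed
  obtain m m' where m: "m < length xs" "m' < length xs" "\<sigma> m = k" "\<sigma> m' = k'"
    using inv[OF k(1)] inv[OF k(2)] by blast
  have "jacobi_term i (map (\<lambda>a. xs ! \<sigma> a) [0..<length xs]) = 0"
  proof (rule jacobi_term_two_zero[of _ _ m m'])
    show "set (map (\<lambda>a. xs ! \<sigma> a) [0..<length xs]) \<subseteq> Tot"
      using xs by (simp only: set_map_permutes[OF \<sigma>])
  qed (use i k m in auto)
  then show "(of_int (sign \<sigma>) * koszul_sign ds \<sigma>) *\<^sub>R
      jacobi_term i (map (\<lambda>a. xs ! \<sigma> a) [0..<length xs]) = 0" by simp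
qed

lemma jacobi_sum_large:
  assumes xs: "set xs \<subseteq> Tot" and i: "1 \<le> i" "i \<le> length xs"
    and large: "i > 3 \<or> length xs + 1 - i > 3 \<or> length xs \<ge> 5"
  shows "jacobi_sum ds xs i = 0"
  unfolding jacobi_sum_eq_jacobi_term[OF i(2)]
proof (rule sum.neutral, rule ballI)
  fix \<sigma> assume "\<sigma> \<in> unshuffles i (length xs)"
  then have \<sigma>: "\<sigma> permutes {..<length xs}" by (simp add: unshuffles_def)
  have "jacobi_term i (map (\<lambda>a. xs ! \<sigma> a) [0..<length xs]) = 0"
  proof (rule jacobi_term_large)
    show "set (map (\<lambda>a. xs ! \<sigma> a) [0..<length xs]) \<subseteq> Tot"
      using xs by (simp only: set_map_permutes[OF \<sigma>])
  qed (use i large in auto)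
  then show "(of_int (sign \<sigma>) * koszul_sign ds \<sigma>) *\<^sub>R
      jacobi_term i (map (\<lambda>a. xs ! \<sigma> a) [0..<length xs]) = 0" by simp
qed

text \<open>If two arguments have non-zero degree, or there are at least five arguments, all summands
  vanish. Otherwise the relation is \<open>jacobi_1\<close>, \<open>jacobi_2\<close>, \<open>jacobi_3\<close> or \<open>jacobi_4\<close>, once the
  unshuffles are listed.\<close>

lemma generalized_jacobi:
  assumes hom: "homogeneous V ds xs" and n: "length xs = n" "1 \<le> n"
  shows "(\<Sum>(i, j)\<in>{(i, j). 1 \<le> i \<and> 1 \<le> j \<and> i + j = n + 1}.
    (-1) ^ (i * (j - 1)) *\<^sub>R
    (\<Sum>\<sigma>\<in>unshuffles i n. (of_int (sign \<sigma>) * koszul_sign ds \<sigma>) *\<^sub>R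
      l j (l i (map (\<lambda>a. xs ! \<sigma> a) [0..<i]) # map (\<lambda>a. xs ! \<sigma> a) [i..<n]))) = 0"
    (is "(\<Sum>(i, j)\<in>?I. _ *\<^sub>R ?S i j) = 0")
proof -
  have len: "length ds = length xs" and V: "\<And>k. k < length xs \<Longrightarrow> xs ! k \<in> V (ds ! k)"
    using hom by (auto simp: homogeneous_def list_all2_conv_all_nth)
  have xs: "set xs \<subseteq> Tot"
    using V courant_space_subset by (fastforce simp: in_set_conv_nth)
  have "(\<Sum>(i, j)\<in>?I. (-1) ^ (i * (j - 1)) *\<^sub>R ?S i j) = (\<Sum>(i, j)\<in>?I. (-1) ^ (i * (j - 1)) *\<^sub>R jacobi_sum ds xs i)"
  proof (rule sum.cong[OF refl])
    fix p assume "p \<in> ?I"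
    then obtain i j where p: "p = (i, j)" "i + j = n + 1" by blast
    then have "j = length xs + 1 - i" using n(1) by linarith
    then have "?S i j = jacobi_sum ds xs i" by (simp only: jacobi_sum_def n(1))
    then show "(case p of (i, j) \<Rightarrow> (-1) ^ (i * (j - 1)) *\<^sub>R ?S i j) =
        (case p of (i, j) \<Rightarrow> (-1) ^ (i * (j - 1)) *\<^sub>R jacobi_sum ds xs i)" by (simp only: p(1) prod.case)
  qed
  also have "\<dots> = 0"
  proof (cases "n \<ge> 5 \<or> (\<exists>k k'. k < n \<and> k' < n \<and> k \<noteq> k' \<and> ds ! k \<noteq> 0 \<and> ds ! k' \<noteq> 0)")
    case True
    have "jacobi_sum ds xs i = 0" if i: "1 \<le> i" "i \<le> n" for i
      using True
    proof
      assume "n \<ge> 5"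
      then show ?thesis using jacobi_sum_large[OF xs] i n by blast
    next
      assume "\<exists>k k'. k < n \<and> k' < n \<and> k \<noteq> k' \<and> ds ! k \<noteq> 0 \<and> ds ! k' \<noteq> 0"
      then obtain k k' where k: "k < n" "k' < n" "k \<noteq> k'" "ds ! k \<noteq> 0" "ds ! k' \<noteq> 0" by blast
      then have "fst (xs ! k) = 0" "fst (xs ! k') = 0" using V courant_space_fst n by blast+
      then show ?thesis using jacobi_sum_two_zero[OF xs, of i k k'] i k n by blast
    qed
    then show ?thesis by (intro sum.neutral) auto
  next
    case False
    then have even: "jacobi_sum ds xs i = (\<Sum>ps\<in>unshuffle_lists i n.
        of_int (sign (list_perm ps)) *\<^sub>R jacobi_term i (map ((!) xs) ps))" if "i \<le> n" for i
      using jacobi_sum_even[of i xs ds] that n len by auto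
    have large: "jacobi_sum ds xs i = 0" if "1 \<le> i" "i \<le> n" "i > 3 \<or> n + 1 - i > 3" for i
      using jacobi_sum_large[OF xs, of i ds] that n by auto
    consider "n = 1" | "n = 2" | "n = 3" | "n = 4" using False n(2) by linarith
    then show ?thesis
    proof cases
      case 1
      then obtain x0 where x: "xs = [x0]" "x0 \<in> Tot"
        using n xs by (auto simp: length_Suc_conv)
      have I: "{(i, j). 1 \<le> i \<and> 1 \<le> j \<and> i + j = (1 :: nat) + 1} = {(1, 1)}" by auto
      have "jacobi_sum ds xs 1 = 0"
        unfolding even[unfolded 1, OF order_refl] unshuffle_lists_1_1
        using jacobi_1[OF x(2)] by (simp add: sign_list_perm jacobi_term_def x(1) l_simps zero_prod_def)
      then show ?thesis unfolding 1 I by simp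
    next
      case 2
      then obtain x0 x1 where x: "xs = [x0, x1]" "x0 \<in> Tot" "x1 \<in> Tot"
        using n xs by (auto simp: length_Suc_conv numeral_2_eq_2)
      have I: "{(i, j). 1 \<le> i \<and> 1 \<le> j \<and> i + j = (2 :: nat) + 1} = {(1, 2), (2, 1)}" by auto
      have "jacobi_sum ds xs 1 = l2 (d x0) x1 - l2 (d x1) x0"
        by (subst even) (simp_all add: 2 unshuffle_lists_1_2[simplified] sign_list_perm sign_list_perm[simplified] jacobi_term_def x(1) l_simps
            del: courant_l2.simps courant_d.simps)
      moreover have "jacobi_sum ds xs 2 = d (l2 x0 x1)"
        by (subst even) (simp_all add: 2 unshuffle_lists_2_2 sign_list_perm sign_list_perm[simplified] jacobi_term_def x(1) l_simps
            del: courant_l2.simps courant_d.simps)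
      ultimately show ?thesis
        unfolding 2 I using jacobi_2[OF x(2,3)] by simp
    next
      case 3
      then obtain x0 x1 x2 where x: "xs = [x0, x1, x2]" "x0 \<in> Tot" "x1 \<in> Tot" "x2 \<in> Tot"
        using n xs by (auto simp: length_Suc_conv numeral_3_eq_3)
      have I: "{(i, j). 1 \<le> i \<and> 1 \<le> j \<and> i + j = (3 :: nat) + 1} = {(1, 3), (2, 2), (3, 1)}" by auto
      have "jacobi_sum ds xs 1 = l3 (d x0) x1 x2 - l3 (d x1) x0 x2 + l3 (d x2) x0 x1"
        by (subst even) (simp_all add: 3 unshuffle_lists_1_3[simplified] sign_list_perm sign_list_perm[simplified] jacobi_term_def x(1) l_simps
            del: courant_l2.simps courant_l3.simps courant_d.simps)
      moreover have "jacobi_sum ds xs 2 = l2 (l2 x0 x1) x2 - l2 (l2 x0 x2) x1 + l2 (l2 x1 x2) x0"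
        by (subst even) (simp_all add: 3 unshuffle_lists_2_3 sign_list_perm sign_list_perm[simplified] jacobi_term_def x(1) l_simps
            del: courant_l2.simps courant_l3.simps courant_d.simps)
      moreover have "jacobi_sum ds xs 3 = d (l3 x0 x1 x2)"
        by (subst even) (simp_all add: 3 unshuffle_lists_3_3 sign_list_perm sign_list_perm[simplified] jacobi_term_def x(1) l_simps
            del: courant_l2.simps courant_l3.simps courant_d.simps)
      ultimately show ?thesis
        unfolding 3 I using jacobi_3[OF x(2-4)] by (simp add: add.assoc)
    next
      case 4
      then obtain x0 x1 x2 x3 where x: "xs = [x0, x1, x2, x3]" "x0 \<in> Tot" "x1 \<in> Tot" "x2 \<in> Tot" "x3 \<in> Tot"
        using n xs by (auto simp: length_Suc_conv eval_nat_numeral)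
      have I: "{(i, j). 1 \<le> i \<and> 1 \<le> j \<and> i + j = (4 :: nat) + 1} = {(1, 4), (2, 3), (3, 2), (4, 1)}" by auto
      have "jacobi_sum ds xs 2 = l3 (l2 x0 x1) x2 x3 - l3 (l2 x0 x2) x1 x3 + l3 (l2 x0 x3) x1 x2
          + l3 (l2 x1 x2) x0 x3 - l3 (l2 x1 x3) x0 x2 + l3 (l2 x2 x3) x0 x1"
        by (subst even) (simp_all add: 4 unshuffle_lists_2_4 sign_list_perm sign_list_perm[simplified] jacobi_term_def x(1) l_simps
            del: courant_l2.simps courant_l3.simps courant_d.simps)
      moreover have "jacobi_sum ds xs 3 =
          l2 (l3 x0 x1 x2) x3 - l2 (l3 x0 x1 x3) x2 + l2 (l3 x0 x2 x3) x1 - l2 (l3 x1 x2 x3) x0"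
        by (subst even) (simp_all add: 4 unshuffle_lists_3_4 sign_list_perm sign_list_perm[simplified] jacobi_term_def x(1) l_simps
            del: courant_l2.simps courant_l3.simps courant_d.simps)
      moreover have "jacobi_sum ds xs 1 = 0" "jacobi_sum ds xs 4 = 0"
        using 4 by (simp_all add: large)
      ultimately show ?thesis
        unfolding 4 I using jacobi_4[OF x(2-5)] by simp
    qed
  qed
  finally show ?thesis .
qed

lemma L_infty: "L_infty_algebra V l"
  unfolding L_infty_algebra_def
  using graded_vector_space_courant wedge_map_courant generalized_jacobi by blast

text \<open>In degree 1 the kernel of \<open>d\<close> is \<open>ker \<D>\<close>, which is the image of the inclusion \<open>d\<^sub>2\<close>;
  the inclusion is injective; and all other components, being zero, contribute nothing.\<close>

lemma exact:
  assumes "k \<noteq> 0"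
  shows "{x \<in> V k. d x = 0} = d ` V (k + 1)"
proof (intro equalityI subsetI)
  fix x assume "x \<in> {x \<in> V k. d x = 0}"
  then obtain e f c where x: "x = (e, f, c)" "(e, f, c) \<in> V k" "d (e, f, c) = 0"
    by (cases x) auto
  then have m: "e = 0" "c = 0" "f \<in> C" "courant_D M E f = 0" "k \<noteq> 1 \<Longrightarrow> f = 0"
    using assms by (auto simp: courant_space_iff zero_prod_def)
  then have "(0, 0, f) \<in> V (k + 1)"
    by (auto simp: courant_space_iff section_zero smooth_zero ker_D)
  moreover have "x = d (0, 0, f)" using x(1) m by (simp add: courant_D_zero)
  ultimately show "x \<in> d ` V (k + 1)" by blast
next
  fix x assume "x \<in> d ` V (k + 1)"
  then obtain e f c where x: "x = d (e, f, c)" "(e, f, c) \<in> V (k + 1)" by auto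
  then have m: "f = 0" "c \<in> K" "k \<noteq> 1 \<Longrightarrow> c = 0" using assms by (auto simp: courant_space_iff)
  then show "x \<in> {x \<in> V k. d x = 0}"
    using x(1) by (auto simp: courant_space_iff courant_D_zero section_zero ker_D ker_D_zero smooth_zero zero_prod_def)
qed

end

theorem theorem2p4p3:
  fixes M :: "('m::{t2_space, second_countable_topology}) manifold"
    and E :: "('m, 'v::real_vector) courant"
  assumes "courant_algebroid M E"
  shows "L_infty_algebra (courant_space M E) (courant_l M E) \<and>
    (\<forall>k. \<forall>x\<in>courant_space M E k. courant_l M E 1 [x] = courant_d M E x) \<and>
    (\<forall>f\<in>smooth_functions M. courant_d M E (0, f, 0) = (courant_D M E f, 0, 0)) \<and>
    (\<forall>c\<in>ker_D M E. courant_d M E (0, 0, c) = (0, c, 0)) \<and>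
    (\<forall>k. k \<noteq> 0 \<longrightarrow>
       {x \<in> courant_space M E k. courant_d M E x = 0} = courant_d M E ` courant_space M E (k + 1)) \<and>
    courant_d M E ` courant_space M E 1 = {(courant_D M E f, 0, 0) |f. f \<in> smooth_functions M} \<and>
    (\<forall>e1\<in>sections M E. \<forall>e2\<in>sections M E.
       courant_l M E 2 [(e1, 0, 0), (e2, 0, 0)] = (bracket E e1 e2, 0, 0)) \<and>
    (\<forall>e\<in>sections M E. \<forall>f\<in>smooth_functions M.
       courant_l M E 2 [(e, 0, 0), (0, f, 0)] = (0, (1/2) *\<^sub>R pair E e (courant_D M E f), 0)) \<and>
    (\<forall>ds xs. homogeneous (courant_space M E) ds xs \<and> length xs = 2 \<and> sum_list ds > 1 \<longrightarrow>
       courant_l M E 2 xs = 0) \<and>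
    (\<forall>e1\<in>sections M E. \<forall>e2\<in>sections M E. \<forall>e3\<in>sections M E.
       courant_l M E 3 [(e1, 0, 0), (e2, 0, 0), (e3, 0, 0)] = (0, - courant_T E e1 e2 e3, 0)) \<and>
    (\<forall>ds xs. homogeneous (courant_space M E) ds xs \<and> length xs = 3 \<and> sum_list ds > 0 \<longrightarrow>
       courant_l M E 3 xs = 0) \<and>
    (\<forall>n>3. \<forall>ds xs. homogeneous (courant_space M E) ds xs \<and> length xs = n \<longrightarrow>
       courant_l M E n xs = 0)"
proof -
  interpret courant_algebroid_locale M E by unfold_locales (rule assms)
  have l2_high: "l 2 xs = 0" if h: "homogeneous V ds xs" "length xs = 2" "sum_list ds > 1" for ds xs
  proof -
    obtain e f c p e' f' c' q where u: "xs = [(e, f, c), (e', f', c')]" "ds = [p, q]"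
      "(e, f, c) \<in> V p" "(e', f', c') \<in> V q"
      using h(1,2) by (auto simp: homogeneous_def length_Suc_conv numeral_2_eq_2 list_all2_Cons2)
    then have "p + q > 1" using h(3) by simp
    then consider "p \<noteq> 0" "q \<noteq> 0" | "p = 0" "q \<noteq> 0" "q \<noteq> 1" | "q = 0" "p \<noteq> 0" "p \<noteq> 1"
      by linarith
    then show ?thesis
      using u by cases (auto simp: l_simps courant_space_iff bracket_zero pair_zero courant_D
          courant_D_zero section_zero zero_prod_def)
  qed
  have l3_high: "l 3 xs = 0" if h: "homogeneous V ds xs" "length xs = 3" "sum_list ds > 0" for ds xs
  proof -
    obtain u v w p q s where u: "xs = [u, v, w]" "ds = [p, q, s]" "u \<in> V p" "v \<in> V q" "w \<in> V s"
      using h(1,2) by (auto simp: homogeneous_def length_Suc_conv numeral_3_eq_3 list_all2_Cons2)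
    have "p \<noteq> 0 \<or> q \<noteq> 0 \<or> s \<noteq> 0" using h(3) u(2) by auto
    then have "l3 u v w = 0" by (rule l3_zero_degree[OF u(3-5)])
    then show ?thesis using u(1) by (simp add: l_simps del: courant_l3.simps)
  qed
  have image: "d ` V 1 = {(courant_D M E f, 0, 0) |f. f \<in> C}"
  proof (intro equalityI subsetI)
    fix x assume "x \<in> d ` V 1"
    then obtain e f c where "x = d (e, f, c)" "(e, f, c) \<in> V 1" by auto
    then show "x \<in> {(courant_D M E f, 0, 0) |f. f \<in> C}" by (auto simp: courant_space_iff)
  next
    fix x :: "('m, 'v) courant_elem"
    assume "x \<in> {(courant_D M E f, 0, 0) |f. f \<in> C}"
    then obtain f where f: "f \<in> C" "x = d (0, f, 0)" by auto
    then have "(0, f, 0) \<in> V 1" by (simp add: courant_space_iff section_zero ker_D_zero)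
    then show "x \<in> d ` V 1" using f(2) by blast
  qed
  show ?thesis
  proof (intro conjI)
    show "\<forall>f\<in>C. d (0, f, 0) = (courant_D M E f, 0, 0)" by simp
    show "\<forall>c\<in>K. d (0, 0, c) = (0, c, 0)" by (simp add: courant_D_zero)
    show "\<forall>k. k \<noteq> 0 \<longrightarrow> {x \<in> V k. d x = 0} = d ` V (k + 1)" using exact by blast
    show "\<forall>e1\<in>\<Gamma>. \<forall>e2\<in>\<Gamma>. l 2 [(e1, 0, 0), (e2, 0, 0)] = (bracket E e1 e2, 0, 0)"
      by (simp add: l_simps courant_D_zero pair_zero)
    show "\<forall>e\<in>\<Gamma>. \<forall>f\<in>C. l 2 [(e, 0, 0), (0, f, 0)] = (0, (1/2) *\<^sub>R pair E e (courant_D M E f), 0)"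
      by (simp add: l_simps courant_D_zero pair_zero bracket_zero section_zero)
    show "\<forall>k. \<forall>x\<in>V k. l 1 [x] = d x" by (simp add: courant_l_def)
    show "\<forall>ds xs. homogeneous V ds xs \<and> length xs = 2 \<and> sum_list ds > 1 \<longrightarrow> l 2 xs = 0"
      using l2_high by blast
    show "\<forall>e1\<in>\<Gamma>. \<forall>e2\<in>\<Gamma>. \<forall>e3\<in>\<Gamma>.
        l 3 [(e1, 0, 0), (e2, 0, 0), (e3, 0, 0)] = (0, - courant_T E e1 e2 e3, 0)"
      by (simp add: l_simps)
    show "\<forall>ds xs. homogeneous V ds xs \<and> length xs = 3 \<and> sum_list ds > 0 \<longrightarrow> l 3 xs = 0"
      using l3_high by blast
    show "\<forall>n>3. \<forall>ds xs. homogeneous V ds xs \<and> length xs = n \<longrightarrow> l n xs = 0"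
      by (simp add: l_simps)
  qed (rule L_infty, rule image)
qed

end
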